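(* Let $T\in\mathbf{R}^{n+p}$ be a constant vector and suppose that the submanifold $\Sigma^n\subset\mathbf{R}^{n+p}$ is a critical point for $F$. If $\Sigma_s$ is a compactly supported normal variation of $\Sigma=\Sigma_0$ with $\partial_s|_{s=0}\Sigma_s=V$, then $F''=\partial_{ss}|_{s=0}F(\Sigma_s)$ is given by $$F''=\int_\Sigma-\langle V, LV\rangle\, e^{\langle T,x\rangle}\,d\mu,$$ where $$LV=\Delta^\perp V+\nabla^\perp_{T^T}V+\big\langle\langle A,V\rangle,A\big\rangle=\left(\Delta V^\alpha+\langle T,\nabla V^\alpha\rangle+g^{ik}g^{jl}V^\beta h^\beta_{ij}h^\alpha_{kl}\right)e_\alpha .$$
   Context: Submanifolds and variations are smooth, and submanifolds are without boundary. $F(\Sigma)=\int_\Sigma e^{\langle T,x\rangle}d\mu$, where $x$ is the position vector and $d\mu$ the induced volume measure. If $F(\Sigma)=\infty$, derivatives of $F(\Sigma_s)$ are those of the integral over a compact region containing the support of the variation (outside of which $\Sigma_s$ does not change). $\Sigma$ is a critical point for $F$ if $\partial_s|_{s=0}F(\Sigma_s)=0$ for every compactly supported variation with normal variation vector field. $(\cdot)^T$, $(\cdot)^\perp$ are the tangential and normal projections; $\nabla^\perp$ and $\Delta^\perp$ are the normal connection and the rough Laplacian on the normal bundle. $g$ is the induced metric, $A(X,Y)=(\overline\nabla_XY)^\perp$ the second fundamental form ($\overline\nabla$ the Euclidean connection), $\{e_\alpha\}$ a local orthonormal normal frame, $V=V^\alpha e_\alpha$, and $h^\alpha_{ij}=\langle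 A(\partial_i,\partial_j),e_\alpha\rangle$; repeated indices are summed. In the component expression, $\Delta V^\alpha$ and $\nabla V^\alpha$ denote the components of the covariant derivatives $\Delta^\perp V$ and $\nabla^\perp V$, and $\langle\langle A,V\rangle,A\rangle=g^{ik}g^{jl}V^\beta h^\beta_{ij}h^\alpha_{kl}e_\alpha$. *)

theory Defs
  imports "HOL-Analysis.Analysis"
begin

section \<open>Smooth maps\<close>

text \<open>\<open>diff_times_on k S f\<close>: \<open>f\<close> is of class $C^k$ on \<open>S\<close>. Only meant for open \<open>S\<close>.\<close>

primrec diff_times_on ::
  "nat \<Rightarrow> 'a::real_normed_vector set \<Rightarrow> ('a \<Rightarrow> 'b::real_normed_vector) \<Rightarrow> bool" where
  "diff_times_on 0 S f \<longleftrightarrow> continuous_on S f"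
| "diff_times_on (Suc k) S f \<longleftrightarrow>
     continuous_on S f \<and> (\<forall>x\<in>S. f differentiable (at x)) \<and>
     (\<forall>v. diff_times_on k S (\<lambda>x. frechet_derivative f (at x) v))"

definition smooth_on :: "'a::real_normed_vector set \<Rightarrow> ('a \<Rightarrow> 'b::real_normed_vector) \<Rightarrow> bool" where
  "smooth_on S f \<longleftrightarrow> (\<forall>k. diff_times_on k S f)"

section \<open>Immersed submanifolds\<close>

text \<open>
  An immersed submanifold of the Euclidean space \<open>'a\<close> is a smooth manifold \<open>M\<close> without boundary,
  of dimension \<open>CARD('n)\<close>, together with a smooth immersion \<open>X\<close> of \<open>M\<close> (the position vector).
  An embedded submanifold is the special case where \<open>M\<close> is a subset of \<open>'a\<close> and \<open>X q = q\<close>.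
  \<open>M\<close> is a subset of a second countable Hausdorff space with its subspace topology; its smooth
  structure is given by an atlas of local parametrizations \<open>(W, \<psi>)\<close>, where \<open>\<psi>\<close> maps the open set
  \<open>W\<close> of $\mathbf{R}^n$ homeomorphically onto an open subset of \<open>M\<close>. Here and below, the values
  of \<open>\<psi>\<close> outside \<open>W\<close>, and of maps on \<open>M\<close> outside \<open>M\<close>, are irrelevant.
\<close>

type_synonym ('n, 'm) atlas = "((real^'n) set \<times> (real^'n \<Rightarrow> 'm)) set"

definition smooth_atlas ::
  "'m::{t2_space,second_countable_topology} set \<Rightarrow> ('n::finite, 'm) atlas \<Rightarrow> bool" where
  "smooth_atlas M \<A> \<longleftrightarrow>
     (\<forall>(W,\<psi>)\<in>\<A>. open W \<and> openin (top_of_set M) (\<psi> ` W) \<and> (\<exists>\<theta>. homeomorphism W (\<psi> ` W) \<psi> \<theta>)) \<and>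
     (\<Union>(W,\<psi>)\<in>\<A>. \<psi> ` W) = M \<and>
     (\<forall>(W1,\<psi>1)\<in>\<A>. \<forall>(W2,\<psi>2)\<in>\<A>.
        smooth_on {u\<in>W1. \<psi>1 u \<in> \<psi>2 ` W2} (\<lambda>u. inv_into W2 \<psi>2 (\<psi>1 u)))"

definition smooth_immersion :: "('n::finite, 'm) atlas \<Rightarrow> ('m \<Rightarrow> 'a::euclidean_space) \<Rightarrow> bool" where
  "smooth_immersion \<A> X \<longleftrightarrow>
     (\<forall>(W,\<psi>)\<in>\<A>. smooth_on W (X \<circ> \<psi>) \<and> (\<forall>u\<in>W. inj (frechet_derivative (X \<circ> \<psi>) (at u))))"

definition immersed_submanifold ::
  "'m::{t2_space,second_countable_topology} set \<Rightarrow> ('n::finite, 'm) atlas \<Rightarrow>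
   ('m \<Rightarrow> 'a::euclidean_space) \<Rightarrow> bool" where
  "immersed_submanifold M \<A> X \<longleftrightarrow> smooth_atlas M \<A> \<and> smooth_immersion \<A> X"

section \<open>Local geometry\<close>

text \<open>
  In this section \<open>\<phi>\<close> stands for the immersion \<open>X \<circ> \<psi>\<close> of the parameter domain, \<open>u\<close> for a
  parameter, and all vector fields along the submanifold (\<open>x\<close>, \<open>y\<close>, \<open>Z\<close>, \<open>V\<close>) are given as
  \<open>'a\<close>-valued functions of \<open>u\<close>. The coordinate field $\partial_i$ is thus \<open>pd \<phi> i\<close>.
\<close>

definition pd :: "(real^'n::finite \<Rightarrow> 'a::euclidean_space) \<Rightarrow> 'n \<Rightarrow> real^'n \<Rightarrow> 'a" where
  "pd \<phi> i u = frechet_derivative \<phi> (at u) (axis i 1)"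

definition tangent_space :: "(real^'n::finite \<Rightarrow> 'a::euclidean_space) \<Rightarrow> real^'n \<Rightarrow> 'a set" where
  "tangent_space \<phi> u = range (frechet_derivative \<phi> (at u))"

definition normal_space :: "(real^'n::finite \<Rightarrow> 'a::euclidean_space) \<Rightarrow> real^'n \<Rightarrow> 'a set" where
  "normal_space \<phi> u = (tangent_space \<phi> u)\<^sup>\<bottom>"

definition tan_proj :: "(real^'n::finite \<Rightarrow> 'a::euclidean_space) \<Rightarrow> real^'n \<Rightarrow> 'a \<Rightarrow> 'a" where
  "tan_proj \<phi> u v = (THE w. w \<in> tangent_space \<phi> u \<and> v - w \<in> normal_space \<phi> u)"

definition nor_proj :: "(real^'n::finite \<Rightarrow> 'a::euclidean_space) \<Rightarrow> real^'n \<Rightarrow> 'a \<Rightarrow> 'a" where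
  "nor_proj \<phi> u v = v - tan_proj \<phi> u v"

definition metric :: "(real^'n::finite \<Rightarrow> 'a::euclidean_space) \<Rightarrow> real^'n \<Rightarrow> real^'n^'n" where
  "metric \<phi> u = (\<chi> i j. pd \<phi> i u \<bullet> pd \<phi> j u)"

definition inv_metric ::
  "(real^'n::finite \<Rightarrow> 'a::euclidean_space) \<Rightarrow> real^'n \<Rightarrow> 'n \<Rightarrow> 'n \<Rightarrow> real" where
  "inv_metric \<phi> u i j = matrix_inv (metric \<phi> u) $ i $ j"

text \<open>
  The Euclidean connection $\overline\nabla_x Z$ for a tangent field \<open>x\<close> and an arbitrary
  \<open>'a\<close>-valued field \<open>Z\<close> along the submanifold: \<open>Z\<close> is differentiated in the parameter direction
  that represents \<open>x\<close>.
\<close>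

definition eucl_conn ::
  "(real^'n::finite \<Rightarrow> 'a::euclidean_space) \<Rightarrow> (real^'n \<Rightarrow> 'a) \<Rightarrow> (real^'n \<Rightarrow> 'a) \<Rightarrow> real^'n \<Rightarrow> 'a" where
  "eucl_conn \<phi> x Z u =
     frechet_derivative Z (at u) (THE a. frechet_derivative \<phi> (at u) a = x u)"

text \<open>Levi-Civita connection of the induced metric, for tangent fields \<open>x\<close> and \<open>y\<close>.\<close>

definition tan_conn ::
  "(real^'n::finite \<Rightarrow> 'a::euclidean_space) \<Rightarrow> (real^'n \<Rightarrow> 'a) \<Rightarrow> (real^'n \<Rightarrow> 'a) \<Rightarrow> real^'n \<Rightarrow> 'a" where
  "tan_conn \<phi> x y u = tan_proj \<phi> u (eucl_conn \<phi> x y u)"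

text \<open>Normal connection, for a tangent field \<open>x\<close> and a normal field \<open>V\<close>.\<close>

definition nor_conn ::
  "(real^'n::finite \<Rightarrow> 'a::euclidean_space) \<Rightarrow> (real^'n \<Rightarrow> 'a) \<Rightarrow> (real^'n \<Rightarrow> 'a) \<Rightarrow> real^'n \<Rightarrow> 'a" where
  "nor_conn \<phi> x V u = nor_proj \<phi> u (eucl_conn \<phi> x V u)"

text \<open>Second fundamental form, for tangent fields \<open>x\<close> and \<open>y\<close>.\<close>

definition sff ::
  "(real^'n::finite \<Rightarrow> 'a::euclidean_space) \<Rightarrow> (real^'n \<Rightarrow> 'a) \<Rightarrow> (real^'n \<Rightarrow> 'a) \<Rightarrow> real^'n \<Rightarrow> 'a" where
  "sff \<phi> x y u = nor_proj \<phi> u (eucl_conn \<phi> x y u)"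

text \<open>
  Rough Laplacian: the metric trace of the second covariant derivative
  $\nabla^\perp_x\nabla^\perp_y V - \nabla^\perp_{\nabla_x y} V$.
\<close>

definition nor_laplacian ::
  "(real^'n::finite \<Rightarrow> 'a::euclidean_space) \<Rightarrow> (real^'n \<Rightarrow> 'a) \<Rightarrow> real^'n \<Rightarrow> 'a" where
  "nor_laplacian \<phi> V u =
     (\<Sum>i\<in>UNIV. \<Sum>j\<in>UNIV. inv_metric \<phi> u i j *\<^sub>R
        (nor_conn \<phi> (pd \<phi> i) (nor_conn \<phi> (pd \<phi> j) V) u
         - nor_conn \<phi> (tan_conn \<phi> (pd \<phi> i) (pd \<phi> j)) V u))"

text \<open>
  $\langle\langle A,V\rangle,A\rangle = g^{ik} g^{jl} \langle A(\partial_i,\partial_j), V\rangle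
  A(\partial_k,\partial_l)$; for normal \<open>V\<close> one has
  $\langle A(\partial_i,\partial_j), V\rangle = V^\beta h^\beta_{ij}$ and
  $A(\partial_k,\partial_l) = h^\alpha_{kl} e_\alpha$ in any orthonormal normal frame.
\<close>

definition AVA ::
  "(real^'n::finite \<Rightarrow> 'a::euclidean_space) \<Rightarrow> (real^'n \<Rightarrow> 'a) \<Rightarrow> real^'n \<Rightarrow> 'a" where
  "AVA \<phi> V u =
     (\<Sum>i\<in>UNIV. \<Sum>j\<in>UNIV. \<Sum>k\<in>UNIV. \<Sum>l\<in>UNIV.
        (inv_metric \<phi> u i k * inv_metric \<phi> u j l * (sff \<phi> (pd \<phi> i) (pd \<phi> j) u \<bullet> V u)) *\<^sub>R
        sff \<phi> (pd \<phi> k) (pd \<phi> l) u)"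

definition L_local ::
  "'a \<Rightarrow> (real^'n::finite \<Rightarrow> 'a::euclidean_space) \<Rightarrow> (real^'n \<Rightarrow> 'a) \<Rightarrow> real^'n \<Rightarrow> 'a" where
  "L_local T \<phi> V u =
     nor_laplacian \<phi> V u + nor_conn \<phi> (\<lambda>w. tan_proj \<phi> w T) V u + AVA \<phi> V u"

text \<open>A smooth orthonormal frame \<open>e 0, \<dots>, e (p-1)\<close> of the normal bundle over the parameter set \<open>U\<close>.\<close>

definition orthonormal_normal_frame ::
  "nat \<Rightarrow> (real^'n::finite \<Rightarrow> 'a::euclidean_space) \<Rightarrow> (real^'n) set \<Rightarrow> (nat \<Rightarrow> real^'n \<Rightarrow> 'a) \<Rightarrow> bool" where
  "orthonormal_normal_frame p \<phi> U e \<longleftrightarrow>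
     (\<forall>\<alpha><p. smooth_on U (e \<alpha>) \<and> (\<forall>u\<in>U. e \<alpha> u \<in> normal_space \<phi> u)) \<and>
     (\<forall>\<alpha><p. \<forall>\<beta><p. \<forall>u\<in>U. e \<alpha> u \<bullet> e \<beta> u = (if \<alpha> = \<beta> then 1 else 0))"

text \<open>
  The components $\Delta V^\alpha$, $\nabla V^\alpha$ (a tangent vector, the index being raised with
  the metric) of the covariant derivatives $\Delta^\perp V$, $\nabla^\perp V$, and $h^\alpha_{ij}$,
  where \<open>e\<close> is the single frame field $e_\alpha$.
\<close>

definition lap_comp ::
  "(real^'n::finite \<Rightarrow> 'a::euclidean_space) \<Rightarrow> (real^'n \<Rightarrow> 'a) \<Rightarrow> (real^'n \<Rightarrow> 'a) \<Rightarrow> real^'n \<Rightarrow> real" where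
  "lap_comp \<phi> V e u = nor_laplacian \<phi> V u \<bullet> e u"

definition grad_comp ::
  "(real^'n::finite \<Rightarrow> 'a::euclidean_space) \<Rightarrow> (real^'n \<Rightarrow> 'a) \<Rightarrow> (real^'n \<Rightarrow> 'a) \<Rightarrow> real^'n \<Rightarrow> 'a" where
  "grad_comp \<phi> V e u =
     (\<Sum>i\<in>UNIV. \<Sum>j\<in>UNIV. (inv_metric \<phi> u i j * (nor_conn \<phi> (pd \<phi> j) V u \<bullet> e u)) *\<^sub>R pd \<phi> i u)"

definition sff_comp ::
  "(real^'n::finite \<Rightarrow> 'a::euclidean_space) \<Rightarrow> (real^'n \<Rightarrow> 'a) \<Rightarrow> 'n \<Rightarrow> 'n \<Rightarrow> real^'n \<Rightarrow> real" where
  "sff_comp \<phi> e i j u = sff \<phi> (pd \<phi> i) (pd \<phi> j) u \<bullet> e u"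

definition L_components ::
  "nat \<Rightarrow> 'a \<Rightarrow> (real^'n::finite \<Rightarrow> 'a::euclidean_space) \<Rightarrow> (nat \<Rightarrow> real^'n \<Rightarrow> 'a) \<Rightarrow>
   (real^'n \<Rightarrow> 'a) \<Rightarrow> real^'n \<Rightarrow> 'a" where
  "L_components p T \<phi> e V u =
     (\<Sum>\<alpha><p.
        (lap_comp \<phi> V (e \<alpha>) u + T \<bullet> grad_comp \<phi> V (e \<alpha>) u
         + (\<Sum>\<beta><p. \<Sum>i\<in>UNIV. \<Sum>j\<in>UNIV. \<Sum>k\<in>UNIV. \<Sum>l\<in>UNIV.
              inv_metric \<phi> u i k * inv_metric \<phi> u j l *
              (V u \<bullet> e \<beta> u) * sff_comp \<phi> (e \<beta>) i j u * sff_comp \<phi> (e \<alpha>) k l u))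
        *\<^sub>R e \<alpha> u)"

section \<open>Global objects\<close>

text \<open>\<open>L\<close> as an operator on fields on \<open>M\<close>: the value common to all local parametrizations.\<close>

definition L_op ::
  "'a::euclidean_space \<Rightarrow> ('n::finite, 'm) atlas \<Rightarrow> ('m \<Rightarrow> 'a) \<Rightarrow> ('m \<Rightarrow> 'a) \<Rightarrow> 'm \<Rightarrow> 'a" where
  "L_op T \<A> X V q =
     (THE z. \<forall>(W,\<psi>)\<in>\<A>. \<forall>u\<in>W. \<psi> u = q \<longrightarrow> z = L_local T (X \<circ> \<psi>) (V \<circ> \<psi>) u)"

definition normal_field ::
  "('n::finite, 'm) atlas \<Rightarrow> ('m \<Rightarrow> 'a::euclidean_space) \<Rightarrow> ('m \<Rightarrow> 'a) \<Rightarrow> bool" where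
  "normal_field \<A> X V \<longleftrightarrow> (\<forall>(W,\<psi>)\<in>\<A>. \<forall>u\<in>W. V (\<psi> u) \<in> normal_space (X \<circ> \<psi>) u)"

text \<open>
  The induced volume measure: the unique Borel measure on \<open>M\<close> which in each local parametrization
  is $\sqrt{\det g}\,du$.
\<close>

definition volume_measure ::
  "'m::topological_space set \<Rightarrow> ('n::finite, 'm) atlas \<Rightarrow> ('m \<Rightarrow> 'a::euclidean_space) \<Rightarrow> 'm measure" where
  "volume_measure M \<A> X =
     (THE \<mu>. sets \<mu> = sets (restrict_space borel M) \<and>
        (\<forall>(W,\<psi>)\<in>\<A>. \<forall>B\<in>sets borel. B \<subseteq> W \<longrightarrow>
           emeasure \<mu> (\<psi> ` B) = (\<integral>\<^sup>+u\<in>B. ennreal (sqrt (det (metric (X \<circ> \<psi>) u))) \<partial>lborel)))"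

text \<open>The part of \<open>F\<close> coming from a Borel set \<open>A\<close>; \<open>F\<close> itself is \<open>F_part\<close> with \<open>A = M\<close>.\<close>

definition F_part ::
  "'a::euclidean_space \<Rightarrow> 'm::topological_space set \<Rightarrow> ('n::finite, 'm) atlas \<Rightarrow> ('m \<Rightarrow> 'a) \<Rightarrow>
   'm set \<Rightarrow> ennreal" where
  "F_part T M \<A> X A = (\<integral>\<^sup>+q\<in>A. ennreal (exp (T \<bullet> X q)) \<partial>volume_measure M \<A> X)"

section \<open>Variations\<close>

text \<open>
  A variation \<open>Y s\<close>, $|s| < \varepsilon$, of \<open>X\<close> that is constant in \<open>s\<close> outside the compact
  set \<open>K \<subseteq> M\<close>; \<open>K\<close> may be any compact set that contains the support.
\<close>

definition compact_variation ::
  "'m::{t2_space,second_countable_topology} set \<Rightarrow> ('n::finite, 'm) atlas \<Rightarrow>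
   ('m \<Rightarrow> 'a::euclidean_space) \<Rightarrow> 'm set \<Rightarrow> real \<Rightarrow> (real \<Rightarrow> 'm \<Rightarrow> 'a) \<Rightarrow> bool" where
  "compact_variation M \<A> X K \<epsilon> Y \<longleftrightarrow>
     0 < \<epsilon> \<and> compact K \<and> K \<subseteq> M \<and>
     (\<forall>q\<in>M. Y 0 q = X q) \<and>
     (\<forall>s\<in>{-\<epsilon><..<\<epsilon>}. \<forall>q\<in>M - K. Y s q = X q) \<and>
     (\<forall>s\<in>{-\<epsilon><..<\<epsilon>}. immersed_submanifold M \<A> (Y s)) \<and>
     (\<forall>(W,\<psi>)\<in>\<A>. smooth_on ({-\<epsilon><..<\<epsilon>} \<times> W) (\<lambda>(s,u). Y s (\<psi> u)))"

text \<open>Only the variation vector field \<open>V\<close> at \<open>s = 0\<close> is required to be normal.\<close>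

definition normal_variation ::
  "'m::{t2_space,second_countable_topology} set \<Rightarrow> ('n::finite, 'm) atlas \<Rightarrow>
   ('m \<Rightarrow> 'a::euclidean_space) \<Rightarrow> 'm set \<Rightarrow> real \<Rightarrow> (real \<Rightarrow> 'm \<Rightarrow> 'a) \<Rightarrow> ('m \<Rightarrow> 'a) \<Rightarrow> bool" where
  "normal_variation M \<A> X K \<epsilon> Y V \<longleftrightarrow>
     compact_variation M \<A> X K \<epsilon> Y \<and>
     (\<forall>q\<in>M. ((\<lambda>s. Y s q) has_vector_derivative V q) (at 0)) \<and>
     normal_field \<A> X V"

text \<open>
  The function of \<open>s\<close> whose derivatives at \<open>0\<close> are the derivatives of \<open>F\<close> along the variation:
  \<open>F\<close> of the whole submanifold if this is finite at \<open>s = 0\<close>, and otherwise the part of \<open>F\<close> coming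
  from the compact region \<open>K\<close> outside of which nothing changes.
\<close>

definition F_along ::
  "'a::euclidean_space \<Rightarrow> 'm::topological_space set \<Rightarrow> ('n::finite, 'm) atlas \<Rightarrow> ('m \<Rightarrow> 'a) \<Rightarrow>
   'm set \<Rightarrow> (real \<Rightarrow> 'm \<Rightarrow> 'a) \<Rightarrow> real \<Rightarrow> real" where
  "F_along T M \<A> X K Y s =
     enn2real (F_part T M \<A> (Y s) (if F_part T M \<A> X M < \<infinity> then M else K))"

definition F_critical ::
  "'a::euclidean_space \<Rightarrow> 'm::{t2_space,second_countable_topology} set \<Rightarrow> ('n::finite, 'm) atlas \<Rightarrow>
   ('m \<Rightarrow> 'a) \<Rightarrow> bool" where
  "F_critical T M \<A> X \<longleftrightarrow>
     (\<forall>K \<epsilon> Y V. normal_variation M \<A> X K \<epsilon> Y V \<longrightarrow>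
        (F_along T M \<A> X K Y has_real_derivative 0) (at 0))"

definition has_second_derivative :: "(real \<Rightarrow> real) \<Rightarrow> real \<Rightarrow> real \<Rightarrow> bool" where
  "has_second_derivative f D s \<longleftrightarrow>
     (\<exists>f'. (\<forall>\<^sub>F t in nhds s. (f has_real_derivative f' t) (at t)) \<and>
        (f' has_real_derivative D) (at s))"

end

theory Submission
  imports Defs
begin

text \<open>
  All volume measures of a variation are densities over the fixed measure of \<open>X\<close>, so \<open>F\<close> is,
  up to a constant, an integral over \<open>K\<close> that may be differentiated under the integral sign.
  Let \<open>Z\<close> be the acceleration of the variation at \<open>s = 0\<close>, $D U = \langle T, U\rangle + \mathrm{div}\,U$
  (\<open>div_drift\<close> in a chart, \<open>Div\<close> on \<open>M\<close>) and $f = D V$. The density $e^{\langle T,x\rangle}d\mu$ has the logarithmic derivative $f$, and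
  its second derivative at \<open>0\<close>, divided by the density, is
  $f^2 + D Z + |\nabla^\perp V|^2 - |\langle A,V\rangle|^2$.
  Since \<open>V\<close> is normal, $D(fV) = f^2$; moreover
  $D(\frac12\nabla|V|^2) = |\nabla^\perp V|^2 + \langle V, \Delta^\perp V + \nabla^\perp_{T^T}V\rangle$.
  Hence the second derivative is the density times
  $D(Z^\perp + fV) + D(Z^T + \frac12\nabla|V|^2) - \langle V, LV\rangle$.
  The first term integrates to zero because \<open>X\<close> is critical, tested with the linear variation of
  \<open>X\<close> in the normal direction $Z^\perp + fV$; the second one by the divergence theorem.
  In this way the equation $H = T^\perp$ of critical points is never needed.
\<close>

section \<open>Calculus of smooth maps\<close>

text \<open>Only the initial velocity of a variation is normal, so its acceleration is arbitrary and
  enters through \<open>D Z\<close>. It is removed in two halves because the two vanishing results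
  are complementary: criticality kills the integral of \<open>D N\<close> for normal
  \<open>N\<close> of compact support, the divergence theorem does so for tangent fields. The square
  of \<open>f\<close> is no divergence by itself; it becomes one because differentiating the
  coefficient of \<open>f V\<close> only yields multiples of \<open>V\<close>, which no tangential
  trace sees. Adding half the gradient of |V|^2 plays the part of an integration by parts of |nabla
  V|^2; the weight supplies the drift term. Two obstacles shape the rest. The objects on
  \<open>M\<close> are described through all charts at once, so every field built in a chart must be
  shown to be chart independent before it can be integrated. And \<open>M\<close> need not be
  compact: all bounds come from \<open>K\<close>, on which the relative densities are jointly
  continuous in the parameter and the point, and the test variation for criticality must stay an
  immersion on all of \<open>M\<close> for a uniform range of parameters.\<close>

lemma diff_times_on_cong:
  assumes "open S" "\<And>x. x \<in> S \<Longrightarrow> f x = g x" "diff_times_on k S f"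
  shows "diff_times_on k S g"
  using assms(2,3)
proof (induction k arbitrary: f g)
  case 0 then show ?case by (auto cong: continuous_on_cong)
next
  case (Suc k)
  have fd: "f differentiable (at x)" if "x \<in> S" for x using Suc.prems that by auto
  have gd: "g differentiable (at x)" if x: "x \<in> S" for x
  proof -
    obtain D where "(f has_derivative D) (at x)" using fd[OF x] unfolding differentiable_def by blast
    then have "(g has_derivative D) (at x)"
      by (rule has_derivative_transform_within_open[OF _ \<open>open S\<close> x Suc.prems(1)])
    then show ?thesis by (auto simp: differentiable_def)
  qed
  have "frechet_derivative f (at x) = frechet_derivative g (at x)" if "x \<in> S" for x
    using frechet_derivative_transform_within_open[OF fd[OF that] \<open>open S\<close> that] Suc.prems(1) by blast
  then have "diff_times_on k S (\<lambda>x. frechet_derivative g (at x) v)" for v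
    using Suc.IH[of "\<lambda>x. frechet_derivative f (at x) v" "\<lambda>x. frechet_derivative g (at x) v"] Suc.prems(2) by auto
  moreover have "continuous_on S g" using Suc.prems by (auto cong: continuous_on_cong)
  ultimately show ?case using gd by auto
qed

lemma diff_times_on_continuous: "diff_times_on k S f \<Longrightarrow> continuous_on S f"
  by (cases k) auto

text \<open>The definition names the derivative \<open>frechet_derivative\<close>; here any
  explicitly known derivative will do, so that the inductions below can be run with the product and
  chain rules.\<close>

lemma diff_times_on_SucI:
  assumes "open S" "\<And>x. x \<in> S \<Longrightarrow> (f has_derivative f' x) (at x)" "\<And>v. diff_times_on k S (\<lambda>x. f' x v)"
  shows "diff_times_on (Suc k) S f"
proof -
  have "continuous_on S f"
    using assms(2) by (meson continuous_at_imp_continuous_on has_derivative_continuous)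
  moreover have "f differentiable (at x)" if "x \<in> S" for x using assms(2)[OF that] by (auto simp: differentiable_def)
  moreover have "diff_times_on k S (\<lambda>x. frechet_derivative f (at x) v)" for v
    by (rule diff_times_on_cong[OF assms(1) _ assms(3)[of v]])
      (use assms(2) frechet_derivative_at in metis)
  ultimately show ?thesis by simp
qed

lemma diff_times_on_SucD:
  assumes "diff_times_on (Suc k) S f"
  shows "x \<in> S \<Longrightarrow> (f has_derivative frechet_derivative f (at x)) (at x)"
    and "diff_times_on k S (\<lambda>x. frechet_derivative f (at x) v)"
  using assms frechet_derivative_works by auto

lemma diff_times_on_Suc_imp: "diff_times_on (Suc k) S f \<Longrightarrow> diff_times_on k S f"
  by (induction k arbitrary: f) auto

lemma diff_times_on_subset: "diff_times_on k S f \<Longrightarrow> S' \<subseteq> S \<Longrightarrow> diff_times_on k S' f"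
  by (induction k arbitrary: f) (auto intro: continuous_on_subset)

lemma diff_times_on_const [simp]: "diff_times_on k S (\<lambda>x. c)"
  by (induction k arbitrary: c) auto

lemma diff_times_on_bounded_linear:
  assumes "open S" "bounded_linear h" "diff_times_on k S f"
  shows "diff_times_on k S (\<lambda>x. h (f x))"
  using assms(3)
proof (induction k arbitrary: f)
  case 0 then show ?case using bounded_linear.continuous_on[OF assms(2)] by simp
next
  case (Suc k)
  show ?case
    by (rule diff_times_on_SucI[OF assms(1) bounded_linear.has_derivative[OF assms(2) diff_times_on_SucD(1)[OF Suc.prems]]
          Suc.IH[OF diff_times_on_SucD(2)[OF Suc.prems]]])
qed

lemma diff_times_on_add:
  assumes "open S" "diff_times_on k S f" "diff_times_on k S g"
  shows "diff_times_on k S (\<lambda>x. f x + g x)"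
  using assms(2,3)
proof (induction k arbitrary: f g)
  case 0 then show ?case by (auto intro: continuous_intros)
next
  case (Suc k)
  show ?case
    by (rule diff_times_on_SucI[OF assms(1) has_derivative_add[OF diff_times_on_SucD(1)[OF Suc.prems(1)] diff_times_on_SucD(1)[OF Suc.prems(2)]]
        Suc.IH[OF diff_times_on_SucD(2)[OF Suc.prems(1)] diff_times_on_SucD(2)[OF Suc.prems(2)]]])
qed

text \<open>In the product rule each factor also occurs undifferentiated, hence the weakening of
  C^(k+1) to C^k in the induction step.\<close>

lemma diff_times_on_bilinear:
  assumes "open S" "bounded_bilinear h" "diff_times_on k S f" "diff_times_on k S g"
  shows "diff_times_on k S (\<lambda>x. h (f x) (g x))"
  using assms(3,4)
proof (induction k arbitrary: f g)
  case 0 then show ?case using bounded_bilinear.continuous_on[OF assms(2)] by auto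
next
  case (Suc k)
  show ?case
    by (rule diff_times_on_SucI[OF assms(1) bounded_bilinear.FDERIV[OF assms(2) diff_times_on_SucD(1)[OF Suc.prems(1)] diff_times_on_SucD(1)[OF Suc.prems(2)]]
        diff_times_on_add[OF assms(1) Suc.IH[OF diff_times_on_Suc_imp[OF Suc.prems(1)] diff_times_on_SucD(2)[OF Suc.prems(2)]]
          Suc.IH[OF diff_times_on_SucD(2)[OF Suc.prems(1)] diff_times_on_Suc_imp[OF Suc.prems(2)]]]])
qed

lemma diff_times_on_sum:
  assumes "open S" "\<And>i. i \<in> I \<Longrightarrow> diff_times_on k S (f i)"
  shows "diff_times_on k S (\<lambda>x. \<Sum>i\<in>I. f i x)"
  using assms(2) by (induction I rule: infinite_finite_induct) (auto intro: diff_times_on_add[OF assms(1)])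

lemma diff_times_on_compose:
  fixes f :: "'a::real_normed_vector \<Rightarrow> 'b::euclidean_space" and g :: "'b \<Rightarrow> 'c::real_normed_vector"
  assumes "open S" "open S'" "f ` S \<subseteq> S'" "diff_times_on k S f" "diff_times_on k S' g"
  shows "diff_times_on k S (\<lambda>x. g (f x))"
  using assms(4,5)
proof (induction k arbitrary: g)
  case 0 then show ?case using assms(3) by (auto intro: continuous_on_compose2)
next
  case (Suc k)
  \<comment> \<open>\<open>diff_times_on\<close> controls derivatives in fixed directions only,
    while the chain rule differentiates \<open>g\<close> in a direction that moves with x. Expanding
    that direction in a basis leaves fixed directions with C^k coefficients.\<close>
  let ?D = "\<lambda>x v. \<Sum>b\<in>Basis. (frechet_derivative f (at x) v \<bullet> b) *\<^sub>R frechet_derivative g (at (f x)) b"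
  have "((\<lambda>x. g (f x)) has_derivative ?D x) (at x)" if "x \<in> S" for x
  proof -
    have g: "(g has_derivative frechet_derivative g (at (f x))) (at (f x))"
      using diff_times_on_SucD(1)[OF Suc.prems(2)] that assms(3) by blast
    interpret bounded_linear "frechet_derivative g (at (f x))" using g by (rule has_derivative_bounded_linear)
    have "frechet_derivative g (at (f x)) (frechet_derivative f (at x) v) = ?D x v" for v
      by (subst euclidean_representation[symmetric, of "frechet_derivative f (at x) v"]) (simp only: sum scaleR)
    then show ?thesis
      using has_derivative_compose[OF diff_times_on_SucD(1)[OF Suc.prems(1) that] g] by simp
  qed
  then show ?case
  proof (rule diff_times_on_SucI[OF assms(1)])
    show "diff_times_on k S (\<lambda>x. ?D x v)" for v
      by (intro diff_times_on_sum[OF assms(1)] diff_times_on_bilinear[OF assms(1) bounded_bilinear_scaleR]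
          diff_times_on_bounded_linear[OF assms(1) bounded_linear_inner_left] diff_times_on_SucD(2)[OF Suc.prems(1)]
          Suc.IH diff_times_on_Suc_imp[OF Suc.prems(1)] diff_times_on_SucD(2)[OF Suc.prems(2)])
  qed auto
qed

text \<open>On the nonzero reals the derivative of \<open>inverse\<close> is, up to sign, a product
  of \<open>inverse\<close> with itself, so each order reduces to the one before. The general case
  is a composition.\<close>

lemma diff_times_on_inverse:
  fixes f :: "'a::real_normed_vector \<Rightarrow> real"
  assumes "open S" "diff_times_on k S f" "\<And>x. x \<in> S \<Longrightarrow> f x \<noteq> 0"
  shows "diff_times_on k S (\<lambda>x. inverse (f x))"
proof -
  have "diff_times_on k (- {0}) (inverse :: real \<Rightarrow> real)"
  proof (induction k)
    case 0 then show ?case by (auto intro!: continuous_intros)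
  next
    case (Suc k)
    show ?case
      by (rule diff_times_on_SucI[OF _ has_derivative_inverse'])
        (auto intro!: diff_times_on_bounded_linear[OF _ bounded_linear_minus[OF bounded_linear_ident]]
           diff_times_on_bilinear[OF _ bounded_bilinear_mult] Suc.IH)
  qed
  then show ?thesis
    by (intro diff_times_on_compose[OF assms(1) _ _ assms(2), of "- {0}"]) (use assms(3) in auto)
qed

section \<open>Closure properties of smooth maps\<close>

named_theorems smooth_intros

lemma smooth_on_cong:
  "open S \<Longrightarrow> (\<And>x. x \<in> S \<Longrightarrow> f x = g x) \<Longrightarrow> smooth_on S f \<Longrightarrow> smooth_on S g"
  using diff_times_on_cong unfolding smooth_on_def by blast

lemma smooth_on_subset: "smooth_on S f \<Longrightarrow> S' \<subseteq> S \<Longrightarrow> smooth_on S' f"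
  using diff_times_on_subset unfolding smooth_on_def by blast

lemma smooth_on_continuous: "smooth_on S f \<Longrightarrow> continuous_on S f"
  unfolding smooth_on_def using diff_times_on_continuous by blast

lemma smooth_on_has_derivative:
  "smooth_on S f \<Longrightarrow> x \<in> S \<Longrightarrow> (f has_derivative frechet_derivative f (at x)) (at x)"
  unfolding smooth_on_def using diff_times_on_SucD(1)[of 0] by blast

lemma smooth_on_differentiable: "smooth_on S f \<Longrightarrow> x \<in> S \<Longrightarrow> f differentiable (at x)"
  using smooth_on_has_derivative differentiable_def by blast

lemma smooth_on_frechet [smooth_intros]:
  "smooth_on S f \<Longrightarrow> smooth_on S (\<lambda>x. frechet_derivative f (at x) v)"
  unfolding smooth_on_def using diff_times_on_SucD(2) by blast

lemma smooth_on_const [smooth_intros]: "smooth_on S (\<lambda>x. c)"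
  by (simp add: smooth_on_def)

lemma smooth_on_bounded_linear:
  "open S \<Longrightarrow> bounded_linear h \<Longrightarrow> smooth_on S f \<Longrightarrow> smooth_on S (\<lambda>x. h (f x))"
  unfolding smooth_on_def using diff_times_on_bounded_linear by blast

lemma diff_times_on_ident: "open S \<Longrightarrow> diff_times_on k S (\<lambda>x. x)"
  by (cases k) (auto intro!: diff_times_on_SucI[OF _ has_derivative_ident])

lemma smooth_on_ident [smooth_intros]: "open S \<Longrightarrow> smooth_on S (\<lambda>x. x)"
  unfolding smooth_on_def using diff_times_on_ident by blast

lemma smooth_on_bounded_linear_map: "open S \<Longrightarrow> bounded_linear h \<Longrightarrow> smooth_on S h"
  using smooth_on_bounded_linear[OF _ _ smooth_on_ident] by blast

lemma smooth_on_add [smooth_intros]: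
  "open S \<Longrightarrow> smooth_on S f \<Longrightarrow> smooth_on S g \<Longrightarrow> smooth_on S (\<lambda>x. f x + g x)"
  unfolding smooth_on_def using diff_times_on_add by blast

lemma smooth_on_minus [smooth_intros]:
  "open S \<Longrightarrow> smooth_on S f \<Longrightarrow> smooth_on S (\<lambda>x. - f x)"
  using smooth_on_bounded_linear[OF _ bounded_linear_minus[OF bounded_linear_ident]] by blast

lemma smooth_on_diff [smooth_intros]:
  "open S \<Longrightarrow> smooth_on S f \<Longrightarrow> smooth_on S g \<Longrightarrow> smooth_on S (\<lambda>x. f x - g x)"
  using smooth_on_add[of S f "\<lambda>x. - g x"] smooth_on_minus by force

lemma smooth_on_bilinear:
  "open S \<Longrightarrow> bounded_bilinear h \<Longrightarrow> smooth_on S f \<Longrightarrow> smooth_on S g \<Longrightarrow> smooth_on S (\<lambda>x. h (f x) (g x))"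
  unfolding smooth_on_def using diff_times_on_bilinear by blast

lemmas smooth_on_scaleR [smooth_intros] = smooth_on_bilinear[OF _ bounded_bilinear_scaleR]
lemmas smooth_on_inner [smooth_intros] = smooth_on_bilinear[OF _ bounded_bilinear_inner]
lemmas smooth_on_mult [smooth_intros] =
  smooth_on_bilinear[OF _ bounded_bilinear_mult[where 'a = real]]

lemma smooth_on_sum [smooth_intros]:
  "open S \<Longrightarrow> (\<And>i. i \<in> I \<Longrightarrow> smooth_on S (f i)) \<Longrightarrow> smooth_on S (\<lambda>x. \<Sum>i\<in>I. f i x)"
  unfolding smooth_on_def using diff_times_on_sum[of S I] by blast

lemma smooth_on_prod [smooth_intros]:
  fixes f :: "'i \<Rightarrow> 'a::real_normed_vector \<Rightarrow> real"
  assumes "open S" "\<And>i. i \<in> I \<Longrightarrow> smooth_on S (f i)"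
  shows "smooth_on S (\<lambda>x. \<Prod>i\<in>I. f i x)"
  using assms(2) by (induction I rule: infinite_finite_induct) (auto intro!: smooth_intros assms(1))

lemma smooth_on_compose:
  fixes f :: "'a::real_normed_vector \<Rightarrow> 'b::euclidean_space"
  shows "open S \<Longrightarrow> open S' \<Longrightarrow> f ` S \<subseteq> S' \<Longrightarrow> smooth_on S f \<Longrightarrow> smooth_on S' g \<Longrightarrow> smooth_on S (\<lambda>x. g (f x))"
  unfolding smooth_on_def using diff_times_on_compose by blast

lemma smooth_on_divide [smooth_intros]:
  fixes f g :: "'a::real_normed_vector \<Rightarrow> real"
  assumes "open S" "smooth_on S f" "smooth_on S g" "\<And>x. x \<in> S \<Longrightarrow> g x \<noteq> 0"
  shows "smooth_on S (\<lambda>x. f x / g x)"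
  unfolding divide_inverse
  using assms(3,4) diff_times_on_inverse[OF assms(1), of _ g]
  by (intro smooth_on_mult assms(1,2)) (auto simp: smooth_on_def)

lemma smooth_on_Pair [smooth_intros]:
  assumes "open S" "smooth_on S f" "smooth_on S g"
  shows "smooth_on S (\<lambda>x. (f x, g x))"
proof -
  have "smooth_on S (\<lambda>x. (f x, 0) + (0, g x))"
    by (intro smooth_on_add assms smooth_on_bounded_linear[OF assms(1) bounded_linear_Pair[OF bounded_linear_ident bounded_linear_zero]]
       smooth_on_bounded_linear[OF assms(1) bounded_linear_Pair[OF bounded_linear_zero bounded_linear_ident]])
  then show ?thesis by simp
qed

lemma smooth_on_det [smooth_intros]:
  fixes A :: "'a::real_normed_vector \<Rightarrow> real^'n^'n"
  assumes "open S" "\<And>i j. smooth_on S (\<lambda>x. A x $ i $ j)"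
  shows "smooth_on S (\<lambda>x. det (A x))"
  unfolding det_def by (intro smooth_intros assms)

section \<open>Gram matrices\<close>

text \<open>Stated for arbitrary tuples of vectors, so that the same formulas can be differentiated
  along the variation parameter as well as along the coordinates.\<close>

definition gram :: "('n::finite \<Rightarrow> 'a::euclidean_space) \<Rightarrow> real^'n^'n" where
  "gram e = (\<chi> i j. e i \<bullet> e j)"

definition ginv :: "('n::finite \<Rightarrow> 'a::euclidean_space) \<Rightarrow> 'n \<Rightarrow> 'n \<Rightarrow> real" where
  "ginv e i j = matrix_inv (gram e) $ i $ j"

definition lincomb :: "('n::finite \<Rightarrow> 'a::euclidean_space) \<Rightarrow> real^'n \<Rightarrow> 'a" where
  "lincomb e a = (\<Sum>i\<in>UNIV. a $ i *\<^sub>R e i)"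

text \<open>Linear independence, in the form that matches the injective differential in
  \<open>smooth_immersion\<close>.\<close>

definition frame :: "('n::finite \<Rightarrow> 'a::euclidean_space) \<Rightarrow> bool" where
  "frame e \<longleftrightarrow> inj (lincomb e)"

lemma linear_lincomb: "linear (lincomb e)"
  unfolding lincomb_def
  by (intro linearI) (auto simp: algebra_simps sum.distrib scaleR_sum_right)

lemma lincomb_eq_0: "frame e \<Longrightarrow> lincomb e a = 0 \<Longrightarrow> a = 0"
  unfolding frame_def by (metis linear_0 linear_lincomb injD)

lemma inner_gram: "x \<bullet> (gram e *v x) = lincomb e x \<bullet> lincomb e x"
  by (simp add: gram_def lincomb_def inner_vec_def matrix_vector_mult_def inner_sum_left inner_sum_right
      sum_distrib_left inner_commute algebra_simps)

lemma det_nonzero_if_posdef: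
  fixes A :: "real^'n^'n"
  assumes "\<And>x. x \<noteq> 0 \<Longrightarrow> x \<bullet> (A *v x) > 0"
  shows "det A \<noteq> 0"
proof -
  have "inj ((*v) A)"
    using assms by (intro injI) (metis eq_iff_diff_eq_0 inner_zero_right less_irrefl matrix_vector_mult_diff_distrib)
  then show ?thesis
    by (metis det_nz_iff_inj matrix_vector_mul_linear matrix_of_matrix_vector_mul)
qed

lemma det_gram_pos:
  assumes "frame e" shows "det (gram e) > 0"
proof -
  \<comment> \<open>The segment from the identity to the Gram matrix stays positive definite, so the
    determinant has no zero on it and keeps the sign it has at the identity.\<close>
  define A where "A t = (\<chi> i j. (1 - t) * mat 1 $ i $ j + t * gram e $ i $ j)" for t :: real
  have "det (A t) \<noteq> 0" if "0 \<le> t" "t \<le> 1" for t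
  proof (rule det_nonzero_if_posdef)
    fix x :: "real^'a" assume x: "x \<noteq> 0"
    have "A t = (1 - t) *\<^sub>R mat 1 + t *\<^sub>R gram e"
      by (simp add: A_def vec_eq_iff)
    then have "x \<bullet> (A t *v x) = (1 - t) * (x \<bullet> x) + t * (lincomb e x \<bullet> lincomb e x)"
      by (simp add: matrix_vector_mult_add_rdistrib scaleR_matrix_vector_assoc[symmetric] inner_add_right inner_gram)
    moreover have "lincomb e x \<bullet> lincomb e x > 0"
      using lincomb_eq_0[OF assms, of x] x by auto
    moreover have "x \<bullet> x > 0" using x by auto
    ultimately show "x \<bullet> (A t *v x) > 0"
      using that by (cases "t = 0") (auto intro!: add_nonneg_pos mult_nonneg_nonneg)
  qed
  moreover have "continuous_on {0..1} (\<lambda>t. det (A t))"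
    unfolding det_def A_def by (auto intro!: continuous_intros)
  ultimately have "\<not> det (A 1) \<le> 0"
    using IVT2'[of "\<lambda>t. det (A t)" 1 0 0] by (force simp: A_def mat_def[symmetric])
  moreover have "A 1 = gram e" by (simp add: A_def vec_eq_iff)
  ultimately show ?thesis by simp
qed

lemma matrix_inv_works:
  fixes A :: "real^'n^'n"
  assumes "det A \<noteq> 0"
  shows "A ** matrix_inv A = mat 1" "matrix_inv A ** A = mat 1"
proof -
  have "\<exists>B. A ** B = mat 1 \<and> B ** A = mat 1"
    using assms invertible_det_nz[of A] unfolding invertible_def by blast
  then have "A ** matrix_inv A = mat 1 \<and> matrix_inv A ** A = mat 1"
    unfolding matrix_inv_def by (rule someI_ex)
  then show "A ** matrix_inv A = mat 1" "matrix_inv A ** A = mat 1" by auto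
qed

lemma matrix_inv_unique:
  fixes A B :: "real^'n^'n"
  assumes "B ** A = mat 1"
  shows "matrix_inv A = B"
proof -
  have "det A \<noteq> 0"
    using assms by (metis det_I det_mul mult_zero_right zero_neq_one)
  then show ?thesis
    by (metis assms matrix_inv_works(1) matrix_mul_assoc matrix_mul_lid matrix_mul_rid)
qed

lemma ginv_left: "frame e \<Longrightarrow> (\<Sum>j\<in>UNIV. ginv e i j * (e j \<bullet> e k)) = (if i = k then 1 else 0)"
  using arg_cong[OF matrix_inv_works(2)[of "gram e"], of "\<lambda>A. A $ i $ k"] det_gram_pos[of e]
  by (simp add: ginv_def matrix_matrix_mult_def mat_def gram_def)

text \<open>The transpose of the inverse is another left inverse of the symmetric Gram
  matrix.\<close>

lemma ginv_sym:
  assumes "frame e" shows "ginv e i j = ginv e j i"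
proof -
  have "transpose (gram e) = gram e" by (simp add: gram_def transpose_def vec_eq_iff inner_commute)
  then have "transpose (matrix_inv (gram e)) ** gram e = mat 1"
    using matrix_inv_works(1)[of "gram e"] det_gram_pos[OF assms]
    by (metis less_irrefl matrix_transpose_mul transpose_mat)
  then have "matrix_inv (gram e) = transpose (matrix_inv (gram e))" by (rule matrix_inv_unique)
  from arg_cong[OF this, of "\<lambda>A. A $ i $ j"] show ?thesis
    by (simp add: ginv_def transpose_def)
qed

lemma ginv_right: "frame e \<Longrightarrow> (\<Sum>j\<in>UNIV. (e i \<bullet> e j) * ginv e j k) = (if i = k then 1 else 0)"
  using ginv_left[of e k i] by (simp add: ginv_sym[of e _ k] inner_commute mult.commute)

text \<open>Cramer's rule makes the entries of the inverse quotients of polynomials in the inner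
  products; differentiability and smoothness are read off from this form.\<close>

lemma ginv_cramer:
  assumes "frame e"
  shows "ginv e i j = det (\<chi> a b. if b = i then (if a = j then 1 else 0) else e a \<bullet> e b) / det (gram e)"
proof -
  let ?x = "\<chi> i. ginv e i j"
  have d: "det (gram e) \<noteq> 0" using det_gram_pos[OF assms] by simp
  have "gram e *v ?x = axis j 1"
    using ginv_right[OF assms] by (simp add: vec_eq_iff matrix_vector_mult_def gram_def axis_def)
  then have "?x = (\<chi> k. det(\<chi> a b. if b=k then axis j 1 $ a else gram e $a$b) / det (gram e))"
    by (simp only: cramer[OF d])
  then have "?x $ i = det(\<chi> a b. if b=i then axis j 1 $ a else gram e $a$b) / det (gram e)"
    by simp
  moreover have "(\<chi> a b. if b=i then axis j 1 $ a else gram e $a$b) = (\<chi> a b. if b = i then (if a = j then 1 else 0) else e a \<bullet> e b)"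
    by (auto simp: vec_eq_iff gram_def axis_def)
  ultimately show ?thesis by simp
qed

text \<open>The orthogonal projection onto the span of a frame. In contrast to
  \<open>tan_proj\<close> it is an explicit expression that can be differentiated.\<close>

definition tproj :: "('n::finite \<Rightarrow> 'a::euclidean_space) \<Rightarrow> 'a \<Rightarrow> 'a" where
  "tproj e v = (\<Sum>i\<in>UNIV. \<Sum>j\<in>UNIV. (ginv e i j * (v \<bullet> e j)) *\<^sub>R e i)"

lemma ginv_sum_inner:
  assumes e: "frame e"
  shows "(\<Sum>i\<in>UNIV. \<Sum>j\<in>UNIV. (ginv e i j * c j) *\<^sub>R e i) \<bullet> e k = c k"
proof -
  have "(\<Sum>i\<in>UNIV. \<Sum>j\<in>UNIV. (ginv e i j * c j) *\<^sub>R e i) \<bullet> e k = (\<Sum>i\<in>UNIV. \<Sum>j\<in>UNIV. c j * (ginv e j i * (e i \<bullet> e k)))"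
    by (simp add: inner_sum_left ginv_sym[OF e, of _ "_"] algebra_simps)
  also have "\<dots> = (\<Sum>j\<in>UNIV. c j * (\<Sum>i\<in>UNIV. ginv e j i * (e i \<bullet> e k)))"
    by (subst sum.swap) (simp add: sum_distrib_left)
  also have "\<dots> = c k" by (simp add: ginv_left[OF e] if_distrib cong: if_cong)
  finally show ?thesis .
qed

lemma tproj_inner: "frame e \<Longrightarrow> tproj e v \<bullet> e k = v \<bullet> e k"
  unfolding tproj_def by (rule ginv_sum_inner)

lemma tproj_lincomb: "tproj e v = lincomb e (\<chi> i. \<Sum>j\<in>UNIV. ginv e i j * (v \<bullet> e j))"
  by (simp add: tproj_def lincomb_def scaleR_sum_left)

lemma linear_tproj: "linear (tproj e)"
  unfolding tproj_def
  by (intro linearI) (simp_all add: inner_add_left algebra_simps sum.distrib scaleR_sum_right)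

lemma tproj_basis:
  assumes "frame e" shows "tproj e (e k) = e k"
  unfolding tproj_def scaleR_sum_left[symmetric]
  using ginv_left[OF assms, of _ k] by (simp add: inner_commute if_distrib[of "\<lambda>x. x *\<^sub>R _"] cong: if_cong)

section \<open>Gram matrices under a change of frame\<close>

lemma gram_transform:
  fixes J :: "'n::finite \<Rightarrow> 'n \<Rightarrow> real"
  assumes "\<And>i. e i = (\<Sum>k\<in>UNIV. J k i *\<^sub>R f k)"
  shows "gram e = transpose (\<chi> k i. J k i) ** gram f ** (\<chi> k i. J k i)"
  by (simp add: vec_eq_iff gram_def matrix_matrix_mult_def transpose_def assms inner_sum_left inner_sum_right
      sum_distrib_left sum_distrib_right algebra_simps)

lemma det_gram_transform:
  fixes J :: "'n::finite \<Rightarrow> 'n \<Rightarrow> real"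
  assumes "\<And>i. e i = (\<Sum>k\<in>UNIV. J k i *\<^sub>R f k)"
  shows "det (gram e) = (det (\<chi> k i. J k i))\<^sup>2 * det (gram f)"
  by (simp add: gram_transform[OF assms] det_mul power2_eq_square)

text \<open>If G = M^T H M, then M G^-1 M^T inverts H. With \<open>J\<close> the Jacobi matrix of a
  change of coordinates this is the contravariant law of the inverse metric.\<close>

lemma ginv_transform:
  fixes J :: "'n::finite \<Rightarrow> 'n \<Rightarrow> real"
  assumes J: "\<And>i. e i = (\<Sum>k\<in>UNIV. J k i *\<^sub>R f k)" and e: "frame e"
  shows "(\<Sum>i\<in>UNIV. \<Sum>j\<in>UNIV. ginv e i j * J k i * J l j) = ginv f k l"
proof -
  define M where "M = (\<chi> k i. J k i)"
  have G: "gram e = transpose M ** gram f ** M" unfolding M_def by (rule gram_transform[OF J])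
  have d: "det (gram e) \<noteq> 0" using det_gram_pos[OF e] by simp
  then have "det M \<noteq> 0" unfolding G det_mul by auto
  note M = matrix_inv_works[OF this]
  have "(M ** matrix_inv (gram e) ** transpose M ** gram f) ** M = M ** (matrix_inv (gram e) ** gram e)"
    by (simp add: G matrix_mul_assoc)
  also have "\<dots> = M" by (simp add: matrix_inv_works[OF d])
  finally have "M ** matrix_inv (gram e) ** transpose M ** gram f = mat 1"
    by (metis M(1) matrix_mul_assoc matrix_mul_rid)
  then have "matrix_inv (gram f) = M ** matrix_inv (gram e) ** transpose M" by (rule matrix_inv_unique)
  then have "ginv f k l = (M ** matrix_inv (gram e) ** transpose M) $ k $ l" by (simp add: ginv_def)
  also have "\<dots> = (\<Sum>j\<in>UNIV. \<Sum>i\<in>UNIV. ginv e i j * J k i * J l j)"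
    by (simp add: matrix_matrix_mult_def transpose_def M_def ginv_def sum_distrib_right sum_distrib_left algebra_simps)
  finally show ?thesis by (subst sum.swap) simp
qed

section \<open>Derivatives and smoothness of Gram determinants and their inverses\<close>

lemma has_real_derivative_det:
  fixes A :: "real \<Rightarrow> real^'n^'n"
  assumes "\<And>i j. ((\<lambda>t. A t $ i $ j) has_real_derivative A' i j) (at t)"
  shows "((\<lambda>t. det (A t)) has_real_derivative (\<Sum>k\<in>UNIV. det (\<chi> i j. if i = k then A' k j else A t $ i $ j))) (at t)"
proof -
  have "((\<lambda>t. det (A t)) has_real_derivative (\<Sum>p | p permutes UNIV. of_int (sign p) *
      (\<Sum>k\<in>UNIV. A' k (p k) * (\<Prod>j\<in>UNIV-{k}. A t $ j $ p j)))) (at t)"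
    unfolding det_def
    by (intro DERIV_sum DERIV_cmult has_field_derivative_prod) (rule assms)
  moreover have "(\<Sum>p | p permutes UNIV. of_int (sign p) * (\<Sum>k\<in>UNIV. A' k (p k) * (\<Prod>j\<in>UNIV-{k}. A t $ j $ p j)))
     = (\<Sum>k\<in>UNIV. det (\<chi> i j. if i = k then A' k j else A t $ i $ j))"
    unfolding det_def sum_distrib_left
  proof (subst sum.swap, intro sum.cong refl)
    fix k and p :: "'n \<Rightarrow> 'n"
    have "(\<Prod>i\<in>UNIV. (\<chi> i j. if i = k then A' k j else A t $ i $ j) $ i $ p i) = A' k (p k) * (\<Prod>j\<in>UNIV-{k}. A t $ j $ p j)"
      by (subst prod.remove[of UNIV k]) (auto intro!: prod.cong)
    then show "of_int (sign p) * (A' k (p k) * (\<Prod>j\<in>UNIV-{k}. A t $ j $ p j)) =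
       of_int (sign p) * (\<Prod>i\<in>UNIV. (\<chi> i j. if i = k then A' k j else A t $ i $ j) $ i $ p i)" by simp
  qed
  ultimately show ?thesis by simp
qed

text \<open>The new row is a combination of the rows of \<open>A\<close> with coefficients r A^-1,
  and only the coefficient of row k survives in the determinant.\<close>

lemma det_replace_row:
  fixes A :: "real^'n^'n"
  assumes "det A \<noteq> 0"
  shows "det (\<chi> i j. if i = k then r $ j else A $ i $ j) = (\<Sum>j\<in>UNIV. r $ j * matrix_inv A $ j $ k) * det A"
proof -
  define x where "x = r v* matrix_inv A"
  have "r = x v* A"
    unfolding x_def by (simp add: vector_matrix_mul_assoc matrix_inv_works[OF assms])
  then have "(\<chi> i j. if i = k then r $ j else A $ i $ j) =
      (\<chi> i. if i = k then (\<Sum>i\<in>UNIV. x $ i *s row i A) else row i A)"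
    by (auto simp: vec_eq_iff vector_matrix_mult_def row_def algebra_simps)
  then have "det (\<chi> i j. if i = k then r $ j else A $ i $ j) = x $ k * det A"
    by (simp add: cramer_lemma_transpose)
  then show ?thesis by (simp add: x_def vector_matrix_mult_def algebra_simps)
qed

text \<open>Jacobi's formula. The two terms in the derivative of <e_i, e_j> have equal traces
  because the inverse is symmetric, whence the factor 2; the square root in the volume density will
  remove it again.\<close>

lemma has_real_derivative_det_gram:
  fixes e :: "real \<Rightarrow> 'n::finite \<Rightarrow> 'a::euclidean_space"
  assumes "\<And>i. ((\<lambda>t. e t i) has_vector_derivative z i) (at t)" and fr: "frame (e t)"
  shows "((\<lambda>t. det (gram (e t))) has_real_derivative
     2 * det (gram (e t)) * (\<Sum>i\<in>UNIV. \<Sum>j\<in>UNIV. ginv (e t) i j * (z i \<bullet> e t j))) (at t)"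
proof -
  have d: "det (gram (e t)) \<noteq> 0" using det_gram_pos[OF fr] by simp
  have D: "((\<lambda>t. gram (e t) $ i $ j) has_real_derivative e t i \<bullet> z j + z i \<bullet> e t j) (at t)" for i j
    unfolding gram_def has_real_derivative_iff_has_vector_derivative
    using bounded_bilinear.has_vector_derivative[OF bounded_bilinear_inner assms(1) assms(1)] by simp
  have "(\<Sum>k\<in>UNIV. det (\<chi> i j. if i = k then e t k \<bullet> z j + z k \<bullet> e t j else gram (e t) $ i $ j))
     = (\<Sum>k\<in>UNIV. det (gram (e t)) * (\<Sum>j\<in>UNIV. (e t k \<bullet> z j + z k \<bullet> e t j) * ginv (e t) j k))"
    using det_replace_row[OF d, where r = "\<chi> j. e t k \<bullet> z j + z k \<bullet> e t j" and k = k for k]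
    unfolding vec_lambda_beta ginv_def by (simp add: mult.commute)
  also have "\<dots> = det (gram (e t)) * ((\<Sum>k\<in>UNIV. \<Sum>j\<in>UNIV. ginv (e t) j k * (z j \<bullet> e t k)) + (\<Sum>k\<in>UNIV. \<Sum>j\<in>UNIV. ginv (e t) k j * (z k \<bullet> e t j)))"
    using ginv_sym[OF fr] by (simp add: sum_distrib_left sum.distrib[symmetric] algebra_simps inner_commute)
  also have "\<dots> = 2 * det (gram (e t)) * (\<Sum>i\<in>UNIV. \<Sum>j\<in>UNIV. ginv (e t) i j * (z i \<bullet> e t j))"
    by (subst sum.swap) simp
  finally show ?thesis using has_real_derivative_det[of "\<lambda>t. gram (e t)", OF D] by simp
qed

lemma has_real_derivative_sqrt_det_gram:
  fixes e :: "real \<Rightarrow> 'n::finite \<Rightarrow> 'a::euclidean_space"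
  assumes "\<And>i. ((\<lambda>t. e t i) has_vector_derivative z i) (at t)" and fr: "frame (e t)"
  shows "((\<lambda>t. sqrt (det (gram (e t)))) has_real_derivative
     sqrt (det (gram (e t))) * (\<Sum>i\<in>UNIV. \<Sum>j\<in>UNIV. ginv (e t) i j * (z i \<bullet> e t j))) (at t)"
proof -
  have d: "det (gram (e t)) > 0" using det_gram_pos[OF fr] .
  have "sqrt (det (gram (e t))) * sqrt (det (gram (e t))) = det (gram (e t))" using d by simp
  then have *: "inverse (sqrt (det (gram (e t)))) * det (gram (e t)) = sqrt (det (gram (e t)))"
    using d by (simp add: field_simps)
  have "((\<lambda>t. sqrt (det (gram (e t)))) has_real_derivative
     (2 * det (gram (e t)) * (\<Sum>i\<in>UNIV. \<Sum>j\<in>UNIV. ginv (e t) i j * (z i \<bullet> e t j)))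
      * (inverse (sqrt (det (gram (e t)))) / 2)) (at t)"
    using DERIV_chain2[OF DERIV_real_sqrt[OF d] has_real_derivative_det_gram[OF assms]] by (simp add: mult.commute)
  moreover have "(2 * det (gram (e t)) * C) * (inverse (sqrt (det (gram (e t)))) / 2) =
      (inverse (sqrt (det (gram (e t)))) * det (gram (e t))) * C" for C by simp
  ultimately show ?thesis unfolding * by metis
qed

text \<open>Differentiability comes from Cramer's rule; the value follows by differentiating G^-1 G
  = 1 and multiplying by G^-1 from the right. The open set \<open>S\<close> provides this identity
  near t.\<close>

lemma has_real_derivative_ginv:
  fixes e :: "real \<Rightarrow> 'n::finite \<Rightarrow> 'a::euclidean_space"
  assumes e: "\<And>i. ((\<lambda>t. e t i) has_vector_derivative z i) (at t)"
    and S: "open S" "t \<in> S" and fr: "\<And>s. s \<in> S \<Longrightarrow> frame (e s)"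
  shows "((\<lambda>t. ginv (e t) k l) has_real_derivative
     - (\<Sum>i\<in>UNIV. \<Sum>j\<in>UNIV. ginv (e t) k i * ginv (e t) l j * (z i \<bullet> e t j + e t i \<bullet> z j))) (at t)"
proof -
  have D: "((\<lambda>t. e t i \<bullet> e t j) has_real_derivative e t i \<bullet> z j + z i \<bullet> e t j) (at t)" for i j
    unfolding has_real_derivative_iff_has_vector_derivative
    using bounded_bilinear.has_vector_derivative[OF bounded_bilinear_inner e e] by simp
  have "\<exists>D. ((\<lambda>t. ginv (e t) i j) has_real_derivative D) (at t)" for i j
  proof -
    let ?A = "\<lambda>t. \<chi> a b. if b = i then (if a = j then 1 else 0) else e t a \<bullet> e t b"
    have "((\<lambda>t. ?A t $ a $ b) has_real_derivative (if b = i then 0 else e t a \<bullet> z b + z a \<bullet> e t b)) (at t)" for a b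
      using D by auto
    from DERIV_divide[OF has_real_derivative_det[OF this] has_real_derivative_det_gram[OF e fr[OF S(2)]]]
    obtain D' where "((\<lambda>t. det (?A t) / det (gram (e t))) has_real_derivative D') (at t)"
      using det_gram_pos[OF fr[OF S(2)]] by auto
    then have "((\<lambda>t. ginv (e t) i j) has_real_derivative D') (at t)"
      by (rule has_field_derivative_transform_within_open[OF _ S]) (simp add: ginv_cramer[OF fr])
    then show ?thesis by blast
  qed
  then obtain h where h: "((\<lambda>t. ginv (e t) i j) has_real_derivative h i j) (at t)" for i j by metis
  have "(\<Sum>a\<in>UNIV. h i a * (e t a \<bullet> e t b) + ginv (e t) i a * (e t a \<bullet> z b + z a \<bullet> e t b)) = 0" for i b
  proof -
    have "((\<lambda>t. \<Sum>a\<in>UNIV. ginv (e t) i a * (e t a \<bullet> e t b)) has_real_derivative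
       (\<Sum>a\<in>UNIV. h i a * (e t a \<bullet> e t b) + ginv (e t) i a * (e t a \<bullet> z b + z a \<bullet> e t b))) (at t)"
      by (rule DERIV_sum) (use DERIV_mult[OF h D] in \<open>simp add: algebra_simps\<close>)
    moreover have "((\<lambda>t. \<Sum>a\<in>UNIV. ginv (e t) i a * (e t a \<bullet> e t b)) has_real_derivative 0) (at t)"
      by (rule has_field_derivative_transform_within_open[OF DERIV_const S, of "if i = b then 1 else 0"]) (simp add: ginv_left[OF fr])
    ultimately show ?thesis using DERIV_unique by blast
  qed
  then have *: "(\<Sum>a\<in>UNIV. h k a * (e t a \<bullet> e t b)) = - (\<Sum>a\<in>UNIV. ginv (e t) k a * (e t a \<bullet> z b + z a \<bullet> e t b))" for b
    by (simp add: sum.distrib eq_neg_iff_add_eq_0)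
  have "h k l = (\<Sum>a\<in>UNIV. h k a * (\<Sum>b\<in>UNIV. (e t a \<bullet> e t b) * ginv (e t) b l))"
    by (simp add: ginv_right[OF fr[OF S(2)]] if_distrib cong: if_cong)
  also have "\<dots> = (\<Sum>b\<in>UNIV. (\<Sum>a\<in>UNIV. h k a * (e t a \<bullet> e t b)) * ginv (e t) b l)"
    unfolding sum_distrib_left sum_distrib_right by (subst sum.swap) (simp add: algebra_simps)
  also have "\<dots> = - (\<Sum>b\<in>UNIV. \<Sum>a\<in>UNIV. ginv (e t) k a * ginv (e t) l b * (z a \<bullet> e t b + e t a \<bullet> z b))"
    unfolding * using ginv_sym[OF fr[OF S(2)]]
    by (simp add: sum_distrib_right sum_distrib_left sum_negf[symmetric] algebra_simps)
  finally show ?thesis using h[of k l] by (subst sum.swap) simp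
qed

lemma smooth_on_det_gram:
  assumes "open S" "\<And>i. smooth_on S (\<lambda>x. e x i)"
  shows "smooth_on S (\<lambda>x. det (gram (e x)))"
  unfolding gram_def by (intro smooth_on_det) (auto intro!: smooth_intros assms)

lemma smooth_on_ginv:
  fixes e :: "'b::real_normed_vector \<Rightarrow> 'n::finite \<Rightarrow> 'a::euclidean_space"
  assumes "open S" "\<And>i. smooth_on S (\<lambda>x. e x i)" "\<And>x. x \<in> S \<Longrightarrow> frame (e x)"
  shows "smooth_on S (\<lambda>x. ginv (e x) i j)"
proof -
  have "smooth_on S (\<lambda>x. det (\<chi> a b. if b = i then (if a = j then 1 else 0) else e x a \<bullet> e x b) / det (gram (e x)))"
  proof (rule smooth_on_divide[OF assms(1) smooth_on_det[OF assms(1)] smooth_on_det_gram[OF assms(1,2)]])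
    show "smooth_on S (\<lambda>x. (\<chi> a b. if b = i then (if a = j then 1 else 0) else e x a \<bullet> e x b) $ a $ b)" for a b
      by (cases "b = i") (auto intro!: smooth_intros assms)
  qed (use det_gram_pos[OF assms(3)] in force)
  then show ?thesis
    by (rule smooth_on_cong[OF assms(1), rotated]) (simp add: ginv_cramer[OF assms(3)])
qed

section \<open>Change of variables\<close>

text \<open>The change of variables theorem of the library needs a well-ordered index type.\<close>

typedef ('n::finite) idx = "{..<CARD('n)}"
  by (rule exI[of _ 0]) simp

instance idx :: (finite) finite
proof
  have "finite (Abs_idx ` {..<CARD('a)} :: 'a idx set)" by simp
  moreover have "(UNIV :: 'a idx set) = Abs_idx ` {..<CARD('a)}"
    using Rep_idx Rep_idx_inverse by (metis UNIV_eq_I image_eqI)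
  ultimately show "finite (UNIV :: 'a idx set)" by simp
qed

instantiation idx :: (finite) wellorder
begin
definition less_eq_idx :: "'a idx \<Rightarrow> 'a idx \<Rightarrow> bool" where "less_eq_idx x y \<longleftrightarrow> Rep_idx x \<le> Rep_idx y"
definition less_idx :: "'a idx \<Rightarrow> 'a idx \<Rightarrow> bool" where "less_idx x y \<longleftrightarrow> Rep_idx x < Rep_idx y"
instance
proof
  fix P :: "'a idx \<Rightarrow> bool" and a
  assume *: "\<And>x. (\<And>y. y < x \<Longrightarrow> P y) \<Longrightarrow> P x"
  show "P a"
    by (induction a rule: measure_induct_rule[where f = Rep_idx]) (use * in \<open>auto simp: less_idx_def\<close>)
qed (auto simp: less_eq_idx_def less_idx_def Rep_idx_inject)
end

lemma card_idx: "CARD('n idx) = CARD('n::finite)"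
  using type_definition.card[OF type_definition_idx] by simp

text \<open>Conjugation with \<open>b\<close> is a sign-preserving bijection between the
  permutations of the two index types, and it matches the products in the two Leibniz
  expansions.\<close>

lemma det_reindex:
  fixes A :: "real^'n::finite^'n" and b :: "'m::finite \<Rightarrow> 'n"
  assumes b: "bij b"
  shows "det (\<chi> i j. A $ b i $ b j) = det A"
proof -
  let ?m = "map_permutation UNIV b"
  have inj: "inj b" and r: "range b = UNIV" using b by (auto simp: bij_def)
  have eq: "?m p = b \<circ> p \<circ> inv b" for p
    unfolding map_permutation_def r by (simp add: restrict_id_def fun_eq_iff)
  have bb: "bij_betw ?m {p. p permutes UNIV} {p. p permutes UNIV}"
  proof (rule bij_betw_byWitness[where f' = "map_permutation UNIV (inv b)"])
    have eq': "map_permutation UNIV (inv b) p = inv b \<circ> p \<circ> b" for p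
      using b by (simp add: map_permutation_def restrict_id_def inv_inv_eq bij_imp_bij_inv bij_is_surj fun_eq_iff)
    show "\<forall>p\<in>{p. p permutes UNIV}. map_permutation UNIV (inv b) (?m p) = p"
      unfolding eq eq' using inj by (auto simp: fun_eq_iff)
    show "\<forall>p\<in>{p. p permutes UNIV}. ?m (map_permutation UNIV (inv b) p) = p"
      unfolding eq eq' using b by (auto simp: fun_eq_iff bij_def surj_f_inv_f)
    show "?m ` {p. p permutes UNIV} \<subseteq> {p. p permutes UNIV}"
      using map_permutation_permutes[of b UNIV UNIV] b by auto
    show "map_permutation UNIV (inv b) ` {p. p permutes UNIV} \<subseteq> {p. p permutes UNIV}"
      using map_permutation_permutes[of "inv b" UNIV UNIV] b by (auto simp: bij_imp_bij_inv)
  qed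
  have "det A = (\<Sum>p | p permutes UNIV. of_int (sign (?m p)) * (\<Prod>i\<in>UNIV. A $ i $ (?m p) i))"
    unfolding det_def by (rule sum.reindex_bij_betw[OF bb, symmetric])
  also have "\<dots> = (\<Sum>p | p permutes UNIV. of_int (sign p) * (\<Prod>i\<in>UNIV. A $ b i $ b (p i)))"
  proof (intro sum.cong refl)
    fix p :: "'m \<Rightarrow> 'm" assume "p \<in> {p. p permutes UNIV}"
    then have "sign (?m p) = sign p" by (intro sign_map_permutation inj) auto
    moreover have "(\<Prod>i\<in>UNIV. A $ i $ (?m p) i) = (\<Prod>i\<in>UNIV. A $ b i $ (?m p) (b i))"
      by (rule prod.reindex_bij_betw[OF b, symmetric])
    ultimately show "of_int (sign (?m p)) * (\<Prod>i\<in>UNIV. A $ i $ (?m p) i) = of_int (sign p) * (\<Prod>i\<in>UNIV. A $ b i $ b (p i))"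
      using inj by (simp add: eq)
  qed
  finally show ?thesis by (simp add: det_def)
qed

lemma prod_Basis_vec: "(\<Prod>b\<in>Basis. (x::real^'n::finite) \<bullet> b) = (\<Prod>i\<in>UNIV. x $ i)"
proof -
  have "Basis = range (\<lambda>i::'n. axis i (1::real))" by (auto simp: Basis_vec_def)
  moreover have "inj (\<lambda>i::'n. axis i (1::real))" by (auto intro!: injI simp: axis_eq_axis)
  ultimately have "(\<Prod>b\<in>Basis. x \<bullet> b) = (\<Prod>i\<in>UNIV. x \<bullet> axis i 1)"
    using prod.reindex[of "\<lambda>i::'n. axis i (1::real)" UNIV "\<lambda>b. x \<bullet> b"] by (simp only: o_def)
  then show ?thesis by (simp add: inner_axis)
qed

text \<open>Relabelling coordinates carries boxes to boxes with the same side lengths, and boxes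
  determine Lebesgue measure.\<close>

lemma lborel_reindex:
  fixes b :: "'m::finite \<Rightarrow> 'n::finite"
  assumes b: "bij b"
  shows "lborel = distr lborel borel (\<lambda>x::real^'n. (\<chi> i. x $ b i) :: real^'m)"
proof (rule lborel_eqI)
  let ?h = "\<lambda>x::real^'n. (\<chi> i. x $ b i) :: real^'m"
  fix l u :: "real^'m" assume le: "\<And>c. c \<in> Basis \<Longrightarrow> l \<bullet> c \<le> u \<bullet> c"
  let ?k = "\<lambda>y::real^'m. (\<chi> j. y $ inv b j) :: real^'n"
  have le': "l $ i \<le> u $ i" for i using le[of "axis i 1"] by (simp add: inner_axis)
  have vim: "?h -` box l u = box (?k l) (?k u)"
    using b by (auto simp: mem_box_cart) (metis bij_inv_eq_iff)+
  have cont: "continuous_on UNIV ?h"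
    by (intro linear_continuous_on linear_linear[THEN iffD2] linearI) (auto simp: vec_eq_iff)
  have "emeasure (distr lborel borel ?h) (box l u) = emeasure lborel (box (?k l) (?k u))"
    by (subst emeasure_distr) (auto simp: vim intro!: borel_measurable_continuous_onI cont)
  also have "\<dots> = (\<Prod>c\<in>Basis. (?k u - ?k l) \<bullet> c)"
    by (rule emeasure_lborel_box) (use le' in \<open>auto simp: Basis_vec_def inner_axis\<close>)
  also have "\<dots> = (\<Prod>i\<in>UNIV. u $ i - l $ i)"
    unfolding prod_Basis_vec
    by (subst prod.reindex_bij_betw[OF bij_imp_bij_inv[OF b], of "\<lambda>i. u $ i - l $ i", symmetric]) simp
  finally show "emeasure (distr lborel borel ?h) (box l u) = (\<Prod>b\<in>Basis. (u - l) \<bullet> b)"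
    by (simp add: prod_Basis_vec)
qed simp

text \<open>\<open>has_measure_differentiable_image\<close> equates a finite measure with a finite
  integral; the two cases below turn this equivalence into an equation in [0, infinity].\<close>

lemma emeasure_differentiable_image_wellorder:
  fixes g :: "real^'n::{finite,wellorder} \<Rightarrow> real^'n::_"
  assumes B: "B \<in> sets borel" and gB: "g ` B \<in> sets borel"
    and der: "\<And>x. x \<in> B \<Longrightarrow> (g has_derivative g' x) (at x)"
    and inj: "inj_on g B"
    and meas: "(\<lambda>x. indicator B x * \<bar>det (matrix (g' x))\<bar>) \<in> borel_measurable borel"
  shows "emeasure lborel (g ` B) = (\<integral>\<^sup>+x\<in>B. ennreal \<bar>det (matrix (g' x))\<bar> \<partial>lborel)"
proof -
  let ?f = "\<lambda>x. \<bar>det (matrix (g' x))\<bar>"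
  have R: "(\<integral>\<^sup>+x\<in>B. ennreal (?f x) \<partial>lborel) = (\<integral>\<^sup>+x. ennreal (indicator B x * ?f x) \<partial>lborel)"
    by (intro nn_integral_cong) (auto simp: indicator_def)
  have *: "g ` B \<in> lmeasurable \<and> measure lebesgue (g ` B) = m \<longleftrightarrow> (?f has_integral m) B" for m
    by (rule has_measure_differentiable_image) (use B der inj in \<open>auto intro: has_derivative_at_withinI\<close>)
  have e: "emeasure lebesgue (g ` B) = emeasure lborel (g ` B)" using gB by simp
  show ?thesis
  proof (cases "(\<integral>\<^sup>+x. ennreal (indicator B x * ?f x) \<partial>lborel)")
    case (real r)
    have "((\<lambda>x. indicator B x * ?f x) has_integral r) UNIV"
      by (rule nn_integral_has_integral) (use real meas in auto)
    then have "(?f has_integral r) B"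
      by (subst (asm) has_integral_restrict_UNIV[symmetric])
        (simp add: indicator_def of_bool_def if_distrib[of "\<lambda>x. x * _"] has_integral_restrict_UNIV cong: if_cong)
    then have "g ` B \<in> lmeasurable" "measure lebesgue (g ` B) = r" using * by auto
    then have "emeasure lebesgue (g ` B) = ennreal r"
      by (metis emeasure_eq_measure2 fmeasurableD2 top.not_eq_extremum)
    then show ?thesis using real e R by simp
  next
    case top
    have "g ` B \<notin> lmeasurable"
    proof
      assume "g ` B \<in> lmeasurable"
      then have "(?f has_integral measure lebesgue (g ` B)) B" using * by blast
      from nn_integral_has_integral_lebesgue[OF _ this] have "(\<integral>\<^sup>+x. ennreal (indicator B x * ?f x) \<partial>lborel) \<noteq> \<infinity>"
        by simp
      then show False using top by simp
    qed
    then have "emeasure lebesgue (g ` B) = \<infinity>"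
      using gB by (auto simp: fmeasurable_def) (metis infinity_ennreal_def top.not_eq_extremum)
    then show ?thesis using top e R by simp
  qed
qed

lemma matrix_nth: "matrix f $ i $ j = f (axis j 1) $ i"
  by (simp add: matrix_def)

text \<open>The map is conjugated with the relabelling \<open>h\<close> of the coordinates, which
  preserves Lebesgue measure and, by \<open>det_reindex\<close>, the Jacobi determinant.\<close>

lemma emeasure_differentiable_image:
  fixes g :: "real^'n::finite \<Rightarrow> real^'n"
  assumes B: "B \<in> sets borel" and gB: "g ` B \<in> sets borel"
    and der: "\<And>x. x \<in> B \<Longrightarrow> (g has_derivative g' x) (at x)"
    and inj: "inj_on g B"
    and meas: "(\<lambda>x. indicator B x * \<bar>det (matrix (g' x))\<bar>) \<in> borel_measurable borel"
  shows "emeasure lborel (g ` B) = (\<integral>\<^sup>+x\<in>B. ennreal \<bar>det (matrix (g' x))\<bar> \<partial>lborel)"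
proof -
  obtain b :: "'n idx \<Rightarrow> 'n" where b: "bij b"
    using card_idx[where 'n='n] finite_same_card_bij[of "UNIV :: 'n idx set" "UNIV :: 'n set"] by auto
  define h where "h = (\<lambda>x::real^'n. (\<chi> i. x $ b i) :: real^'n idx)"
  define k where "k = (\<lambda>y::real^'n idx. (\<chi> j. y $ inv b j) :: real^'n)"
  have binv: "b (inv b i) = i" "inv b (b j) = j" for i j
    by (rule surj_f_inv_f[OF bij_is_surj[OF b]], rule inv_f_f[OF bij_is_inj[OF b]])
  have hk: "h (k y) = y" and kh: "k (h x) = x" for x y
    by (auto simp: h_def k_def vec_eq_iff binv)
  have lh: "linear h" and lk: "linear k" unfolding h_def k_def by (auto intro!: linearI simp: vec_eq_iff)
  have [measurable]: "h \<in> borel_measurable borel" "k \<in> borel_measurable borel"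
    using lh lk by (auto intro!: borel_measurable_continuous_onI linear_continuous_on simp: linear_linear)
  have himg: "h ` C = k -` C" for C by (force simp: hk kh image_iff)
  have borelh: "h ` C \<in> sets borel" if "C \<in> sets borel" for C
    using measurable_sets_borel[OF _ that, of k] by (simp add: himg)
  have emh: "emeasure lborel (h ` C) = emeasure lborel C" if C: "C \<in> sets borel" for C
  proof -
    have "emeasure lborel (h ` C) = emeasure (distr lborel borel h) (h ` C)"
      unfolding h_def by (subst lborel_reindex[OF b]) simp
    also have "\<dots> = emeasure lborel (h -` (h ` C))"
      by (subst emeasure_distr) (auto simp: borelh[OF C])
    also have "h -` (h ` C) = C" using kh by (metis inj_on_inverseI inj_vimage_image_eq)
    finally show ?thesis .
  qed
  define G where "G = h \<circ> g \<circ> k"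
  define G' where "G' y = h \<circ> g' (k y) \<circ> k" for y
  have kax: "k (axis j 1) = axis (b j) 1" for j
    by (auto simp: k_def axis_def vec_eq_iff binv)
  have "matrix (G' y) = (\<chi> i j. matrix (g' (k y)) $ b i $ b j)" for y
    unfolding vec_eq_iff by (simp add: matrix_nth G'_def kax) (simp add: h_def)
  then have det: "det (matrix (G' y)) = det (matrix (g' (k y)))" for y
    by (simp add: det_reindex[OF b])
  have Gh: "G ` (h ` B) = h ` (g ` B)" by (auto simp: G_def kh image_iff)
  have ind: "indicator (h ` B) y = (indicator B (k y) :: 'x::zero_neq_one)" for y
    by (auto simp: himg indicator_def)
  have "emeasure lborel (G ` (h ` B)) = (\<integral>\<^sup>+y\<in>h ` B. ennreal \<bar>det (matrix (G' y))\<bar> \<partial>lborel)"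
  proof (rule emeasure_differentiable_image_wellorder)
    show "h ` B \<in> sets borel" "G ` (h ` B) \<in> sets borel" using borelh B gB Gh by auto
    show "(G has_derivative G' y) (at y)" if "y \<in> h ` B" for y
    proof -
      have "(g has_derivative g' (k y)) (at (k y))" using der that by (auto simp: kh)
      then show ?thesis unfolding G_def G'_def
        using linear_imp_has_derivative[OF lh] linear_imp_has_derivative[OF lk]
        by (intro diff_chain_at) auto
    qed
    show "inj_on G (h ` B)"
      using inj unfolding G_def inj_on_def by (auto simp: kh) (metis kh)
    show "(\<lambda>y. indicator (h ` B) y * \<bar>det (matrix (G' y))\<bar>) \<in> borel_measurable borel"
      unfolding det ind using measurable_compose[OF _ meas, of k borel] by simp
  qed
  also have "\<dots> = (\<integral>\<^sup>+y. ennreal (indicator B (k y) * \<bar>det (matrix (g' (k y)))\<bar>) \<partial>distr lborel borel h)"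
    unfolding det ind lborel_reindex[OF b, folded h_def, symmetric]
    by (intro nn_integral_cong) (auto simp: indicator_def)
  also have "\<dots> = (\<integral>\<^sup>+x. ennreal (indicator B x * \<bar>det (matrix (g' x))\<bar>) \<partial>lborel)"
    by (subst nn_integral_distr) (use measurable_compose[OF _ meas, of k borel] in \<open>auto simp: kh\<close>)
  also have "\<dots> = (\<integral>\<^sup>+x\<in>B. ennreal \<bar>det (matrix (g' x))\<bar> \<partial>lborel)"
    by (intro nn_integral_cong) (auto simp: indicator_def)
  finally show ?thesis unfolding Gh by (simp add: emh gB)
qed

lemma nn_integral_change_of_variables:
  fixes g :: "real^'n::finite \<Rightarrow> real^'n" and f :: "real^'n \<Rightarrow> ennreal"
  assumes B: "B \<in> sets borel" and gB: "g ` B \<in> sets borel"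
    and der: "\<And>x. x \<in> B \<Longrightarrow> (g has_derivative g' x) (at x)"
    and inj: "inj_on g B"
    and meas: "(\<lambda>x. indicator B x * \<bar>det (matrix (g' x))\<bar>) \<in> borel_measurable borel"
    and f: "(\<lambda>y. f y * indicator (g ` B) y) \<in> borel_measurable borel"
  shows "(\<integral>\<^sup>+y\<in>g ` B. f y \<partial>lborel) = (\<integral>\<^sup>+x\<in>B. ennreal \<bar>det (matrix (g' x))\<bar> * f (g x) \<partial>lborel)"
proof -
  let ?d = "\<lambda>x. \<bar>det (matrix (g' x))\<bar>"
  let ?N = "density (restrict_space lborel B) (\<lambda>x. ennreal (?d x))"
  have cont: "continuous_on B g"
    using der by (meson continuous_at_imp_continuous_on has_derivative_continuous)
  have gm: "g \<in> measurable (restrict_space borel B) (restrict_space borel (g ` B))"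
    by (intro measurable_restrict_space2 borel_measurable_continuous_on_restrict cont) (auto simp: space_restrict_space)
  have dm: "(\<lambda>x. ennreal (?d x)) \<in> borel_measurable (restrict_space lborel B)"
  proof -
    have "?d \<in> borel_measurable (restrict_space borel B)"
      using meas B by (subst borel_measurable_restrict_space_iff) (auto simp: mult.commute)
    then show ?thesis by (simp cong: measurable_cong_sets sets_restrict_space_cong)
  qed
  \<comment> \<open>Applied to all Borel subsets of the image, the volume formula says that Lebesgue
    measure there is the push-forward of the Jacobian density. Integrals of functions then follow by
    transport.\<close>
  have eq: "restrict_space lborel (g ` B) = distr ?N (restrict_space borel (g ` B)) g"
  proof (rule measure_eqI)
    show "sets (restrict_space lborel (g ` B)) = sets (distr ?N (restrict_space borel (g ` B)) g)"
      by (simp cong: sets_restrict_space_cong)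
    fix C assume "C \<in> sets (restrict_space lborel (g ` B))"
    then have C: "C \<subseteq> g ` B" "C \<in> sets borel" using gB by (auto simp: sets_restrict_space_iff)
    define D where "D = g -` C \<inter> B"
    have "D \<in> sets (restrict_space borel B)"
      using measurable_sets[OF gm, of C] C gB by (simp add: D_def space_restrict_space sets_restrict_space_iff)
    then have D: "D \<in> sets borel" "D \<subseteq> B" using B by (auto simp: sets_restrict_space_iff)
    have gD: "g ` D = C" using C by (auto simp: D_def)
    have "emeasure lborel (g ` D) = (\<integral>\<^sup>+x\<in>D. ennreal (?d x) \<partial>lborel)"
    proof (rule emeasure_differentiable_image)
      show "(\<lambda>x. indicator D x * ?d x) \<in> borel_measurable borel"
      proof -
        have "(\<lambda>x. indicator D x * (indicator B x * ?d x)) \<in> borel_measurable borel"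
          using D(1) meas by measurable
        also have "(\<lambda>x. indicator D x * (indicator B x * ?d x)) = (\<lambda>x. indicator D x * ?d x)"
          using D(2) by (auto simp: indicator_def fun_eq_iff)
        finally show ?thesis .
      qed
    qed (use D gD C der inj in \<open>auto intro: inj_on_subset\<close>)
    also have "\<dots> = (\<integral>\<^sup>+x\<in>B. ennreal (?d x) * indicator D x \<partial>lborel)"
      using D(2) by (intro nn_integral_cong) (auto simp: indicator_def)
    also have "\<dots> = (\<integral>\<^sup>+x. ennreal (?d x) * indicator D x \<partial>restrict_space lborel B)"
      using B by (subst nn_integral_restrict_space) auto
    also have "\<dots> = emeasure ?N D"
      by (subst emeasure_density[OF dm]) (use D B in \<open>auto simp: sets_restrict_space_iff\<close>)
    also have "\<dots> = emeasure (distr ?N (restrict_space borel (g ` B)) g) C"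
      by (subst emeasure_distr) (use gm C gB in \<open>auto simp: sets_restrict_space_iff D_def space_restrict_space Int_commute
        cong: measurable_cong_sets sets_restrict_space_cong\<close>)
    finally show "emeasure (restrict_space lborel (g ` B)) C = emeasure (distr ?N (restrict_space borel (g ` B)) g) C"
      using C gB gD by (simp add: emeasure_restrict_space)
  qed
  have fm: "f \<in> borel_measurable (restrict_space borel (g ` B))"
    using f gB by (subst borel_measurable_restrict_space_iff_ennreal) auto
  have fgm: "(\<lambda>x. f (g x)) \<in> borel_measurable (restrict_space lborel B)"
    using measurable_compose[OF gm fm] by (simp cong: measurable_cong_sets sets_restrict_space_cong)
  have "(\<integral>\<^sup>+y\<in>g ` B. f y \<partial>lborel) = (\<integral>\<^sup>+y. f y \<partial>restrict_space lborel (g ` B))"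
    using gB by (subst nn_integral_restrict_space) auto
  also have "\<dots> = (\<integral>\<^sup>+x. f (g x) \<partial>?N)"
    unfolding eq by (rule nn_integral_distr) (use gm fm in \<open>auto cong: measurable_cong_sets sets_restrict_space_cong\<close>)
  also have "\<dots> = (\<integral>\<^sup>+x. ennreal (?d x) * f (g x) \<partial>restrict_space lborel B)"
    by (rule nn_integral_density[OF dm]) (rule fgm)
  also have "\<dots> = (\<integral>\<^sup>+x\<in>B. ennreal (?d x) * f (g x) \<partial>lborel)"
    using B by (subst nn_integral_restrict_space) auto
  finally show ?thesis .
qed

section \<open>Charts and the volume measure\<close>

lemma vec_expansion: "(\<Sum>k\<in>UNIV. (a $ k) *\<^sub>R axis k 1) = (a :: real^'n::finite)"
  by (simp add: vec_eq_iff axis_def if_distrib cong: if_cong)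

lemma pd_compose:
  fixes \<tau> :: "real^'n::finite \<Rightarrow> real^'m::finite" and \<phi> :: "real^'m \<Rightarrow> 'a::euclidean_space"
  assumes "\<tau> differentiable (at u)" "\<phi> differentiable (at (\<tau> u))"
  shows "pd (\<lambda>v. \<phi> (\<tau> v)) i u = (\<Sum>k\<in>UNIV. (frechet_derivative \<tau> (at u) (axis i 1) $ k) *\<^sub>R pd \<phi> k (\<tau> u))"
proof -
  let ?D = "frechet_derivative \<phi> (at (\<tau> u))"
  have l: "linear ?D" using assms(2) by (rule linear_frechet_derivative)
  have "frechet_derivative (\<phi> \<circ> \<tau>) (at u) = ?D \<circ> frechet_derivative \<tau> (at u)"
    by (rule frechet_derivative_compose[OF assms])
  then have "pd (\<lambda>v. \<phi> (\<tau> v)) i u = ?D (frechet_derivative \<tau> (at u) (axis i 1))"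
    by (simp add: pd_def o_def)
  also have "\<dots> = ?D (\<Sum>k\<in>UNIV. (frechet_derivative \<tau> (at u) (axis i 1) $ k) *\<^sub>R axis k 1)"
    by (simp only: vec_expansion)
  finally show ?thesis by (simp add: linear_sum[OF l] linear_cmul[OF l] pd_def)
qed

lemma lincomb_pd:
  assumes "\<phi> differentiable (at u)"
  shows "lincomb (\<lambda>i. pd \<phi> i u) a = frechet_derivative \<phi> (at u) a"
proof -
  note l = linear_frechet_derivative[OF assms]
  have "frechet_derivative \<phi> (at u) a = frechet_derivative \<phi> (at u) (\<Sum>k\<in>UNIV. (a $ k) *\<^sub>R axis k 1)"
    by (simp only: vec_expansion)
  then show ?thesis by (simp add: linear_sum[OF l] linear_cmul[OF l] pd_def lincomb_def)
qed

lemma frame_pd_iff: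
  assumes "\<phi> differentiable (at u)"
  shows "frame (\<lambda>i. pd \<phi> i u) \<longleftrightarrow> inj (frechet_derivative \<phi> (at u))"
  unfolding frame_def using lincomb_pd[OF assms] by (metis ext)

lemma metric_gram: "metric \<phi> u = gram (\<lambda>i. pd \<phi> i u)"
  by (simp add: metric_def gram_def)

lemma inv_metric_ginv: "inv_metric \<phi> u i j = ginv (\<lambda>i. pd \<phi> i u) i j"
  by (simp add: inv_metric_def ginv_def metric_gram)

lemma smooth_on_pd [smooth_intros]: "smooth_on S \<phi> \<Longrightarrow> smooth_on S (pd \<phi> i)"
  unfolding pd_def[abs_def] by (rule smooth_on_frechet)

section \<open>Charts and transition maps\<close>

locale smooth_manifold =
  fixes M :: "'m::{t2_space,second_countable_topology} set" and \<A> :: "('n::finite, 'm) atlas"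
  assumes atlas: "smooth_atlas M \<A>"
begin

lemma
  assumes "(W, \<psi>) \<in> \<A>"
  shows chart_open: "open W"
    and chart_openin: "openin (top_of_set M) (\<psi> ` W)"
    and chart_subset: "\<psi> ` W \<subseteq> M"
    and chart_continuous: "continuous_on W \<psi>"
    and chart_inj: "inj_on \<psi> W"
    and chart_inv_continuous: "continuous_on (\<psi> ` W) (inv_into W \<psi>)"
proof -
  have *: "open W \<and> openin (top_of_set M) (\<psi> ` W) \<and> (\<exists>\<theta>. homeomorphism W (\<psi> ` W) \<psi> \<theta>)"
    using atlas assms unfolding smooth_atlas_def by blast
  then obtain \<theta> where \<theta>: "homeomorphism W (\<psi> ` W) \<psi> \<theta>" by blast
  show "open W" "openin (top_of_set M) (\<psi> ` W)" using * by auto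
  then show "\<psi> ` W \<subseteq> M" by (simp add: openin_imp_subset)
  show "continuous_on W \<psi>" using \<theta> by (simp add: homeomorphism_def)
  show inj: "inj_on \<psi> W" using \<theta> unfolding homeomorphism_def by (metis inj_on_inverseI)
  have "inv_into W \<psi> q = \<theta> q" if "q \<in> \<psi> ` W" for q
    using that \<theta> inj by (auto simp: homeomorphism_def)
  moreover have "continuous_on (\<psi> ` W) \<theta>" using \<theta> by (simp add: homeomorphism_def)
  ultimately show "continuous_on (\<psi> ` W) (inv_into W \<psi>)" by (simp cong: continuous_on_cong)
qed

lemma chart_cover:
  assumes "q \<in> M"
  obtains W \<psi> u where "(W, \<psi>) \<in> \<A>" "u \<in> W" "\<psi> u = q"
  using atlas assms unfolding smooth_atlas_def by fast

definition overlap :: "(real^'n) set \<Rightarrow> (real^'n \<Rightarrow> 'm) \<Rightarrow> (real^'n) set \<Rightarrow> (real^'n \<Rightarrow> 'm) \<Rightarrow> (real^'n) set" where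
  "overlap W1 \<psi>1 W2 \<psi>2 = {u\<in>W1. \<psi>1 u \<in> \<psi>2 ` W2}"

definition trans_map :: "(real^'n \<Rightarrow> 'm) \<Rightarrow> (real^'n) set \<Rightarrow> (real^'n \<Rightarrow> 'm) \<Rightarrow> real^'n \<Rightarrow> real^'n" where
  "trans_map \<psi>1 W2 \<psi>2 u = inv_into W2 \<psi>2 (\<psi>1 u)"

lemma chart_vimage_open:
  assumes c: "(W, \<psi>) \<in> \<A>" and U: "openin (top_of_set M) U"
  shows "open {u\<in>W. \<psi> u \<in> U}"
proof -
  obtain T where T: "open T" "U = M \<inter> T" using U by (auto simp: openin_open)
  have "open (W \<inter> \<psi> -` T)"
    by (rule continuous_open_preimage[OF chart_continuous[OF c] chart_open[OF c] T(1)])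
  moreover have "W \<inter> \<psi> -` T = {u\<in>W. \<psi> u \<in> U}" using chart_subset[OF c] T(2) by auto
  ultimately show ?thesis by simp
qed

lemma openin_diff_compact: "compact K \<Longrightarrow> openin (top_of_set M) (M - K)"
  using compact_imp_closed[of K] by (auto simp: openin_open intro!: exI[of _ "- K"])

lemma chart_image_openin:
  assumes c: "(W, \<psi>) \<in> \<A>" and U: "open U" "U \<subseteq> W"
  shows "openin (top_of_set M) (\<psi> ` U)"
proof -
  have "openin (top_of_set (\<psi> ` W)) (\<psi> ` W \<inter> inv_into W \<psi> -` U)"
    by (rule continuous_openin_preimage_gen[OF chart_inv_continuous[OF c] U(1)])
  moreover have "\<psi> ` W \<inter> inv_into W \<psi> -` U = \<psi> ` U"
    using U(2) by (auto simp: inv_into_f_f[OF chart_inj[OF c]])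
  ultimately show ?thesis using chart_openin[OF c] openin_trans by fastforce
qed

lemma
  assumes c1: "(W1, \<psi>1) \<in> \<A>" and c2: "(W2, \<psi>2) \<in> \<A>"
  shows overlap_open: "open (overlap W1 \<psi>1 W2 \<psi>2)"
    and trans_map_smooth: "smooth_on (overlap W1 \<psi>1 W2 \<psi>2) (trans_map \<psi>1 W2 \<psi>2)"
    and trans_map_in: "u \<in> overlap W1 \<psi>1 W2 \<psi>2 \<Longrightarrow> trans_map \<psi>1 W2 \<psi>2 u \<in> W2"
    and trans_map_eq: "u \<in> overlap W1 \<psi>1 W2 \<psi>2 \<Longrightarrow> \<psi>2 (trans_map \<psi>1 W2 \<psi>2 u) = \<psi>1 u"
    and trans_map_inj: "inj_on (trans_map \<psi>1 W2 \<psi>2) (overlap W1 \<psi>1 W2 \<psi>2)"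
proof -
  show "open (overlap W1 \<psi>1 W2 \<psi>2)"
    unfolding overlap_def using chart_vimage_open[OF c1 chart_openin[OF c2]] .
  show "smooth_on (overlap W1 \<psi>1 W2 \<psi>2) (trans_map \<psi>1 W2 \<psi>2)"
    using atlas c1 c2 unfolding smooth_atlas_def overlap_def trans_map_def[abs_def] by blast
  show 1: "u \<in> overlap W1 \<psi>1 W2 \<psi>2 \<Longrightarrow> \<psi>2 (trans_map \<psi>1 W2 \<psi>2 u) = \<psi>1 u" for u
    unfolding overlap_def trans_map_def by (simp add: f_inv_into_f)
  show "u \<in> overlap W1 \<psi>1 W2 \<psi>2 \<Longrightarrow> trans_map \<psi>1 W2 \<psi>2 u \<in> W2" for u
    unfolding overlap_def trans_map_def by (simp add: inv_into_into)
  show "inj_on (trans_map \<psi>1 W2 \<psi>2) (overlap W1 \<psi>1 W2 \<psi>2)"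
  proof (rule inj_onI)
    fix u v assume uv: "u \<in> overlap W1 \<psi>1 W2 \<psi>2" "v \<in> overlap W1 \<psi>1 W2 \<psi>2" "trans_map \<psi>1 W2 \<psi>2 u = trans_map \<psi>1 W2 \<psi>2 v"
    then have "\<psi>1 u = \<psi>1 v" using 1 by metis
    then show "u = v" using uv chart_inj[OF c1] by (auto simp: overlap_def inj_on_def)
  qed
qed

lemma trans_map_unique:
  assumes "(W2, \<psi>2) \<in> \<A>" "u2 \<in> W2" "\<psi>2 u2 = \<psi>1 u1"
  shows "trans_map \<psi>1 W2 \<psi>2 u1 = u2"
  using assms chart_inj[OF assms(1)] unfolding trans_map_def by (metis inv_into_f_f)

lemma chart_vimage_borel:
  assumes c: "(W, \<psi>) \<in> \<A>" and B: "B \<in> sets (restrict_space borel M)"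
  shows "{u\<in>W. \<psi> u \<in> B} \<in> sets borel"
proof -
  obtain T where T: "T \<in> sets borel" "B = M \<inter> T" using B by (auto simp: sets_restrict_space)
  have "\<psi> \<in> borel_measurable (restrict_space borel W)"
    by (rule borel_measurable_continuous_on_restrict[OF chart_continuous[OF c]])
  from measurable_sets[OF this T(1)] have "\<psi> -` T \<inter> W \<in> sets (restrict_space borel W)"
    by (simp add: space_restrict_space)
  moreover have "\<psi> -` T \<inter> W = {u\<in>W. \<psi> u \<in> B}" using chart_subset[OF c] T(2) by auto
  ultimately show ?thesis using chart_open[OF c] by (auto simp: sets_restrict_space_iff)
qed

lemma openin_imp_sets: "openin (top_of_set M) U \<Longrightarrow> U \<in> sets (restrict_space borel M)"
  by (auto simp: openin_open sets_restrict_space)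

text \<open>The inverse of a chart is continuous, so the image is a Borel subset of the chart range,
  and this range is itself open in \<open>M\<close>.\<close>

lemma chart_image_borel:
  assumes c: "(W, \<psi>) \<in> \<A>" and B: "B \<in> sets borel" "B \<subseteq> W"
  shows "\<psi> ` B \<in> sets (restrict_space borel M)"
proof -
  have "inv_into W \<psi> \<in> borel_measurable (restrict_space borel (\<psi> ` W))"
    by (rule borel_measurable_continuous_on_restrict[OF chart_inv_continuous[OF c]])
  from measurable_sets[OF this B(1)] have "inv_into W \<psi> -` B \<inter> \<psi> ` W \<in> sets (restrict_space borel (\<psi> ` W))"
    by (simp add: space_restrict_space)
  moreover have "inv_into W \<psi> -` B \<inter> \<psi> ` W = \<psi> ` B"
    using B(2) by (auto simp: inv_into_f_f[OF chart_inj[OF c]])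
  ultimately obtain T where T: "T \<in> sets borel" "\<psi> ` B = \<psi> ` W \<inter> T" by (auto simp: sets_restrict_space)
  obtain U where "open U" "\<psi> ` W = M \<inter> U" using chart_openin[OF c] by (auto simp: openin_open)
  then have "\<psi> ` B = M \<inter> (U \<inter> T)" "U \<inter> T \<in> sets borel" using T by auto
  then show ?thesis by (auto simp: sets_restrict_space)
qed

lemma countable_charts:
  obtains W :: "nat \<Rightarrow> (real^'n) set" and \<psi> where "\<And>n. W n = {} \<or> (W n, \<psi> n) \<in> \<A>" "(\<Union>n. \<psi> n ` W n) = M"
proof -
  define F where "F = {T. open T \<and> (\<exists>c\<in>\<A>. M \<inter> T = snd c ` fst c)}"
  obtain F' where F': "F' \<subseteq> F" "countable F'" "\<Union>F' = \<Union>F"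
    using Lindelof[of F] unfolding F_def by auto
  have sub: "M \<subseteq> \<Union>F"
  proof
    fix q assume "q \<in> M"
    then obtain W \<psi> u where c: "(W, \<psi>) \<in> \<A>" "u \<in> W" "\<psi> u = q" by (rule chart_cover)
    obtain T where T: "open T" "\<psi> ` W = M \<inter> T" using chart_openin[OF c(1)] by (auto simp: openin_open)
    have "T \<in> F" unfolding F_def using T c(1) by (auto intro!: bexI[of _ "(W, \<psi>)"])
    moreover have "q \<in> T" using T(2) c by blast
    ultimately show "q \<in> \<Union>F" by blast
  qed
  \<comment> \<open>Several charts may have the same range; one is selected for each open
    set.\<close>
  define c where "c T = (SOME c. c \<in> \<A> \<and> M \<inter> T = snd c ` fst c)" for T
  have c: "c T \<in> \<A> \<and> M \<inter> T = snd (c T) ` fst (c T)" if "T \<in> F" for T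
    unfolding c_def by (rule someI_ex) (use that in \<open>unfold F_def, blast\<close>)
  show ?thesis
  proof (cases "F' = {}")
    case True
    then have "M = {}" using sub F'(3) by auto
    then show ?thesis by (intro that[of "\<lambda>_. {}" undefined]) auto
  next
    case False
    define d where "d n = c (from_nat_into F' n)" for n
    have r: "range (from_nat_into F') = F'" using False F'(2) by (rule range_from_nat_into)
    have "(\<Union>n. snd (d n) ` fst (d n)) = (\<Union>T\<in>F'. snd (c T) ` fst (c T))"
      unfolding d_def by (subst (2) r[symmetric]) auto
    also have "\<dots> = (\<Union>T\<in>F'. M \<inter> T)" using c F'(1) by (intro SUP_cong) auto
    also have "\<dots> = M" using sub F'(3) by auto
    finally have 1: "(\<Union>n. snd (d n) ` fst (d n)) = M" .
    have "d n \<in> \<A>" for n using c F'(1) from_nat_into[OF False, of n] unfolding d_def by blast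
    then show ?thesis using 1 by (intro that[of "\<lambda>n. fst (d n)" "\<lambda>n. snd (d n)"]) auto
  qed
qed

end

locale submanifold = smooth_manifold M \<A>
  for M :: "'m::{t2_space,second_countable_topology} set" and \<A> :: "('n::finite, 'm) atlas" +
  fixes X :: "'m \<Rightarrow> 'a::euclidean_space"
  assumes immersion: "smooth_immersion \<A> X"
begin

lemma
  assumes "(W, \<psi>) \<in> \<A>"
  shows imm_smooth: "smooth_on W (X \<circ> \<psi>)"
    and imm_frame: "u \<in> W \<Longrightarrow> frame (\<lambda>i. pd (X \<circ> \<psi>) i u)"
proof -
  show s: "smooth_on W (X \<circ> \<psi>)" using assms immersion unfolding smooth_immersion_def by blast
  show "frame (\<lambda>i. pd (X \<circ> \<psi>) i u)" if "u \<in> W"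
    using assms immersion that frame_pd_iff[OF smooth_on_differentiable[OF s that]]
    unfolding smooth_immersion_def by blast
qed

end

context smooth_manifold
begin

lemma pd_trans_map:
  fixes f :: "'m \<Rightarrow> 'a::euclidean_space"
  assumes c1: "(W1, \<psi>1) \<in> \<A>" and c2: "(W2, \<psi>2) \<in> \<A>" and u: "u \<in> overlap W1 \<psi>1 W2 \<psi>2"
    and f: "(f \<circ> \<psi>2) differentiable (at (trans_map \<psi>1 W2 \<psi>2 u))"
  shows "pd (f \<circ> \<psi>1) i u = (\<Sum>k\<in>UNIV. (frechet_derivative (trans_map \<psi>1 W2 \<psi>2) (at u) (axis i 1) $ k) *\<^sub>R
     pd (f \<circ> \<psi>2) k (trans_map \<psi>1 W2 \<psi>2 u))"
proof -
  let ?\<tau> = "trans_map \<psi>1 W2 \<psi>2"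
  have d: "?\<tau> differentiable (at u)" by (rule smooth_on_differentiable[OF trans_map_smooth[OF c1 c2] u])
  have "frechet_derivative (\<lambda>v. (f \<circ> \<psi>2) (?\<tau> v)) (at u) = frechet_derivative (f \<circ> \<psi>1) (at u)"
    by (rule frechet_derivative_transform_within_open[OF _ overlap_open[OF c1 c2] u])
      (use differentiable_chain_at[OF d f] trans_map_eq[OF c1 c2] in \<open>auto simp: o_def\<close>)
  then show ?thesis using pd_compose[OF d f, of i] unfolding pd_def by simp
qed

text \<open>The law holds for every differentiable \<open>f\<close>. It will be applied to varied
  maps before they are known to be immersions.\<close>

lemma dens_transform:
  fixes f :: "'m \<Rightarrow> 'a::euclidean_space"
  assumes c1: "(W1, \<psi>1) \<in> \<A>" and c2: "(W2, \<psi>2) \<in> \<A>" and u: "u \<in> overlap W1 \<psi>1 W2 \<psi>2"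
    and f: "(f \<circ> \<psi>2) differentiable (at (trans_map \<psi>1 W2 \<psi>2 u))"
  shows "det (metric (f \<circ> \<psi>1) u) = (det (matrix (frechet_derivative (trans_map \<psi>1 W2 \<psi>2) (at u))))\<^sup>2 *
     det (metric (f \<circ> \<psi>2) (trans_map \<psi>1 W2 \<psi>2 u))"
  unfolding metric_gram det_gram_transform[OF pd_trans_map[OF c1 c2 u f]] matrix_def ..

end

lemma continuous_indicator_measurable:
  fixes f :: "'a::topological_space \<Rightarrow> 'b::real_normed_vector"
  assumes "continuous_on W f" "B \<subseteq> W" "B \<in> sets borel"
  shows "(\<lambda>x. indicator B x *\<^sub>R f x) \<in> borel_measurable borel"
  using borel_measurable_continuous_on_indicator[OF assms(3) continuous_on_subset[OF assms(1,2)]] .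

section \<open>The induced volume measure\<close>

context submanifold
begin

definition dens :: "(real^'n \<Rightarrow> 'm) \<Rightarrow> real^'n \<Rightarrow> real" where
  "dens \<psi> u = sqrt (det (metric (X \<circ> \<psi>) u))"

lemma dens_pos: "(W, \<psi>) \<in> \<A> \<Longrightarrow> u \<in> W \<Longrightarrow> dens \<psi> u > 0"
  unfolding dens_def metric_gram using det_gram_pos[OF imm_frame] by simp

lemma dens_continuous: "(W, \<psi>) \<in> \<A> \<Longrightarrow> continuous_on W (dens \<psi>)"
  unfolding dens_def[abs_def] metric_gram
  by (intro continuous_intros smooth_on_continuous smooth_on_det_gram smooth_on_pd imm_smooth chart_open)

lemma dens_measurable:
  "(W, \<psi>) \<in> \<A> \<Longrightarrow> B \<subseteq> W \<Longrightarrow> B \<in> sets borel \<Longrightarrow> (\<lambda>u. ennreal (dens \<psi> u) * indicator B u) \<in> borel_measurable borel"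
  using measurable_compose[OF continuous_indicator_measurable[OF dens_continuous, of W \<psi> B] measurable_ennreal]
  by (rule back_subst[of "\<lambda>f. f \<in> borel_measurable borel"]) (auto simp: fun_eq_iff indicator_def)

text \<open>The Jacobian from the change of variables is exactly the factor between the two
  densities; hence two charts agree on the volume of a set in their overlap.\<close>

lemma nn_integral_overlap:
  assumes c1: "(W1, \<psi>1) \<in> \<A>" and c2: "(W2, \<psi>2) \<in> \<A>"
    and B: "B \<in> sets borel" "B \<subseteq> W1" "\<psi>1 ` B \<subseteq> \<psi>2 ` W2"
  shows "(\<integral>\<^sup>+u\<in>B. ennreal (dens \<psi>1 u) \<partial>lborel) = (\<integral>\<^sup>+u\<in>{u\<in>W2. \<psi>2 u \<in> \<psi>1 ` B}. ennreal (dens \<psi>2 u) \<partial>lborel)"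
proof -
  let ?\<tau> = "trans_map \<psi>1 W2 \<psi>2"
  let ?J = "\<lambda>u. frechet_derivative ?\<tau> (at u)"
  let ?O = "overlap W1 \<psi>1 W2 \<psi>2"
  have BO: "B \<subseteq> ?O" using B by (auto simp: overlap_def)
  have im: "?\<tau> ` B = {u\<in>W2. \<psi>2 u \<in> \<psi>1 ` B}"
  proof -
    have "u \<in> ?\<tau> ` B" if "u \<in> W2" "v \<in> B" "\<psi>2 u = \<psi>1 v" for u v
      using trans_map_unique[of W2 \<psi>2 u \<psi>1 v] c2 that by blast
    then show ?thesis using BO trans_map_in[OF c1 c2] trans_map_eq[OF c1 c2] by auto
  qed
  have imB: "?\<tau> ` B \<in> sets borel"
    unfolding im by (rule chart_vimage_borel[OF c2 chart_image_borel[OF c1 B(1,2)]])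
  have "(\<integral>\<^sup>+u\<in>?\<tau> ` B. ennreal (dens \<psi>2 u) \<partial>lborel) =
     (\<integral>\<^sup>+u\<in>B. ennreal \<bar>det (matrix (?J u))\<bar> * ennreal (dens \<psi>2 (?\<tau> u)) \<partial>lborel)"
  proof (rule nn_integral_change_of_variables[OF B(1) imB])
    show "(?\<tau> has_derivative ?J u) (at u)" if "u \<in> B" for u
      using smooth_on_has_derivative[OF trans_map_smooth[OF c1 c2]] that BO by blast
    show "inj_on ?\<tau> B" using trans_map_inj[OF c1 c2] BO by (rule inj_on_subset)
    have "smooth_on ?O (\<lambda>u. det (matrix (?J u)))"
    proof (rule smooth_on_det[OF overlap_open[OF c1 c2]])
      show "smooth_on ?O (\<lambda>u. matrix (?J u) $ i $ j)" for i j
        unfolding matrix_nth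
        by (rule smooth_on_bounded_linear[OF overlap_open[OF c1 c2] bounded_linear_vec_nth
              smooth_on_frechet[OF trans_map_smooth[OF c1 c2]]])
    qed
    then have "continuous_on ?O (\<lambda>u. \<bar>det (matrix (?J u))\<bar>)"
      by (intro continuous_intros smooth_on_continuous)
    from continuous_indicator_measurable[OF this BO B(1)]
    show "(\<lambda>u. indicator B u * \<bar>det (matrix (?J u))\<bar>) \<in> borel_measurable borel" by simp
    show "(\<lambda>u. ennreal (dens \<psi>2 u) * indicator (?\<tau> ` B) u) \<in> borel_measurable borel"
      by (rule dens_measurable[OF c2 _ imB]) (auto simp: im)
  qed
  also have "\<dots> = (\<integral>\<^sup>+u\<in>B. ennreal (dens \<psi>1 u) \<partial>lborel)"
  proof (intro nn_integral_cong)
    fix u :: "real^'n"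
    have "\<bar>det (matrix (?J u))\<bar> * dens \<psi>2 (?\<tau> u) = dens \<psi>1 u" if "u \<in> B"
    proof -
      have uO: "u \<in> ?O" using that BO by blast
      have "(X \<circ> \<psi>2) differentiable (at (?\<tau> u))"
        by (rule smooth_on_differentiable[OF imm_smooth[OF c2] trans_map_in[OF c1 c2 uO]])
      from dens_transform[OF c1 c2 uO this] show ?thesis
        by (simp add: dens_def real_sqrt_mult)
    qed
    then show "ennreal \<bar>det (matrix (?J u))\<bar> * ennreal (dens \<psi>2 (?\<tau> u)) * indicator B u = ennreal (dens \<psi>1 u) * indicator B u"
      by (auto simp: indicator_def ennreal_mult'[symmetric])
  qed
  finally show ?thesis unfolding im by simp
qed

text \<open>The description under \<open>THE\<close> in \<open>volume_measure\<close>, named so that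
  its unique solvability can be stated.\<close>

definition is_volume :: "'m measure \<Rightarrow> bool" where
  "is_volume \<mu> \<longleftrightarrow> sets \<mu> = sets (restrict_space borel M) \<and>
        (\<forall>(W,\<psi>)\<in>\<A>. \<forall>B\<in>sets borel. B \<subseteq> W \<longrightarrow>
           emeasure \<mu> (\<psi> ` B) = (\<integral>\<^sup>+u\<in>B. ennreal (dens \<psi> u) \<partial>lborel))"

end

text \<open>Monotone convergence for the counting measure.\<close>

lemma ennreal_suminf_commute:
  fixes a :: "nat \<Rightarrow> nat \<Rightarrow> ennreal"
  shows "(\<Sum>i. \<Sum>n. a i n) = (\<Sum>n. \<Sum>i. a i n)"
  using nn_integral_suminf[of a "count_space UNIV"] by (simp add: nn_integral_count_space_nat)

lemma (in smooth_manifold) sets_compact: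
  assumes "compact K" "K \<subseteq> M" shows "K \<in> sets (restrict_space borel M)"
proof -
  have "K = M \<inter> K" "K \<in> sets borel" using assms by (auto intro: borel_closed compact_imp_closed)
  then show ?thesis by (auto simp: sets_restrict_space)
qed

lemma (in smooth_manifold) compact_openin_cover:
  assumes "compact K" "K \<subseteq> M" "\<And>q. q \<in> K \<Longrightarrow> \<exists>U. openin (top_of_set M) U \<and> q \<in> U \<and> P U"
  obtains F where "finite F" "K \<subseteq> \<Union>F" "\<And>U. U \<in> F \<Longrightarrow> openin (top_of_set M) U \<and> P U"
proof -
  have "\<exists>T. open T \<and> q \<in> T \<and> P (M \<inter> T)" if "q \<in> K" for q
    using assms(3)[OF that] by (auto simp: openin_open)
  then obtain T where T: "\<And>q. q \<in> K \<Longrightarrow> open (T q) \<and> q \<in> T q \<and> P (M \<inter> T q)" by metis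
  obtain C where C: "C \<subseteq> K" "finite C" "K \<subseteq> (\<Union>q\<in>C. T q)"
    using compactE_image[OF assms(1), of K T] T by blast
  show ?thesis
    by (rule that[of "(\<lambda>q. M \<inter> T q) ` C"]) (use C T assms(2) in \<open>auto simp: openin_open\<close>)
qed

context submanifold
begin

lemma is_volumeD:
  assumes "is_volume \<mu>"
  shows "sets \<mu> = sets (restrict_space borel M)" "space \<mu> = M"
    "\<lbrakk>(W, \<psi>) \<in> \<A>; B \<in> sets borel; B \<subseteq> W\<rbrakk> \<Longrightarrow> emeasure \<mu> (\<psi> ` B) = (\<integral>\<^sup>+u\<in>B. ennreal (dens \<psi> u) \<partial>lborel)"
  using assms sets_eq_imp_space_eq[of \<mu> "restrict_space borel M"] unfolding is_volume_def
  by (auto simp: space_restrict_space)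

text \<open>\<open>M\<close> is cut into countably many disjoint Borel pieces, each inside one chart
  range. Any solution gives a subset of a piece its chart volume, which forces the formula
  \<open>m\<close>. Conversely \<open>m\<close> is a measure, and it has the right values in every
  other chart by \<open>nn_integral_overlap\<close>.\<close>

lemma volume_unique_ex: "\<exists>!\<mu>. is_volume \<mu>"
proof -
  obtain W :: "nat \<Rightarrow> (real^'n) set" and \<psi> where W: "\<And>n. W n = {} \<or> (W n, \<psi> n) \<in> \<A>" "(\<Union>n. \<psi> n ` W n) = M"
    using countable_charts by blast
  let ?S = "sets (restrict_space borel M)"
  define P where "P = disjointed (\<lambda>n. \<psi> n ` W n)"
  define G where "G n A = {u\<in>W n. \<psi> n u \<in> P n \<inter> A}" for n A
  define m where "m A = (\<Sum>n. \<integral>\<^sup>+u\<in>G n A. ennreal (dens (\<psi> n) u) \<partial>lborel)" for A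
  have Un: "(\<Union>n. P n) = M" using W(2) UN_disjointed_eq[of "\<lambda>n. \<psi> n ` W n"] by (simp add: P_def)
  have disj: "disjoint_family P" unfolding P_def by (rule disjoint_family_disjointed)
  have Psub: "P n \<subseteq> \<psi> n ` W n" for n unfolding P_def by (rule disjointed_subset)
  have "\<psi> n ` W n \<in> ?S" for n using W(1)[of n] openin_imp_sets[OF chart_openin] by fastforce
  then have PS: "P n \<in> ?S" for n
    unfolding P_def using sets.range_disjointed_sets[of "\<lambda>n. \<psi> n ` W n" "restrict_space borel M"] by auto
  have GB: "G n A \<in> sets borel" if "A \<in> ?S" for n A
    using W(1)[of n] chart_vimage_borel[OF _ sets.Int[OF PS that], of "W n" "\<psi> n"] by (auto simp: G_def)
  have meas: "(\<lambda>u. ennreal (dens (\<psi> n) u) * indicator (G n A) u) \<in> borel_measurable borel" if "A \<in> ?S" for n A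
  proof (cases "W n = {}")
    case True then show ?thesis by (simp add: G_def)
  next
    case False
    then show ?thesis using W(1)[of n] by (intro dens_measurable[OF _ _ GB[OF that]]) (auto simp: G_def)
  qed
  have G_im: "\<psi> n ` G n A = A \<inter> P n" for n A using Psub[of n] by (auto simp: G_def)
  have m_formula: "emeasure \<mu> A = m A" if \<mu>: "is_volume \<mu>" and A: "A \<in> ?S" for \<mu> A
  proof -
    have "A \<subseteq> M" using sets.sets_into_space[OF A] by (simp add: space_restrict_space)
    have "emeasure \<mu> (\<Union>n. A \<inter> P n) = (\<Sum>n. emeasure \<mu> (A \<inter> P n))"
      by (rule suminf_emeasure[symmetric])
        (use A PS is_volumeD(1)[OF \<mu>] disj in \<open>auto simp: disjoint_family_on_def, blast\<close>)
    also have "\<dots> = m A"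
      unfolding m_def
    proof (intro suminf_cong)
      fix n
      show "emeasure \<mu> (A \<inter> P n) = (\<integral>\<^sup>+u\<in>G n A. ennreal (dens (\<psi> n) u) \<partial>lborel)"
      proof (cases "W n = {}")
        case True
        then have "P n = {}" using Psub[of n] by simp
        then show ?thesis by (simp add: G_def)
      next
        case False
        then show ?thesis unfolding G_im[symmetric]
          using W(1)[of n] GB[OF A] by (intro is_volumeD(3)[OF \<mu>]) (auto simp: G_def)
      qed
    qed
    also have "(\<Union>n. A \<inter> P n) = A" using Un \<open>A \<subseteq> M\<close> by auto
    finally show ?thesis .
  qed
  define \<mu> where "\<mu> = measure_of M ?S m"
  have S_Pow: "?S \<subseteq> Pow M" using sets.space_closed[of "restrict_space borel M"] by (simp add: space_restrict_space)
  have sets_\<mu>: "sets \<mu> = ?S"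
    unfolding \<mu>_def sets_measure_of[OF S_Pow]
    using sets.sigma_sets_eq[of "restrict_space borel M"] by (simp add: space_restrict_space)
  have em: "emeasure \<mu> A = m A" if "A \<in> ?S" for A
  proof (rule emeasure_measure_of[OF \<mu>_def S_Pow])
    show "positive (sets \<mu>) m" by (simp add: positive_def m_def G_def)
    show "countably_additive (sets \<mu>) m"
    proof (rule countably_additiveI)
      fix A :: "nat \<Rightarrow> 'm set" assume A: "range A \<subseteq> sets \<mu>" "disjoint_family A"
      have "(\<integral>\<^sup>+u\<in>G n (\<Union>i. A i). ennreal (dens (\<psi> n) u) \<partial>lborel) = (\<Sum>i. \<integral>\<^sup>+u\<in>G n (A i). ennreal (dens (\<psi> n) u) \<partial>lborel)" for n
      proof -
        have "disjoint_family (\<lambda>i. G n (A i))" using A(2) by (auto simp: disjoint_family_on_def G_def)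
        from suminf_indicator[OF this] have ind: "indicator (G n (\<Union>i. A i)) u = (\<Sum>i. indicator (G n (A i)) u :: ennreal)" for u
          by (simp add: G_def) (rule arg_cong[where f = "\<lambda>S. indicator S u"], auto)
        show ?thesis unfolding ind ennreal_suminf_cmult[symmetric]
          by (rule nn_integral_suminf) (use meas A(1) sets_\<mu> in auto)
      qed
      then show "(\<Sum>i. m (A i)) = m (\<Union>i. A i)"
        unfolding m_def by (simp add: ennreal_suminf_commute[of "\<lambda>i n. \<integral>\<^sup>+u\<in>G n (A i). ennreal (dens (\<psi> n) u) \<partial>lborel"])
    qed
    show "A \<in> sets \<mu>" using that sets_\<mu> by simp
  qed
  have "is_volume \<mu>"
    unfolding is_volume_def
  proof (intro conjI sets_\<mu> ballI impI, clarify)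
    fix W' \<psi>' and B :: "(real^'n) set" assume c: "(W', \<psi>') \<in> \<A>" and B: "B \<in> sets borel" "B \<subseteq> W'"
    define B' where "B' n = {v\<in>W'. \<psi>' v \<in> P n} \<inter> B" for n
    have B'B: "B' n \<in> sets borel" for n unfolding B'_def using chart_vimage_borel[OF c PS] B(1) by blast
    have "(\<integral>\<^sup>+u\<in>G n (\<psi>' ` B). ennreal (dens (\<psi> n) u) \<partial>lborel) = (\<integral>\<^sup>+u\<in>B' n. ennreal (dens \<psi>' u) \<partial>lborel)" for n
    proof (cases "W n = {}")
      case True
      then have "P n = {}" using Psub[of n] by simp
      then show ?thesis by (simp add: G_def B'_def)
    next
      case False
      then have c2: "(W n, \<psi> n) \<in> \<A>" using W(1) by blast
      have "G n (\<psi>' ` B) = {u\<in>W n. \<psi> n u \<in> \<psi>' ` B' n}" using B(2) by (auto simp: G_def B'_def)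
      moreover have "B' n \<subseteq> W'" "\<psi>' ` B' n \<subseteq> \<psi> n ` W n" using Psub[of n] by (auto simp: B'_def)
      ultimately show ?thesis
        using nn_integral_overlap[OF c c2 B'B, of n] by simp
    qed
    then have "m (\<psi>' ` B) = (\<Sum>n. \<integral>\<^sup>+u\<in>B' n. ennreal (dens \<psi>' u) \<partial>lborel)" by (simp add: m_def)
    also have "\<dots> = (\<integral>\<^sup>+u. (\<Sum>n. ennreal (dens \<psi>' u) * indicator (B' n) u) \<partial>lborel)"
      by (rule nn_integral_suminf[symmetric]) (use dens_measurable[OF c _ B'B] in \<open>auto simp: B'_def\<close>)
    also have "\<dots> = (\<integral>\<^sup>+u\<in>(\<Union>n. B' n). ennreal (dens \<psi>' u) \<partial>lborel)"
      using disj by (subst suminf_indicator[symmetric]) (auto simp: disjoint_family_on_def B'_def)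
    also have "(\<Union>n. B' n) = B" using Un B(2) chart_subset[OF c] by (auto simp: B'_def)
    finally show "emeasure \<mu> (\<psi>' ` B) = (\<integral>\<^sup>+u\<in>B. ennreal (dens \<psi>' u) \<partial>lborel)"
      using em[OF chart_image_borel[OF c B]] by simp
  qed
  moreover have "\<mu>' = \<mu>" if "is_volume \<mu>'" for \<mu>'
    by (rule measure_eqI) (use that is_volumeD(1)[OF that] sets_\<mu> m_formula em in auto)
  ultimately show ?thesis by blast
qed

abbreviation vol :: "'m measure" where "vol \<equiv> volume_measure M \<A> X"

lemma is_volume_vol: "is_volume vol"
  using theI'[OF volume_unique_ex] unfolding volume_measure_def is_volume_def dens_def .

lemma volume_eqI: "is_volume \<mu> \<Longrightarrow> vol = \<mu>"
  using volume_unique_ex is_volume_vol by blast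

lemmas sets_vol = is_volumeD(1)[OF is_volume_vol] and space_vol [simp] = is_volumeD(2)[OF is_volume_vol]
  and emeasure_vol = is_volumeD(3)[OF is_volume_vol]

text \<open>The defining property of the volume measure concerns sets; in this push-forward form it
  passes to integrals, both of nonnegative and of real functions.\<close>

lemma vol_chart:
  assumes c: "(W, \<psi>) \<in> \<A>"
  shows "restrict_space vol (\<psi> ` W) =
    distr (density (restrict_space lborel W) (\<lambda>u. ennreal (dens \<psi> u))) (restrict_space vol (\<psi> ` W)) \<psi>"
    and "\<psi> \<in> measurable (restrict_space borel W) (restrict_space vol (\<psi> ` W))"
    and "(\<lambda>u. ennreal (dens \<psi> u)) \<in> borel_measurable (restrict_space borel W)"
proof -
  let ?N = "density (restrict_space lborel W) (\<lambda>u. ennreal (dens \<psi> u))"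
  have Wb: "W \<in> sets borel" using chart_open[OF c] by auto
  have S: "\<psi> ` W \<in> sets vol" unfolding sets_vol using chart_image_borel[OF c Wb] by simp
  have [simp]: "\<psi> ` W \<inter> M = \<psi> ` W" using chart_subset[OF c] by auto
  have "sets (restrict_space vol (\<psi> ` W)) = sets (restrict_space borel (\<psi> ` W))"
    using chart_subset[OF c] by (simp add: sets_restrict_space_cong[OF sets_vol] sets_restrict_restrict_space inf_absorb2)
  moreover have "\<psi> \<in> measurable (restrict_space borel W) (restrict_space borel (\<psi> ` W))"
    by (intro measurable_restrict_space2 borel_measurable_continuous_on_restrict chart_continuous[OF c]) (auto simp: space_restrict_space)
  ultimately show m: "\<psi> \<in> measurable (restrict_space borel W) (restrict_space vol (\<psi> ` W))"
    by (simp cong: measurable_cong_sets)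
  show d: "(\<lambda>u. ennreal (dens \<psi> u)) \<in> borel_measurable (restrict_space borel W)"
    by (rule measurable_compose[OF borel_measurable_continuous_on_restrict[OF dens_continuous[OF c]] measurable_ennreal])
  show "restrict_space vol (\<psi> ` W) = distr ?N (restrict_space vol (\<psi> ` W)) \<psi>"
  proof (rule measure_eqI)
    fix C assume C: "C \<in> sets (restrict_space vol (\<psi> ` W))"
    then have C': "C \<subseteq> \<psi> ` W" "C \<in> sets vol" using S by (simp_all add: sets_restrict_space_iff)
    define B where "B = {u\<in>W. \<psi> u \<in> C}"
    have B: "B \<in> sets borel" "B \<subseteq> W" unfolding B_def using chart_vimage_borel[OF c] C'(2) sets_vol by auto
    have BC: "\<psi> ` B = C" using C'(1) by (auto simp: B_def)
    have "emeasure (distr ?N (restrict_space vol (\<psi> ` W)) \<psi>) C = emeasure ?N (\<psi> -` C \<inter> W)"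
      by (subst emeasure_distr) (use m C in \<open>auto simp: space_restrict_space cong: measurable_cong_sets sets_restrict_space_cong\<close>)
    also have "\<psi> -` C \<inter> W = B" by (auto simp: B_def)
    also have "emeasure ?N B = (\<integral>\<^sup>+u. ennreal (dens \<psi> u) * indicator B u \<partial>restrict_space lborel W)"
      by (subst emeasure_density) (use d B Wb in \<open>auto simp: sets_restrict_space_iff cong: measurable_cong_sets sets_restrict_space_cong\<close>)
    also have "\<dots> = (\<integral>\<^sup>+u\<in>B. ennreal (dens \<psi> u) \<partial>lborel)"
      using Wb B(2) by (subst nn_integral_restrict_space) (auto intro!: nn_integral_cong simp: indicator_def)
    also have "\<dots> = emeasure vol C" using emeasure_vol[OF c B] BC by simp
    finally show "emeasure (restrict_space vol (\<psi> ` W)) C = emeasure (distr ?N (restrict_space vol (\<psi> ` W)) \<psi>) C"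
      using C' S by (simp add: emeasure_restrict_space)
  qed simp
qed

lemma nn_integral_chart:
  assumes c: "(W, \<psi>) \<in> \<A>" and B: "B \<in> sets borel" "B \<subseteq> W" and f: "f \<in> borel_measurable vol"
  shows "(\<integral>\<^sup>+q\<in>\<psi> ` B. f q \<partial>vol) = (\<integral>\<^sup>+u\<in>B. ennreal (dens \<psi> u) * f (\<psi> u) \<partial>lborel)"
proof -
  have Wb: "W \<in> sets borel" using chart_open[OF c] by auto
  have S: "\<psi> ` W \<in> sets vol" "\<psi> ` B \<in> sets vol" unfolding sets_vol using chart_image_borel[OF c] Wb B by auto
  have [simp]: "\<psi> ` W \<inter> M = \<psi> ` W" using chart_subset[OF c] by auto
  note [measurable] = vol_chart(2,3)[OF c] f S
  have fm: "(\<lambda>q. f q * indicator (\<psi> ` B) q) \<in> borel_measurable (restrict_space vol (\<psi> ` W))"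
    by (rule measurable_restrict_space1) measurable
  have "(\<integral>\<^sup>+q\<in>\<psi> ` B. f q \<partial>vol) = (\<integral>\<^sup>+q. f q * indicator (\<psi> ` B) q \<partial>restrict_space vol (\<psi> ` W))"
    using S image_mono[OF B(2), of \<psi>] by (subst nn_integral_restrict_space) (auto intro!: nn_integral_cong split: split_indicator, blast)
  also have "\<dots> = (\<integral>\<^sup>+u. f (\<psi> u) * indicator (\<psi> ` B) (\<psi> u) \<partial>density (restrict_space lborel W) (\<lambda>u. ennreal (dens \<psi> u)))"
    by (subst vol_chart(1)[OF c], rule nn_integral_distr)
      (use vol_chart(2)[OF c] fm in \<open>auto cong: measurable_cong_sets sets_restrict_space_cong\<close>)
  also have "\<dots> = (\<integral>\<^sup>+u. ennreal (dens \<psi> u) * (f (\<psi> u) * indicator (\<psi> ` B) (\<psi> u)) \<partial>restrict_space lborel W)"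
    by (rule nn_integral_density)
      (use vol_chart(3)[OF c] measurable_compose[OF vol_chart(2)[OF c] fm] in \<open>auto cong: measurable_cong_sets sets_restrict_space_cong\<close>)
  also have "\<dots> = (\<integral>\<^sup>+u\<in>B. ennreal (dens \<psi> u) * f (\<psi> u) \<partial>lborel)"
  proof (subst nn_integral_restrict_space)
    show "W \<inter> space lborel \<in> sets lborel" using Wb by simp
    have "\<psi> u \<in> \<psi> ` B \<longleftrightarrow> u \<in> B" if "u \<in> W" for u
      using that B(2) chart_inj[OF c] by (metis inj_on_image_mem_iff)
    then show "(\<integral>\<^sup>+u\<in>W. (ennreal (dens \<psi> u) * (f (\<psi> u) * indicator (\<psi> ` B) (\<psi> u))) \<partial>lborel) =
       (\<integral>\<^sup>+u\<in>B. ennreal (dens \<psi> u) * f (\<psi> u) \<partial>lborel)"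
      using B(2) by (intro nn_integral_cong) (auto split: split_indicator)
  qed
  finally show ?thesis .
qed

lemma integral_chart:
  fixes f :: "'m \<Rightarrow> real"
  assumes c: "(W, \<psi>) \<in> \<A>" and f: "f \<in> borel_measurable vol" and z: "\<And>q. q \<in> M - \<psi> ` W \<Longrightarrow> f q = 0"
  shows "(\<integral>q. f q \<partial>vol) = (\<integral>u. indicator W u * (dens \<psi> u * f (\<psi> u)) \<partial>lborel)"
proof -
  have Wb: "W \<in> sets borel" using chart_open[OF c] by auto
  have S: "\<psi> ` W \<in> sets vol" unfolding sets_vol using chart_image_borel[OF c Wb] by auto
  have [simp]: "\<psi> ` W \<inter> M = \<psi> ` W" using chart_subset[OF c] by auto
  have fm: "f \<in> borel_measurable (restrict_space vol (\<psi> ` W))"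
    by (rule measurable_restrict_space1[OF f])
  have "(\<integral>q. f q \<partial>vol) = (\<integral>q. f q \<partial>restrict_space vol (\<psi> ` W))"
    using S z by (subst integral_restrict_space) (auto intro!: Bochner_Integration.integral_cong simp: indicator_def)
  also have "\<dots> = (\<integral>u. f (\<psi> u) \<partial>density (restrict_space lborel W) (\<lambda>u. ennreal (dens \<psi> u)))"
    by (subst vol_chart(1)[OF c], rule integral_distr)
      (use vol_chart(2)[OF c] fm in \<open>auto cong: measurable_cong_sets sets_restrict_space_cong\<close>)
  also have "\<dots> = (\<integral>u. dens \<psi> u *\<^sub>R f (\<psi> u) \<partial>restrict_space lborel W)"
  proof (rule integral_density)
    show "(\<lambda>u. f (\<psi> u)) \<in> borel_measurable (restrict_space lborel W)"
      using measurable_compose[OF vol_chart(2)[OF c] fm] by (simp cong: measurable_cong_sets sets_restrict_space_cong)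
    show "dens \<psi> \<in> borel_measurable (restrict_space lborel W)"
      using borel_measurable_continuous_on_restrict[OF dens_continuous[OF c]] by (simp cong: measurable_cong_sets sets_restrict_space_cong)
    show "AE u in restrict_space lborel W. 0 \<le> dens \<psi> u"
      by (rule AE_I2) (use dens_pos[OF c] in \<open>auto simp: space_restrict_space less_imp_le\<close>)
  qed
  also have "\<dots> = (\<integral>u. indicator W u * (dens \<psi> u * f (\<psi> u)) \<partial>lborel)"
    using Wb by (subst integral_restrict_space) auto
  finally show ?thesis .
qed

text \<open>Each point is the centre of a ball whose closure lies in a chart domain. The density is
  bounded on the closed ball, and the images of finitely many such balls cover
  \<open>K\<close>.\<close>

lemma emeasure_vol_compact:
  assumes "compact K" "K \<subseteq> M"
  shows "emeasure vol K < \<infinity>"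
proof -
  have "\<exists>U. openin (top_of_set M) U \<and> q \<in> U \<and> (\<exists>C\<in>sets vol. U \<subseteq> C \<and> emeasure vol C < \<infinity>)" if qK: "q \<in> K" for q
  proof -
    obtain W \<psi> u where c: "(W, \<psi>) \<in> \<A>" "u \<in> W" "\<psi> u = q" using chart_cover[of q] qK assms(2) by blast
    obtain r where r: "r > 0" "cball u r \<subseteq> W" using chart_open[OF c(1)] c(2) open_contains_cball by blast
    have "compact (dens \<psi> ` cball u r)"
      by (intro compact_continuous_image continuous_on_subset[OF dens_continuous[OF c(1)] r(2)]) auto
    then obtain b where b: "\<And>v. v \<in> cball u r \<Longrightarrow> dens \<psi> v \<le> b"
      using compact_imp_bounded bounded_real by (metis abs_le_D1 imageI)
    have "emeasure vol (\<psi> ` cball u r) = (\<integral>\<^sup>+v\<in>cball u r. ennreal (dens \<psi> v) \<partial>lborel)"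
      by (rule emeasure_vol[OF c(1) _ r(2)]) auto
    also have "\<dots> \<le> (\<integral>\<^sup>+v\<in>cball u r. ennreal b \<partial>lborel)"
      using b by (intro nn_integral_mono) (auto simp: indicator_def intro!: ennreal_leI)
    also have "\<dots> < \<infinity>"
      using emeasure_bounded_finite[of "cball u r"] by (simp add: nn_integral_cmult_indicator ennreal_mult_less_top)
    finally have "emeasure vol (\<psi> ` cball u r) < \<infinity>" .
    moreover have "\<psi> ` cball u r \<in> sets vol" unfolding sets_vol by (rule chart_image_borel[OF c(1) _ r(2)]) auto
    moreover have "openin (top_of_set M) (\<psi> ` ball u r)"
      by (rule chart_image_openin[OF c(1)]) (use r(2) ball_subset_cball in auto)
    ultimately show ?thesis using r(1) c(3) ball_subset_cball[of u r]
      by (intro exI[of _ "\<psi> ` ball u r"]) (auto intro!: bexI[of _ "\<psi> ` cball u r"])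
  qed
  then obtain F where F: "finite F" "K \<subseteq> \<Union>F" "\<And>U. U \<in> F \<Longrightarrow> \<exists>C\<in>sets vol. U \<subseteq> C \<and> emeasure vol C < \<infinity>"
    using compact_openin_cover[OF assms, of "\<lambda>U. \<exists>C\<in>sets vol. U \<subseteq> C \<and> emeasure vol C < \<infinity>"] by metis
  then obtain C where C: "\<And>U. U \<in> F \<Longrightarrow> C U \<in> sets vol \<and> U \<subseteq> C U \<and> emeasure vol (C U) < \<infinity>" by metis
  have "\<And>U. U \<in> F \<Longrightarrow> U \<subseteq> C U" using C by simp
  then have "K \<subseteq> (\<Union>U\<in>F. C U)" using F(2) by blast
  then have "emeasure vol K \<le> emeasure vol (\<Union>U\<in>F. C U)"
    by (rule emeasure_mono) (use F(1) C in \<open>auto intro!: sets.finite_UN\<close>)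
  also have "\<dots> \<le> (\<Sum>U\<in>F. emeasure vol (C U))"
    by (rule emeasure_subadditive_finite) (use F C in auto)
  also have "\<dots> < \<infinity>" using C F(1) by simp
  finally show ?thesis .
qed

end

text \<open>A volume measure is determined by its values on chart images, and there the density can
  be verified pointwise.\<close>

lemma volume_measure_density:
  assumes X: "submanifold M \<A> X" and X': "submanifold M \<A> X'"
    and r: "r \<in> borel_measurable (volume_measure M \<A> X)"
    and eq: "\<And>W \<psi> u. (W, \<psi>) \<in> \<A> \<Longrightarrow> u \<in> W \<Longrightarrow>
      ennreal (sqrt (det (metric (X \<circ> \<psi>) u))) * r (\<psi> u) = ennreal (sqrt (det (metric (X' \<circ> \<psi>) u)))"
  shows "volume_measure M \<A> X' = density (volume_measure M \<A> X) r"
proof -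
  interpret X: submanifold M \<A> X by fact
  interpret X': submanifold M \<A> X' by fact
  have "X'.is_volume (density X.vol r)"
    unfolding X'.is_volume_def
  proof (intro conjI ballI impI, goal_cases)
    case 1 then show ?case using X.sets_vol by simp
  next
    case (2 c)
    obtain W \<psi> where c: "c = (W, \<psi>)" by force
    have "emeasure (density X.vol r) (\<psi> ` B) = (\<integral>\<^sup>+u\<in>B. ennreal (X'.dens \<psi> u) \<partial>lborel)"
      if B: "B \<in> sets borel" "B \<subseteq> W" for B
    proof -
      have cA: "(W, \<psi>) \<in> \<A>" using 2 c by simp
      have "emeasure (density X.vol r) (\<psi> ` B) = (\<integral>\<^sup>+q\<in>\<psi> ` B. r q \<partial>X.vol)"
        by (rule emeasure_density[OF r]) (use X.chart_image_borel[OF cA B] X.sets_vol in simp)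
      also have "\<dots> = (\<integral>\<^sup>+u\<in>B. ennreal (X.dens \<psi> u) * r (\<psi> u) \<partial>lborel)"
        by (rule X.nn_integral_chart[OF cA B r])
      also have "\<dots> = (\<integral>\<^sup>+u\<in>B. ennreal (X'.dens \<psi> u) \<partial>lborel)"
        using eq[OF cA] B(2) by (intro nn_integral_cong) (auto simp: indicator_def X.dens_def X'.dens_def)
      finally show ?thesis .
    qed
    then show ?case using c by auto
  qed
  then show ?thesis by (rule X'.volume_eqI)
qed

section \<open>Local geometry\<close>

text \<open>A single chart, seen as an immersion of an open set of parameters. The pointwise
  geometry is developed here and then instantiated with \<open>X \<circ> \<psi>\<close> and with the
  members of a variation.\<close>

locale local_immersion =
  fixes W :: "(real^'n::finite) set" and \<phi> :: "real^'n \<Rightarrow> 'a::euclidean_space"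
  assumes open_W: "open W" and smooth_\<phi>: "smooth_on W \<phi>" and frame_\<phi>: "u \<in> W \<Longrightarrow> frame (\<lambda>i. pd \<phi> i u)"
begin

lemma diff_\<phi>: "u \<in> W \<Longrightarrow> \<phi> differentiable (at u)"
  using smooth_on_differentiable[OF smooth_\<phi>] .

lemma tangent_space_eq: "u \<in> W \<Longrightarrow> tangent_space \<phi> u = range (lincomb (\<lambda>i. pd \<phi> i u))"
  unfolding tangent_space_def using lincomb_pd[OF diff_\<phi>] by (metis ext)

lemma pd_in_tangent: "u \<in> W \<Longrightarrow> pd \<phi> i u \<in> tangent_space \<phi> u"
  unfolding tangent_space_def pd_def by blast

lemma normal_space_iff:
  assumes "u \<in> W" shows "v \<in> normal_space \<phi> u \<longleftrightarrow> (\<forall>i. v \<bullet> pd \<phi> i u = 0)"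
proof
  assume "v \<in> normal_space \<phi> u"
  then show "\<forall>i. v \<bullet> pd \<phi> i u = 0"
    using pd_in_tangent[OF assms] by (auto simp: normal_space_def orthogonal_comp_def orthogonal_def inner_commute)
next
  assume "\<forall>i. v \<bullet> pd \<phi> i u = 0"
  then show "v \<in> normal_space \<phi> u"
    by (auto simp: normal_space_def orthogonal_comp_def orthogonal_def tangent_space_eq[OF assms] lincomb_def
        inner_sum_right inner_sum_left inner_commute)
qed

text \<open>The description under \<open>THE\<close> has only one solution: the difference of two is
  tangent as well as normal, hence orthogonal to itself.\<close>

lemma tan_proj_eq:
  assumes u: "u \<in> W" shows "tan_proj \<phi> u v = tproj (\<lambda>i. pd \<phi> i u) v"
  unfolding tan_proj_def
proof (rule the_equality)
  let ?e = "\<lambda>i. pd \<phi> i u"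
  have n: "v - tproj ?e v \<in> normal_space \<phi> u"
    unfolding normal_space_iff[OF u] using tproj_inner[OF frame_\<phi>[OF u]] by (simp add: inner_diff_left)
  show "tproj ?e v \<in> tangent_space \<phi> u \<and> v - tproj ?e v \<in> normal_space \<phi> u"
    using n by (simp add: tangent_space_eq[OF u] tproj_lincomb)
  fix w assume w: "w \<in> tangent_space \<phi> u \<and> v - w \<in> normal_space \<phi> u"
  then obtain a where a: "w = lincomb ?e a" by (auto simp: tangent_space_eq[OF u])
  obtain b where b: "tproj ?e v = lincomb ?e b" by (simp add: tproj_lincomb)
  have "(w - tproj ?e v) \<bullet> pd \<phi> i u = 0" for i
    using w n by (auto simp: normal_space_iff[OF u] algebra_simps)
  then have "(w - tproj ?e v) \<bullet> lincomb ?e (a - b) = 0"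
    by (simp add: lincomb_def inner_sum_right)
  moreover have "w - tproj ?e v = lincomb ?e (a - b)"
    using a b by (simp add: linear_diff[OF linear_lincomb])
  ultimately show "w = tproj ?e v" by simp
qed

lemma nor_proj_eq: "u \<in> W \<Longrightarrow> nor_proj \<phi> u v = v - tproj (\<lambda>i. pd \<phi> i u) v"
  by (simp add: nor_proj_def tan_proj_eq)

lemma nor_proj_inner: "u \<in> W \<Longrightarrow> nor_proj \<phi> u v \<bullet> pd \<phi> i u = 0"
  by (simp add: nor_proj_eq inner_diff_left tproj_inner[OF frame_\<phi>])

lemma nor_proj_normal: "u \<in> W \<Longrightarrow> (\<And>i. v \<bullet> pd \<phi> i u = 0) \<Longrightarrow> nor_proj \<phi> u v = v"
  by (simp add: nor_proj_eq tproj_def)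

lemma linear_nor_proj: "u \<in> W \<Longrightarrow> linear (nor_proj \<phi> u)"
  using linear_compose_sub[OF linear_id linear_tproj, of "\<lambda>i. pd \<phi> i u"] nor_proj_eq[of u]
  by (simp add: id_def fun_eq_iff linear_iff)

lemma nor_proj_tangent: "u \<in> W \<Longrightarrow> nor_proj \<phi> u (pd \<phi> i u) = 0"
  by (simp add: nor_proj_eq tproj_basis[OF frame_\<phi>])

lemma nor_proj_inner_normal: "u \<in> W \<Longrightarrow> (\<And>i. n \<bullet> pd \<phi> i u = 0) \<Longrightarrow> n \<bullet> nor_proj \<phi> u v = n \<bullet> v"
  by (simp add: nor_proj_eq tproj_def inner_diff_right inner_sum_right)

text \<open>Injectivity of the differential makes the parameter direction under \<open>THE\<close>
  unique.\<close>

lemma eucl_conn_lincomb: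
  assumes u: "u \<in> W" and x: "x u = lincomb (\<lambda>i. pd \<phi> i u) a"
  shows "eucl_conn \<phi> x Z u = frechet_derivative Z (at u) a"
proof -
  have "(THE a. frechet_derivative \<phi> (at u) a = x u) = a"
    unfolding x lincomb_pd[OF diff_\<phi>[OF u]]
    using frame_\<phi>[OF u] frame_pd_iff[OF diff_\<phi>[OF u]] by (auto simp: inj_def)
  then show ?thesis by (simp add: eucl_conn_def)
qed

lemma eucl_conn_pd:
  assumes u: "u \<in> W" shows "eucl_conn \<phi> (pd \<phi> i) Z u = pd Z i u"
proof -
  have "pd \<phi> i u = lincomb (\<lambda>i. pd \<phi> i u) (axis i 1)"
    unfolding lincomb_pd[OF diff_\<phi>[OF u]] by (simp add: pd_def)
  from eucl_conn_lincomb[where x = "pd \<phi> i", OF u this] show ?thesis by (simp add: pd_def)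
qed

lemma nor_conn_pd: "u \<in> W \<Longrightarrow> nor_conn \<phi> (pd \<phi> i) Z u = nor_proj \<phi> u (pd Z i u)"
  by (simp add: nor_conn_def eucl_conn_pd)

lemma sff_pd: "u \<in> W \<Longrightarrow> sff \<phi> (pd \<phi> i) (pd \<phi> j) u = nor_proj \<phi> u (pd (pd \<phi> j) i u)"
  by (simp add: sff_def eucl_conn_pd)

end

text \<open>The divergence is the trace of the ambient derivative, so \<open>Z\<close> may have a
  normal component; for normal \<open>Z\<close> this trace is minus the inner product with the mean
  curvature vector.\<close>

definition div_drift :: "'a \<Rightarrow> (real^'n::finite \<Rightarrow> 'a::euclidean_space) \<Rightarrow> (real^'n \<Rightarrow> 'a) \<Rightarrow> real^'n \<Rightarrow> real" where
  "div_drift T \<phi> Z u = T \<bullet> Z u + (\<Sum>i\<in>UNIV. \<Sum>j\<in>UNIV. ginv (\<lambda>i. pd \<phi> i u) i j * (pd Z i u \<bullet> pd \<phi> j u))"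

text \<open>The normal covariant derivative in the direction of the tangential part of an arbitrary
  vector \<open>y\<close>. Linearity in \<open>y\<close> takes the place of tangent fields, of which
  \<open>nor_conn\<close> sees only the value at \<open>u\<close>.\<close>

definition nor_deriv :: "(real^'n::finite \<Rightarrow> 'a::euclidean_space) \<Rightarrow> (real^'n \<Rightarrow> 'a) \<Rightarrow> real^'n \<Rightarrow> 'a \<Rightarrow> 'a" where
  "nor_deriv \<phi> V u y = (\<Sum>k\<in>UNIV. \<Sum>m\<in>UNIV. (ginv (\<lambda>i. pd \<phi> i u) k m * (y \<bullet> pd \<phi> m u)) *\<^sub>R nor_proj \<phi> u (pd V k u))"

context local_immersion
begin

lemma linear_nor_deriv: "linear (nor_deriv \<phi> V u)"
  unfolding nor_deriv_def
  by (intro linearI) (simp_all add: inner_add_left algebra_simps sum.distrib scaleR_sum_right)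

lemma nor_deriv_pd: "u \<in> W \<Longrightarrow> nor_deriv \<phi> V u (pd \<phi> i u) = nor_proj \<phi> u (pd V i u)"
  unfolding nor_deriv_def scaleR_sum_left[symmetric]
  using ginv_left[OF frame_\<phi>, of u _ i] by (simp add: inner_commute if_distrib[of "\<lambda>x. x *\<^sub>R _"] cong: if_cong)

lemma nor_deriv_normal: "u \<in> W \<Longrightarrow> nor_deriv \<phi> V u y \<bullet> pd \<phi> i u = 0"
  by (simp add: nor_deriv_def inner_sum_left nor_proj_inner)

lemma nor_conn_tan_proj:
  assumes u: "u \<in> W" and x: "x u = tan_proj \<phi> u y" and V: "V differentiable (at u)"
  shows "nor_conn \<phi> x V u = nor_deriv \<phi> V u y"
proof -
  let ?e = "\<lambda>i. pd \<phi> i u"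
  let ?a = "\<chi> i. \<Sum>j\<in>UNIV. ginv ?e i j * (y \<bullet> ?e j)"
  have "x u = lincomb ?e ?a" using x by (simp add: tan_proj_eq[OF u] tproj_lincomb)
  from eucl_conn_lincomb[where x = x and u = u and a = ?a and Z = V, OF u this] have "eucl_conn \<phi> x V u = lincomb (\<lambda>k. pd V k u) ?a"
    by (simp add: lincomb_pd[OF V])
  then have "nor_conn \<phi> x V u = nor_proj \<phi> u (\<Sum>k\<in>UNIV. \<Sum>m\<in>UNIV. (ginv ?e k m * (y \<bullet> ?e m)) *\<^sub>R pd V k u)"
    by (simp add: nor_conn_def lincomb_def scaleR_sum_left)
  then show ?thesis
    by (simp add: nor_deriv_def linear_sum[OF linear_nor_proj[OF u]] linear_cmul[OF linear_nor_proj[OF u]])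
qed

lemma smooth_tproj: "smooth_on W v \<Longrightarrow> smooth_on W (\<lambda>u. tproj (\<lambda>i. pd \<phi> i u) (v u))"
  unfolding tproj_def by (intro smooth_intros smooth_on_ginv open_W smooth_\<phi> frame_\<phi>)

lemma smooth_nor_proj:
  assumes "smooth_on W v" shows "smooth_on W (\<lambda>u. nor_proj \<phi> u (v u))"
  by (rule smooth_on_cong[OF open_W _ smooth_on_diff[OF open_W assms smooth_tproj[OF assms]]]) (simp add: nor_proj_eq)

text \<open>The (i, j) component of the second covariant derivative. The whole vector
  \<open>pd (pd \<phi> j) i u\<close> may be inserted because \<open>nor_deriv\<close> sees only its
  tangential part, the Levi-Civita derivative of a coordinate field.\<close>

definition second_nor where
  "second_nor V i j u = nor_proj \<phi> u (pd (\<lambda>v. nor_proj \<phi> v (pd V j v)) i u) - nor_deriv \<phi> V u (pd (pd \<phi> j) i u)"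

lemma pd_cong:
  assumes "\<And>v. v \<in> W \<Longrightarrow> f v = g v" "u \<in> W" "f differentiable (at u)"
  shows "pd f i u = pd g i u"
  unfolding pd_def using frechet_derivative_transform_within_open[OF assms(3) open_W assms(2,1)] by simp

lemma nor_laplacian_eq:
  assumes u: "u \<in> W" and V: "smooth_on W V"
  shows "nor_laplacian \<phi> V u = (\<Sum>i\<in>UNIV. \<Sum>j\<in>UNIV. ginv (\<lambda>i. pd \<phi> i u) i j *\<^sub>R second_nor V i j u)"
proof -
  have 1: "nor_conn \<phi> (pd \<phi> i) (nor_conn \<phi> (pd \<phi> j) V) u = nor_proj \<phi> u (pd (\<lambda>v. nor_proj \<phi> v (pd V j v)) i u)" for i j
  proof -
    have "pd (\<lambda>v. nor_proj \<phi> v (pd V j v)) i u = pd (nor_conn \<phi> (pd \<phi> j) V) i u"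
      by (rule pd_cong[OF _ u smooth_on_differentiable[OF smooth_nor_proj[OF smooth_on_pd[OF V]] u]])
        (simp add: nor_conn_pd)
    then show ?thesis by (simp add: nor_conn_pd[OF u])
  qed
  have 2: "nor_conn \<phi> (tan_conn \<phi> (pd \<phi> i) (pd \<phi> j)) V u = nor_deriv \<phi> V u (pd (pd \<phi> j) i u)" for i j
    by (rule nor_conn_tan_proj[OF u _ smooth_on_differentiable[OF V u]]) (simp add: tan_conn_def eucl_conn_pd[OF u])
  show ?thesis by (simp add: nor_laplacian_def second_nor_def inv_metric_ginv 1 2)
qed

text \<open>The four sums are regrouped as a trace inside a trace, the shape in which invariance of
  traces can be applied twice.\<close>

lemma AVA_eq:
  assumes u: "u \<in> W"
  shows "AVA \<phi> V u = (\<Sum>j\<in>UNIV. \<Sum>l\<in>UNIV. ginv (\<lambda>i. pd \<phi> i u) j l *\<^sub>R (\<Sum>i\<in>UNIV. \<Sum>k\<in>UNIV. ginv (\<lambda>i. pd \<phi> i u) i k *\<^sub>R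
     ((nor_proj \<phi> u (pd (pd \<phi> j) i u) \<bullet> V u) *\<^sub>R nor_proj \<phi> u (pd (pd \<phi> l) k u))))"
proof -
  have "AVA \<phi> V u = (\<Sum>i\<in>UNIV. \<Sum>j\<in>UNIV. \<Sum>k\<in>UNIV. \<Sum>l\<in>UNIV. ginv (\<lambda>i. pd \<phi> i u) j l *\<^sub>R (ginv (\<lambda>i. pd \<phi> i u) i k *\<^sub>R
     ((nor_proj \<phi> u (pd (pd \<phi> j) i u) \<bullet> V u) *\<^sub>R nor_proj \<phi> u (pd (pd \<phi> l) k u))))"
    by (simp add: AVA_def inv_metric_ginv sff_pd[OF u] mult.commute mult.left_commute)
  also have "\<dots> = (\<Sum>j\<in>UNIV. \<Sum>i\<in>UNIV. \<Sum>l\<in>UNIV. \<Sum>k\<in>UNIV. ginv (\<lambda>i. pd \<phi> i u) j l *\<^sub>R (ginv (\<lambda>i. pd \<phi> i u) i k *\<^sub>R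
     ((nor_proj \<phi> u (pd (pd \<phi> j) i u) \<bullet> V u) *\<^sub>R nor_proj \<phi> u (pd (pd \<phi> l) k u))))"
    by (subst sum.swap, rule sum.cong[OF refl], rule sum.cong[OF refl], rule sum.swap)
  also have "\<dots> = (\<Sum>j\<in>UNIV. \<Sum>l\<in>UNIV. \<Sum>i\<in>UNIV. \<Sum>k\<in>UNIV. ginv (\<lambda>i. pd \<phi> i u) j l *\<^sub>R (ginv (\<lambda>i. pd \<phi> i u) i k *\<^sub>R
     ((nor_proj \<phi> u (pd (pd \<phi> j) i u) \<bullet> V u) *\<^sub>R nor_proj \<phi> u (pd (pd \<phi> l) k u))))"
    by (rule sum.cong[OF refl], rule sum.swap)
  finally show ?thesis by (simp only: scaleR_sum_right)
qed

lemma L_local_eq: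
  assumes u: "u \<in> W" and V: "smooth_on W V"
  shows "L_local T \<phi> V u = (\<Sum>i\<in>UNIV. \<Sum>j\<in>UNIV. ginv (\<lambda>i. pd \<phi> i u) i j *\<^sub>R second_nor V i j u) + nor_deriv \<phi> V u T + AVA \<phi> V u"
  unfolding L_local_def nor_laplacian_eq[OF assms]
  by (simp add: nor_conn_tan_proj[where x = "\<lambda>w. tan_proj \<phi> w T" and y = T, OF u refl smooth_on_differentiable[OF V u]])

text \<open>By a dimension count the coordinate fields and the frame span the ambient space. What
  remains of \<open>z\<close> after subtracting its frame components is orthogonal to both families,
  hence to itself.\<close>

lemma normal_expansion:
  assumes u: "u \<in> W" and dim: "DIM('a) = CARD('n) + p"
    and e: "\<And>\<alpha> i. \<alpha> < p \<Longrightarrow> e \<alpha> \<bullet> pd \<phi> i u = 0"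
    and on: "\<And>\<alpha> \<beta>. \<alpha> < p \<Longrightarrow> \<beta> < p \<Longrightarrow> e \<alpha> \<bullet> e \<beta> = (if \<alpha> = \<beta> then 1 else 0)"
    and z: "\<And>i. z \<bullet> pd \<phi> i u = 0"
  shows "z = (\<Sum>\<alpha><p. (z \<bullet> e \<alpha>) *\<^sub>R e \<alpha>)"
proof -
  let ?b = "lincomb (\<lambda>i. pd \<phi> i u)"
  define w where "w = z - (\<Sum>\<alpha><p. (z \<bullet> e \<alpha>) *\<^sub>R e \<alpha>)"
  have we: "w \<bullet> e \<alpha> = 0" if "\<alpha> < p" for \<alpha>
    using that by (simp add: w_def inner_diff_left inner_sum_left on if_distrib cong: if_cong)
  have wb: "w \<bullet> ?b a = 0" for a
    by (simp add: w_def inner_diff_left inner_sum_left lincomb_def inner_sum_right z e)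
  have inj: "inj ?b" using frame_\<phi>[OF u] by (simp add: frame_def)
  have d1: "dim (range ?b) = CARD('n)"
    using dim_image_eq[OF linear_lincomb, of "\<lambda>i. pd \<phi> i u" UNIV] inj by (simp add: inj_on_def)
  have inje: "inj_on e {..<p}"
    using on by (intro inj_onI) (metis lessThan_iff zero_neq_one)
  have "pairwise orthogonal (e ` {..<p})"
    using on by (auto simp: pairwise_def orthogonal_def)
  moreover have "0 \<notin> e ` {..<p}" using on by (metis imageE inner_zero_left lessThan_iff zero_neq_one)
  ultimately have "independent (e ` {..<p})" by (rule pairwise_orthogonal_independent)
  then have d2: "dim (e ` {..<p}) = p" using dim_eq_card_independent card_image[OF inje] by force
  have "dim (range ?b \<union> e ` {..<p}) = dim (range ?b) + dim (e ` {..<p})"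
    by (rule dim_orthogonal_sum) (use e in \<open>auto simp: lincomb_def inner_sum_left inner_sum_right inner_commute\<close>)
  then have "span (range ?b \<union> e ` {..<p}) = UNIV"
    using d1 d2 dim by (subst dim_eq_full[symmetric]) simp
  then have "w \<in> span (range ?b \<union> e ` {..<p})" by simp
  moreover have "orthogonal w x" if "x \<in> range ?b \<union> e ` {..<p}" for x
    using that we wb by (auto simp: orthogonal_def)
  ultimately have "orthogonal w w" using orthogonal_to_span by blast
  then show ?thesis by (simp add: orthogonal_def w_def)
qed

text \<open>LV is itself normal, so it is recovered from its components in the frame, and these can
  be compared summand by summand.\<close>

lemma L_components_eq:
  assumes u: "u \<in> W" and V: "smooth_on W V" and dim: "DIM('a) = CARD('n) + p"
    and e: "\<And>\<alpha> i. \<alpha> < p \<Longrightarrow> e \<alpha> u \<bullet> pd \<phi> i u = 0"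
    and on: "\<And>\<alpha> \<beta>. \<alpha> < p \<Longrightarrow> \<beta> < p \<Longrightarrow> e \<alpha> u \<bullet> e \<beta> u = (if \<alpha> = \<beta> then 1 else 0)"
    and Vn: "\<And>i. V u \<bullet> pd \<phi> i u = 0"
  shows "L_local T \<phi> V u = L_components p T \<phi> e V u"
proof -
  let ?g = "\<lambda>i j. ginv (\<lambda>i. pd \<phi> i u) i j"
  let ?A = "\<lambda>i j. nor_proj \<phi> u (pd (pd \<phi> j) i u)"
  have exp: "z = (\<Sum>\<alpha><p. (z \<bullet> e \<alpha> u) *\<^sub>R e \<alpha> u)" if "\<And>i. z \<bullet> pd \<phi> i u = 0" for z
    by (rule normal_expansion[OF u dim e on that])
  have sn: "second_nor V i j u \<bullet> pd \<phi> k u = 0" for i j k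
    by (simp add: second_nor_def inner_diff_left nor_proj_inner[OF u] nor_deriv_normal[OF u])
  have Ln: "L_local T \<phi> V u \<bullet> pd \<phi> k u = 0" for k
    by (simp add: L_local_eq[OF u V] AVA_eq[OF u] inner_add_left inner_sum_left sn nor_proj_inner[OF u] nor_deriv_normal[OF u])
  have AV: "?A i j \<bullet> V u = (\<Sum>\<beta><p. (V u \<bullet> e \<beta> u) * (?A i j \<bullet> e \<beta> u))" for i j
    by (subst exp[OF Vn]) (simp add: inner_sum_right)
  have "L_local T \<phi> V u \<bullet> e \<alpha> u = lap_comp \<phi> V (e \<alpha>) u + T \<bullet> grad_comp \<phi> V (e \<alpha>) u
         + (\<Sum>\<beta><p. \<Sum>i\<in>UNIV. \<Sum>j\<in>UNIV. \<Sum>k\<in>UNIV. \<Sum>l\<in>UNIV.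
              inv_metric \<phi> u i k * inv_metric \<phi> u j l *
              (V u \<bullet> e \<beta> u) * sff_comp \<phi> (e \<beta>) i j u * sff_comp \<phi> (e \<alpha>) k l u)" for \<alpha>
  proof -
    have "nor_deriv \<phi> V u T \<bullet> e \<alpha> u = T \<bullet> grad_comp \<phi> V (e \<alpha>) u"
      by (simp add: nor_deriv_def grad_comp_def nor_conn_pd[OF u] inv_metric_ginv inner_sum_left inner_sum_right
          algebra_simps) (subst sum.swap, simp add: ginv_sym[OF frame_\<phi>[OF u]])
    moreover have "AVA \<phi> V u \<bullet> e \<alpha> u = (\<Sum>\<beta><p. \<Sum>i\<in>UNIV. \<Sum>j\<in>UNIV. \<Sum>k\<in>UNIV. \<Sum>l\<in>UNIV.
              inv_metric \<phi> u i k * inv_metric \<phi> u j l *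
              (V u \<bullet> e \<beta> u) * sff_comp \<phi> (e \<beta>) i j u * sff_comp \<phi> (e \<alpha>) k l u)"
    proof -
      \<comment> \<open>Expanding \<open>V\<close> in the frame puts the sum over \<beta> innermost;
        the swaps below move it outwards one index at a time.\<close>
      have "AVA \<phi> V u \<bullet> e \<alpha> u = (\<Sum>i\<in>UNIV. \<Sum>j\<in>UNIV. \<Sum>k\<in>UNIV. \<Sum>l\<in>UNIV. \<Sum>\<beta><p.
              inv_metric \<phi> u i k * inv_metric \<phi> u j l *
              (V u \<bullet> e \<beta> u) * sff_comp \<phi> (e \<beta>) i j u * sff_comp \<phi> (e \<alpha>) k l u)"
        unfolding AVA_def inner_sum_left sff_pd[OF u] sff_comp_def AV
        by (simp add: sum_distrib_left sum_distrib_right mult.assoc)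
      also have "\<dots> = (\<Sum>i\<in>UNIV. \<Sum>j\<in>UNIV. \<Sum>k\<in>UNIV. \<Sum>\<beta><p. \<Sum>l\<in>UNIV.
              inv_metric \<phi> u i k * inv_metric \<phi> u j l *
              (V u \<bullet> e \<beta> u) * sff_comp \<phi> (e \<beta>) i j u * sff_comp \<phi> (e \<alpha>) k l u)"
        by (rule sum.cong[OF refl], rule sum.cong[OF refl], rule sum.cong[OF refl], rule sum.swap)
      also have "\<dots> = (\<Sum>i\<in>UNIV. \<Sum>j\<in>UNIV. \<Sum>\<beta><p. \<Sum>k\<in>UNIV. \<Sum>l\<in>UNIV.
              inv_metric \<phi> u i k * inv_metric \<phi> u j l *
              (V u \<bullet> e \<beta> u) * sff_comp \<phi> (e \<beta>) i j u * sff_comp \<phi> (e \<alpha>) k l u)"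
        by (rule sum.cong[OF refl], rule sum.cong[OF refl], rule sum.swap)
      also have "\<dots> = (\<Sum>i\<in>UNIV. \<Sum>\<beta><p. \<Sum>j\<in>UNIV. \<Sum>k\<in>UNIV. \<Sum>l\<in>UNIV.
              inv_metric \<phi> u i k * inv_metric \<phi> u j l *
              (V u \<bullet> e \<beta> u) * sff_comp \<phi> (e \<beta>) i j u * sff_comp \<phi> (e \<alpha>) k l u)"
        by (rule sum.cong[OF refl], rule sum.swap)
      finally show ?thesis by (subst (asm) sum.swap)
    qed
    ultimately show ?thesis
      by (simp add: L_local_eq[OF u V] lap_comp_def nor_laplacian_eq[OF u V] inner_add_left)
  qed
  moreover have "L_local T \<phi> V u = (\<Sum>\<alpha><p. (L_local T \<phi> V u \<bullet> e \<alpha> u) *\<^sub>R e \<alpha> u)"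
    by (rule exp) (use Ln in auto)
  ultimately show ?thesis unfolding L_components_def by simp
qed

end

section \<open>Independence of the chart\<close>

text \<open>The inverse Gram matrix transforms contravariantly and \<open>B1\<close> covariantly, so
  the Jacobi factors cancel. The values lie in any real vector space because vector-valued forms
  such as \<open>second_nor\<close> are traced as well.\<close>

lemma ginv_trace_transform:
  fixes J :: "'n::finite \<Rightarrow> 'n \<Rightarrow> real" and B1 B2 :: "'n \<Rightarrow> 'n \<Rightarrow> 'b::real_vector"
  assumes J: "\<And>i. e i = (\<Sum>k\<in>UNIV. J k i *\<^sub>R f k)" and e: "frame e"
    and B: "\<And>i j. B1 i j = (\<Sum>k\<in>UNIV. \<Sum>l\<in>UNIV. (J k i * J l j) *\<^sub>R B2 k l)"
  shows "(\<Sum>i\<in>UNIV. \<Sum>j\<in>UNIV. ginv e i j *\<^sub>R B1 i j) = (\<Sum>k\<in>UNIV. \<Sum>l\<in>UNIV. ginv f k l *\<^sub>R B2 k l)"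
proof -
  have "(\<Sum>i\<in>UNIV. \<Sum>j\<in>UNIV. ginv e i j *\<^sub>R B1 i j) = (\<Sum>(i,j)\<in>UNIV\<times>UNIV. \<Sum>(k,l)\<in>UNIV\<times>UNIV. (ginv e i j * J k i * J l j) *\<^sub>R B2 k l)"
    unfolding B sum.cartesian_product[symmetric] by (simp add: scaleR_sum_right mult.assoc)
  also have "\<dots> = (\<Sum>(k,l)\<in>UNIV\<times>UNIV. \<Sum>(i,j)\<in>UNIV\<times>UNIV. (ginv e i j * J k i * J l j) *\<^sub>R B2 k l)"
    unfolding split_def by (rule sum.swap)
  also have "\<dots> = (\<Sum>k\<in>UNIV. \<Sum>l\<in>UNIV. ginv f k l *\<^sub>R B2 k l)"
    unfolding sum.cartesian_product[symmetric] scaleR_sum_left[symmetric] ginv_transform[OF J e] ..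
  finally show ?thesis .
qed

text \<open>Brings a product of two transformed expressions into the double-sum form that the
  premise on \<open>B1\<close> in the trace lemma has.\<close>

lemma scaleR_sum_scaleR:
  fixes y :: "'k \<Rightarrow> 'b::real_vector"
  shows "(\<Sum>l\<in>L. a l * x l) *\<^sub>R (\<Sum>k\<in>K. b k *\<^sub>R y k) = (\<Sum>k\<in>K. \<Sum>l\<in>L. (b k * a l) *\<^sub>R (x l *\<^sub>R y k))"
  unfolding scaleR_sum_left unfolding scaleR_sum_right
  by (subst sum.swap) (simp add: mult.commute mult.left_commute)

lemma inner_sum_scaleR:
  "(\<Sum>k\<in>K. a k *\<^sub>R x k) \<bullet> (\<Sum>l\<in>L. b l *\<^sub>R y l) = (\<Sum>k\<in>K. \<Sum>l\<in>L. (a k * b l) *\<^sub>R (x k \<bullet> y l))"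
  unfolding inner_sum_left unfolding inner_sum_right by (simp add: mult.assoc mult.left_commute)

lemma pd_sum_scaleR:
  fixes f :: "'i \<Rightarrow> real^'n::finite \<Rightarrow> real" and w :: "'i \<Rightarrow> real^'n \<Rightarrow> 'a::euclidean_space"
  assumes "\<And>k. k \<in> I \<Longrightarrow> f k differentiable (at u)" "\<And>k. k \<in> I \<Longrightarrow> w k differentiable (at u)"
  shows "pd (\<lambda>v. \<Sum>k\<in>I. f k v *\<^sub>R w k v) i u = (\<Sum>k\<in>I. pd (f k) i u *\<^sub>R w k u + f k u *\<^sub>R pd (w k) i u)"
proof -
  have "((\<lambda>v. \<Sum>k\<in>I. f k v *\<^sub>R w k v) has_derivative
     (\<lambda>h. \<Sum>k\<in>I. f k u *\<^sub>R frechet_derivative (w k) (at u) h + frechet_derivative (f k) (at u) h *\<^sub>R w k u)) (at u)"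
    by (intro has_derivative_sum has_derivative_scaleR) (use assms frechet_derivative_works in auto)
  from frechet_derivative_at[OF this, symmetric] show ?thesis unfolding pd_def by (simp add: add.commute)
qed

text \<open>\<open>\<tau>\<close> is the transition map from the overlap \<open>O1\<close> into the
  second chart; quantities with suffix 1 are pull-backs of those with suffix 2.\<close>

locale chart_change = A: local_immersion O1 \<phi>1 + B: local_immersion W2 \<phi>2
  for O1 :: "(real^'n::finite) set" and \<phi>1 :: "real^'n \<Rightarrow> 'a::euclidean_space"
    and W2 :: "(real^'n) set" and \<phi>2 :: "real^'n \<Rightarrow> 'a" +
  fixes \<tau> :: "real^'n \<Rightarrow> real^'n"
  assumes smooth_\<tau>: "smooth_on O1 \<tau>" and \<tau>_in: "u \<in> O1 \<Longrightarrow> \<tau> u \<in> W2" and \<phi>1_eq: "u \<in> O1 \<Longrightarrow> \<phi>1 u = \<phi>2 (\<tau> u)"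
begin

definition "J k i u = frechet_derivative \<tau> (at u) (axis i 1) $ k"

lemma smooth_J: "smooth_on O1 (\<lambda>u. J k i u)"
  unfolding J_def
  by (rule smooth_on_bounded_linear[OF A.open_W bounded_linear_vec_nth smooth_on_frechet[OF smooth_\<tau>]])

lemma pd_pullback_at:
  fixes f :: "real^'n \<Rightarrow> 'b::euclidean_space"
  assumes u: "u \<in> O1" and df: "f differentiable (at (\<tau> u))" and g: "\<And>u. u \<in> O1 \<Longrightarrow> g u = f (\<tau> u)"
  shows "pd g i u = (\<Sum>k\<in>UNIV. J k i u *\<^sub>R pd f k (\<tau> u))"
proof -
  have d: "\<tau> differentiable (at u)" by (rule smooth_on_differentiable[OF smooth_\<tau> u])
  have "pd g i u = pd (\<lambda>v. f (\<tau> v)) i u"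
    by (rule sym, rule A.pd_cong[OF _ u]) (use differentiable_chain_at[OF d df] g in \<open>auto simp: o_def\<close>)
  then show ?thesis using pd_compose[OF d df, of i] by (simp add: J_def)
qed

lemma pd_pullback:
  fixes f :: "real^'n \<Rightarrow> 'b::euclidean_space"
  assumes "u \<in> O1" "smooth_on W2 f" "\<And>u. u \<in> O1 \<Longrightarrow> g u = f (\<tau> u)"
  shows "pd g i u = (\<Sum>k\<in>UNIV. J k i u *\<^sub>R pd f k (\<tau> u))"
  by (rule pd_pullback_at[OF assms(1) smooth_on_differentiable[OF assms(2) \<tau>_in[OF assms(1)]] assms(3)])

lemma pd_\<phi>1: "u \<in> O1 \<Longrightarrow> pd \<phi>1 i u = (\<Sum>k\<in>UNIV. J k i u *\<^sub>R pd \<phi>2 k (\<tau> u))"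
  by (rule pd_pullback[OF _ B.smooth_\<phi>]) (auto simp: \<phi>1_eq)

lemma smooth_pullback:
  fixes f :: "real^'n \<Rightarrow> 'b::euclidean_space"
  shows "smooth_on W2 f \<Longrightarrow> smooth_on O1 (\<lambda>u. f (\<tau> u))"
  by (rule smooth_on_compose[OF A.open_W B.open_W _ smooth_\<tau>]) (use \<tau>_in in auto)

lemma trace:
  fixes B1 B2 :: "'n \<Rightarrow> 'n \<Rightarrow> 'b::real_vector"
  assumes u: "u \<in> O1" and B: "\<And>i j. B1 i j = (\<Sum>k\<in>UNIV. \<Sum>l\<in>UNIV. (J k i u * J l j u) *\<^sub>R B2 k l)"
  shows "(\<Sum>i\<in>UNIV. \<Sum>j\<in>UNIV. ginv (\<lambda>i. pd \<phi>1 i u) i j *\<^sub>R B1 i j) =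
    (\<Sum>k\<in>UNIV. \<Sum>l\<in>UNIV. ginv (\<lambda>i. pd \<phi>2 i (\<tau> u)) k l *\<^sub>R B2 k l)"
  by (rule ginv_trace_transform[OF _ A.frame_\<phi>[OF u] B]) (rule pd_\<phi>1[OF u])

lemma tproj_change: "u \<in> O1 \<Longrightarrow> tproj (\<lambda>i. pd \<phi>1 i u) v = tproj (\<lambda>i. pd \<phi>2 i (\<tau> u)) v"
  unfolding tproj_def scaleR_scaleR[symmetric]
  by (rule trace, assumption) (simp only: pd_\<phi>1 inner_sum_right inner_scaleR_right scaleR_sum_scaleR)

lemma nor_proj_change: "u \<in> O1 \<Longrightarrow> nor_proj \<phi>1 u v = nor_proj \<phi>2 (\<tau> u) v"
  by (simp add: A.nor_proj_eq B.nor_proj_eq tproj_change \<tau>_in)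

lemma div_drift_change:
  assumes u: "u \<in> O1" and Z: "Z2 differentiable (at (\<tau> u))" "\<And>u. u \<in> O1 \<Longrightarrow> Z1 u = Z2 (\<tau> u)"
  shows "div_drift T \<phi>1 Z1 u = div_drift T \<phi>2 Z2 (\<tau> u)"
proof -
  have "(\<Sum>i\<in>UNIV. \<Sum>j\<in>UNIV. ginv (\<lambda>i. pd \<phi>1 i u) i j *\<^sub>R (pd Z1 i u \<bullet> pd \<phi>1 j u)) =
    (\<Sum>i\<in>UNIV. \<Sum>j\<in>UNIV. ginv (\<lambda>i. pd \<phi>2 i (\<tau> u)) i j *\<^sub>R (pd Z2 i (\<tau> u) \<bullet> pd \<phi>2 j (\<tau> u)))"
    by (rule trace[OF u]) (simp only: pd_\<phi>1[OF u] pd_pullback_at[where g = Z1 and f = Z2, OF u Z] inner_sum_scaleR)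
  then show ?thesis using Z(2)[OF u] by (simp add: div_drift_def)
qed

context
  fixes V1 V2 :: "real^'n \<Rightarrow> 'a"
  assumes V: "smooth_on W2 V2" "\<And>u. u \<in> O1 \<Longrightarrow> V1 u = V2 (\<tau> u)"
begin

lemma nor_pd_change:
  assumes u: "u \<in> O1"
  shows "nor_proj \<phi>1 u (pd V1 j u) = (\<Sum>k\<in>UNIV. J k j u *\<^sub>R nor_proj \<phi>2 (\<tau> u) (pd V2 k (\<tau> u)))"
proof -
  have "pd V1 j u = (\<Sum>k\<in>UNIV. J k j u *\<^sub>R pd V2 k (\<tau> u))"
    by (rule pd_pullback[OF u V])
  then show ?thesis by (simp add: nor_proj_change[OF u]  linear_sum[OF B.linear_nor_proj[OF \<tau>_in[OF u]]] linear_cmul[OF B.linear_nor_proj[OF \<tau>_in[OF u]]])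
qed

lemma nor_deriv_change:
  assumes u: "u \<in> O1"
  shows "nor_deriv \<phi>1 V1 u y = nor_deriv \<phi>2 V2 (\<tau> u) y"
  unfolding nor_deriv_def scaleR_scaleR[symmetric]
  by (rule trace[OF u]) (simp only: pd_\<phi>1[OF u] nor_pd_change[OF u] inner_sum_right inner_scaleR_right scaleR_sum_scaleR)

text \<open>The first sum, with the derivative of the Jacobi matrix, is what prevents second
  derivatives from being tensors. The lemma serves both the coordinate fields and the normal
  derivatives of \<open>V\<close>.\<close>

lemma pd_change_second:
  fixes F1 :: "real^'n \<Rightarrow> 'a" and F2 :: "'n \<Rightarrow> real^'n \<Rightarrow> 'a"
  assumes u: "u \<in> O1" and F: "\<And>k. smooth_on W2 (F2 k)" "\<And>v. v \<in> O1 \<Longrightarrow> F1 v = (\<Sum>k\<in>UNIV. J k j v *\<^sub>R F2 k (\<tau> v))"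
  shows "pd F1 i u = (\<Sum>k\<in>UNIV. pd (J k j) i u *\<^sub>R F2 k (\<tau> u)) + (\<Sum>l\<in>UNIV. \<Sum>k\<in>UNIV. (J l i u * J k j u) *\<^sub>R pd (F2 k) l (\<tau> u))"
proof -
  have d: "J k j differentiable (at u)" "(\<lambda>v. F2 k (\<tau> v)) differentiable (at u)" for k
    using smooth_on_differentiable[OF smooth_J u] smooth_on_differentiable[OF smooth_pullback[OF F(1)] u] by auto
  have "pd F1 i u = pd (\<lambda>v. \<Sum>k\<in>UNIV. J k j v *\<^sub>R F2 k (\<tau> v)) i u"
    by (rule sym, rule A.pd_cong[OF _ u]) (use F(2) d in \<open>auto intro!: derivative_intros\<close>)
  also have "\<dots> = (\<Sum>k\<in>UNIV. pd (J k j) i u *\<^sub>R F2 k (\<tau> u) + J k j u *\<^sub>R pd (\<lambda>v. F2 k (\<tau> v)) i u)"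
    by (rule pd_sum_scaleR) (use d in auto)
  also have "\<dots> = (\<Sum>k\<in>UNIV. pd (J k j) i u *\<^sub>R F2 k (\<tau> u)) + (\<Sum>k\<in>UNIV. \<Sum>l\<in>UNIV. (J l i u * J k j u) *\<^sub>R pd (F2 k) l (\<tau> u))"
    by (simp add: pd_pullback[OF u F(1) refl] sum.distrib scaleR_sum_right mult.commute)
  finally show ?thesis by (subst (asm) sum.swap)
qed

text \<open>The nontensorial terms of the two parts of \<open>second_nor\<close> coincide, since
  \<open>nor_deriv\<close> sends the coordinate fields back to the normal derivatives of
  \<open>V\<close>; they cancel in the difference.\<close>

lemma second_nor_change:
  assumes u: "u \<in> O1"
  shows "A.second_nor V1 i j u = (\<Sum>l\<in>UNIV. \<Sum>k\<in>UNIV. (J l i u * J k j u) *\<^sub>R B.second_nor V2 l k (\<tau> u))"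
proof -
  let ?n = "nor_proj \<phi>2 (\<tau> u)" and ?d = "nor_deriv \<phi>2 V2 (\<tau> u)"
  let ?w = "\<lambda>k v. nor_proj \<phi>2 v (pd V2 k v)"
  have tu: "\<tau> u \<in> W2" by (rule \<tau>_in[OF u])
  note ln = linear_add[OF B.linear_nor_proj[OF tu]] linear_sum[OF B.linear_nor_proj[OF tu]] linear_cmul[OF B.linear_nor_proj[OF tu]]
  note ld = linear_add[OF B.linear_nor_deriv] linear_sum[OF B.linear_nor_deriv] linear_cmul[OF B.linear_nor_deriv]
  have nw: "?n (?w k (\<tau> u)) = ?w k (\<tau> u)" for k
    by (rule B.nor_proj_normal[OF tu]) (rule B.nor_proj_inner[OF tu])
  have "pd (\<lambda>v. nor_proj \<phi>1 v (pd V1 j v)) i u = (\<Sum>k\<in>UNIV. pd (J k j) i u *\<^sub>R ?w k (\<tau> u)) +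
      (\<Sum>l\<in>UNIV. \<Sum>k\<in>UNIV. (J l i u * J k j u) *\<^sub>R pd (?w k) l (\<tau> u))"
    by (rule pd_change_second[OF u B.smooth_nor_proj[OF smooth_on_pd[OF V(1)]]]) (rule nor_pd_change)
  moreover have "pd (pd \<phi>1 j) i u = (\<Sum>k\<in>UNIV. pd (J k j) i u *\<^sub>R pd \<phi>2 k (\<tau> u)) +
      (\<Sum>l\<in>UNIV. \<Sum>k\<in>UNIV. (J l i u * J k j u) *\<^sub>R pd (pd \<phi>2 k) l (\<tau> u))"
    by (rule pd_change_second[OF u smooth_on_pd[OF B.smooth_\<phi>]]) (rule pd_\<phi>1)
  ultimately show ?thesis
    unfolding A.second_nor_def B.second_nor_def nor_proj_change[OF u] nor_deriv_change[OF u]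
    by (simp add: ln ld nw B.nor_deriv_pd[OF tu] scaleR_diff_right sum_subtractf)
qed

text \<open>The nontensorial term is tangent and is removed by the normal projection.\<close>

lemma sff_change:
  assumes u: "u \<in> O1"
  shows "nor_proj \<phi>1 u (pd (pd \<phi>1 j) i u) = (\<Sum>l\<in>UNIV. \<Sum>k\<in>UNIV. (J l i u * J k j u) *\<^sub>R nor_proj \<phi>2 (\<tau> u) (pd (pd \<phi>2 k) l (\<tau> u)))"
proof -
  have tu: "\<tau> u \<in> W2" by (rule \<tau>_in[OF u])
  note ln = linear_add[OF B.linear_nor_proj[OF tu]] linear_sum[OF B.linear_nor_proj[OF tu]] linear_cmul[OF B.linear_nor_proj[OF tu]]
  have "pd (pd \<phi>1 j) i u = (\<Sum>k\<in>UNIV. pd (J k j) i u *\<^sub>R pd \<phi>2 k (\<tau> u)) +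
      (\<Sum>l\<in>UNIV. \<Sum>k\<in>UNIV. (J l i u * J k j u) *\<^sub>R pd (pd \<phi>2 k) l (\<tau> u))"
    by (rule pd_change_second[OF u smooth_on_pd[OF B.smooth_\<phi>]]) (rule pd_\<phi>1)
  then show ?thesis by (simp add: nor_proj_change[OF u] ln B.nor_proj_tangent[OF tu])
qed

text \<open>With j and l fixed, the form in i and k is traced first. The result transforms
  covariantly in j and l, which permits the second trace.\<close>

lemma AVA_change:
  assumes u: "u \<in> O1"
  shows "AVA \<phi>1 V1 u = AVA \<phi>2 V2 (\<tau> u)"
proof -
  have tu: "\<tau> u \<in> W2" by (rule \<tau>_in[OF u])
  let ?A = "\<lambda>i j. nor_proj \<phi>2 (\<tau> u) (pd (pd \<phi>2 j) i (\<tau> u))"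
  have inner: "(\<Sum>i\<in>UNIV. \<Sum>k\<in>UNIV. ginv (\<lambda>i. pd \<phi>1 i u) i k *\<^sub>R
     ((nor_proj \<phi>1 u (pd (pd \<phi>1 j) i u) \<bullet> V1 u) *\<^sub>R nor_proj \<phi>1 u (pd (pd \<phi>1 l) k u))) =
    (\<Sum>a\<in>UNIV. \<Sum>c\<in>UNIV. ginv (\<lambda>i. pd \<phi>2 i (\<tau> u)) a c *\<^sub>R
      ((\<Sum>b\<in>UNIV. J b j u *\<^sub>R (?A a b \<bullet> V2 (\<tau> u))) *\<^sub>R (\<Sum>d\<in>UNIV. J d l u *\<^sub>R ?A c d)))" for j l
  proof (rule trace[OF u])
    fix i k
    have 1: "nor_proj \<phi>1 u (pd (pd \<phi>1 j) i u) \<bullet> V1 u = (\<Sum>a\<in>UNIV. J a i u * (\<Sum>b\<in>UNIV. J b j u *\<^sub>R (?A a b \<bullet> V2 (\<tau> u))))" for i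
      by (simp add: sff_change[OF u] V(2)[OF u] inner_sum_left sum_distrib_left mult.assoc)
    have 2: "nor_proj \<phi>1 u (pd (pd \<phi>1 l) k u) = (\<Sum>c\<in>UNIV. J c k u *\<^sub>R (\<Sum>d\<in>UNIV. J d l u *\<^sub>R ?A c d))"
      by (simp add: sff_change[OF u] scaleR_sum_right)
    show "(nor_proj \<phi>1 u (pd (pd \<phi>1 j) i u) \<bullet> V1 u) *\<^sub>R nor_proj \<phi>1 u (pd (pd \<phi>1 l) k u) =
      (\<Sum>a\<in>UNIV. \<Sum>c\<in>UNIV. (J a i u * J c k u) *\<^sub>R ((\<Sum>b\<in>UNIV. J b j u *\<^sub>R (?A a b \<bullet> V2 (\<tau> u))) *\<^sub>R (\<Sum>d\<in>UNIV. J d l u *\<^sub>R ?A c d)))"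
      unfolding 1 2 scaleR_sum_scaleR by (subst sum.swap) (simp add: mult.commute)
  qed
  have outer: "(\<Sum>a\<in>UNIV. \<Sum>c\<in>UNIV. ginv (\<lambda>i. pd \<phi>2 i (\<tau> u)) a c *\<^sub>R
      ((\<Sum>b\<in>UNIV. J b j u *\<^sub>R (?A a b \<bullet> V2 (\<tau> u))) *\<^sub>R (\<Sum>d\<in>UNIV. J d l u *\<^sub>R ?A c d))) =
     (\<Sum>b\<in>UNIV. \<Sum>d\<in>UNIV. (J b j u * J d l u) *\<^sub>R (\<Sum>a\<in>UNIV. \<Sum>c\<in>UNIV. ginv (\<lambda>i. pd \<phi>2 i (\<tau> u)) a c *\<^sub>R
      ((?A a b \<bullet> V2 (\<tau> u)) *\<^sub>R ?A c d)))" (is "?lhs = ?rhs") for j l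
  proof -
    let ?t = "\<lambda>a c b d. (J b j u * J d l u * ginv (\<lambda>i. pd \<phi>2 i (\<tau> u)) a c * (?A a b \<bullet> V2 (\<tau> u))) *\<^sub>R ?A c d"
    have "ginv (\<lambda>i. pd \<phi>2 i (\<tau> u)) a c *\<^sub>R ((\<Sum>b\<in>UNIV. J b j u *\<^sub>R (?A a b \<bullet> V2 (\<tau> u))) *\<^sub>R (\<Sum>d\<in>UNIV. J d l u *\<^sub>R ?A c d))
       = (\<Sum>b\<in>UNIV. \<Sum>d\<in>UNIV. ?t a c b d)" for a c
      unfolding real_scaleR_def scaleR_sum_scaleR
      by (subst sum.swap) (simp add: scaleR_sum_right mult.assoc mult.left_commute mult.commute)
    then have "?lhs = (\<Sum>(a,c)\<in>UNIV\<times>UNIV. \<Sum>(b,d)\<in>UNIV\<times>UNIV. ?t a c b d)"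
      unfolding sum.cartesian_product[symmetric] by simp
    also have "\<dots> = (\<Sum>(b,d)\<in>UNIV\<times>UNIV. \<Sum>(a,c)\<in>UNIV\<times>UNIV. ?t a c b d)"
      unfolding split_def by (rule sum.swap)
    also have "\<dots> = ?rhs"
      unfolding sum.cartesian_product[symmetric] by (simp add: scaleR_sum_right mult.assoc)
    finally show ?thesis .
  qed
  show ?thesis
    unfolding A.AVA_eq[OF u] B.AVA_eq[OF tu] inner outer by (rule trace[OF u]) (rule refl)
qed

lemma L_local_change:
  assumes u: "u \<in> O1"
  shows "L_local T \<phi>1 V1 u = L_local T \<phi>2 V2 (\<tau> u)"
proof -
  have tu: "\<tau> u \<in> W2" by (rule \<tau>_in[OF u])
  have s: "smooth_on O1 V1"
    by (rule smooth_on_cong[OF A.open_W _ smooth_pullback[OF V(1)]]) (simp add: V(2))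
  show ?thesis
    unfolding A.L_local_eq[OF u s] B.L_local_eq[OF tu V(1)] AVA_change[OF u] nor_deriv_change[OF u]
      trace[OF u second_nor_change[OF u]] ..
qed

end

end

section \<open>Symmetry of second derivatives\<close>

text \<open>The mean value theorem is applied in direction v to the difference p of the values of f
  along two parallel segments, and then in direction w to the directional derivative.\<close>

lemma second_difference_mvt:
  fixes f :: "'a::real_normed_vector \<Rightarrow> real"
  assumes S: "open S" and f: "smooth_on S f" and r: "r > 0"
    and sub: "\<And>h k. 0 \<le> h \<Longrightarrow> h \<le> r \<Longrightarrow> 0 \<le> k \<Longrightarrow> k \<le> r \<Longrightarrow> x + h *\<^sub>R w + k *\<^sub>R v \<in> S"
  obtains h k where "0 \<le> h" "h \<le> r" "0 \<le> k" "k \<le> r"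
    "f (x + r *\<^sub>R w + r *\<^sub>R v) - f (x + r *\<^sub>R v) - f (x + r *\<^sub>R w) + f x =
      r * r * frechet_derivative (\<lambda>y. frechet_derivative f (at y) v) (at (x + h *\<^sub>R w + k *\<^sub>R v)) w"
proof -
  let ?Dv = "\<lambda>y. frechet_derivative f (at y) v"
  have dir: "((\<lambda>t. g (y + t *\<^sub>R z)) has_real_derivative frechet_derivative g (at (y + t *\<^sub>R z)) z) (at t)"
    if g: "smooth_on S g" "y + t *\<^sub>R z \<in> S" for g :: "'a \<Rightarrow> real" and y z t
  proof -
    have D: "(g has_derivative frechet_derivative g (at (y + t *\<^sub>R z))) (at (y + t *\<^sub>R z))"
      by (rule smooth_on_has_derivative[OF g])
    have "((\<lambda>t. y + t *\<^sub>R z) has_derivative (\<lambda>h. h *\<^sub>R z)) (at t)"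
      by (auto intro!: derivative_eq_intros)
    from has_derivative_compose[OF this D] show ?thesis
      unfolding has_field_derivative_def
      by (rule has_derivative_eq_rhs) (simp add: fun_eq_iff linear_cmul[OF has_derivative_linear[OF D]])
  qed
  define p where "p k = f (x + r *\<^sub>R w + k *\<^sub>R v) - f (x + k *\<^sub>R v)" for k
  have "(p has_real_derivative ?Dv (x + r *\<^sub>R w + k *\<^sub>R v) - ?Dv (x + k *\<^sub>R v)) (at k)" if "0 \<le> k" "k \<le> r" for k
    unfolding p_def using sub[of r k] sub[of 0 k] that r
    by (intro DERIV_diff dir f) auto
  from MVT2[OF r this] obtain k where k: "0 < k" "k < r"
    "p r - p 0 = r * (?Dv (x + r *\<^sub>R w + k *\<^sub>R v) - ?Dv (x + k *\<^sub>R v))" by auto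
  have "((\<lambda>h. ?Dv (x + k *\<^sub>R v + h *\<^sub>R w)) has_real_derivative frechet_derivative ?Dv (at (x + k *\<^sub>R v + h *\<^sub>R w)) w) (at h)"
    if "0 \<le> h" "h \<le> r" for h
    using sub[of h k] that k by (intro dir smooth_on_frechet f) (auto simp: algebra_simps)
  from MVT2[OF r this] obtain h where h: "0 < h" "h < r"
    "?Dv (x + k *\<^sub>R v + r *\<^sub>R w) - ?Dv (x + k *\<^sub>R v) = r * frechet_derivative ?Dv (at (x + k *\<^sub>R v + h *\<^sub>R w)) w" by auto
  have "p r - p 0 = r * r * frechet_derivative ?Dv (at (x + h *\<^sub>R w + k *\<^sub>R v)) w"
    using k(3) h(3) by (simp add: algebra_simps)
  then show ?thesis using h k by (intro that[of h k]) (auto simp: p_def)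
qed

text \<open>The second difference is symmetric in v and w, so a value of one mixed derivative near x
  equals a value of the other near x; continuity carries this to x.\<close>

lemma frechet_commute_real:
  fixes f :: "'a::real_normed_vector \<Rightarrow> real"
  assumes S: "open S" and f: "smooth_on S f" and x: "x \<in> S"
  shows "frechet_derivative (\<lambda>y. frechet_derivative f (at y) v) (at x) w = frechet_derivative (\<lambda>y. frechet_derivative f (at y) w) (at x) v"
proof -
  define a where "a y = frechet_derivative (\<lambda>y. frechet_derivative f (at y) v) (at y) w" for y
  define b where "b y = frechet_derivative (\<lambda>y. frechet_derivative f (at y) w) (at y) v" for y
  have cont: "continuous_on S a" "continuous_on S b"
    unfolding a_def b_def by (auto intro!: smooth_on_continuous smooth_on_frechet f)
  have "\<bar>a x - b x\<bar> \<le> 0 + e" if e: "e > 0" for e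
  proof -
    have "\<forall>\<^sub>F y in nhds x. y \<in> S \<and> dist (a y) (a x) < e/2 \<and> dist (b y) (b x) < e/2"
    proof -
      have "(a \<longlongrightarrow> a x) (nhds x)" "(b \<longlongrightarrow> b x) (nhds x)"
        using cont S x by (auto simp: continuous_on_eq_continuous_at continuous_at tendsto_nhds_iff)
      then show ?thesis
        using e S x by (intro eventually_conj tendstoD) (auto simp: eventually_nhds_in_open)
    qed
    then obtain d where d: "d > 0" "\<And>y. dist y x < d \<Longrightarrow> y \<in> S \<and> dist (a y) (a x) < e/2 \<and> dist (b y) (b x) < e/2"
      unfolding eventually_nhds_metric by blast
    \<comment> \<open>With this r every point of the parallelogram is at distance at most d/2 from
      x; the summand 1 avoids division by zero.\<close>
    define r where "r = d / (2 * (norm w + norm v + 1))"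
    have r: "r > 0" using d(1) by (simp add: r_def add_nonneg_pos)
    have near: "dist (x + h *\<^sub>R w + k *\<^sub>R v) x < d" if "0 \<le> h" "h \<le> r" "0 \<le> k" "k \<le> r" for h k
    proof -
      have "dist (x + h *\<^sub>R w + k *\<^sub>R v) x = norm (h *\<^sub>R w + k *\<^sub>R v)" by (simp add: dist_norm)
      also have "\<dots> \<le> h * norm w + k * norm v" using norm_triangle_ineq[of "h *\<^sub>R w" "k *\<^sub>R v"] that by simp
      also have "\<dots> \<le> r * norm w + r * norm v" using that by (intro add_mono mult_right_mono) auto
      also have "\<dots> \<le> r * (norm w + norm v + 1)" using r by (simp add: algebra_simps)
      also have "\<dots> = d / 2"
      proof -
        have "norm w + norm v + 1 \<noteq> 0" using norm_ge_zero[of w] norm_ge_zero[of v] by linarith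
        moreover have "d / (2 * N) * N = d / 2" if "N \<noteq> 0" for N using that by simp
        ultimately show ?thesis unfolding r_def by blast
      qed
      finally show ?thesis using d(1) by simp
    qed
    obtain h k where 1: "0 \<le> h" "h \<le> r" "0 \<le> k" "k \<le> r"
      "f (x + r *\<^sub>R w + r *\<^sub>R v) - f (x + r *\<^sub>R v) - f (x + r *\<^sub>R w) + f x = r * r * a (x + h *\<^sub>R w + k *\<^sub>R v)"
      unfolding a_def by (rule second_difference_mvt[OF S f r, of x w v]) (use near d(2) in auto)
    obtain h' k' where 2: "0 \<le> h'" "h' \<le> r" "0 \<le> k'" "k' \<le> r"
      "f (x + r *\<^sub>R v + r *\<^sub>R w) - f (x + r *\<^sub>R w) - f (x + r *\<^sub>R v) + f x = r * r * b (x + h' *\<^sub>R v + k' *\<^sub>R w)"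
      unfolding b_def
    proof (rule second_difference_mvt[OF S f r, of x v w])
      show "x + h *\<^sub>R v + k *\<^sub>R w \<in> S" if "0 \<le> h" "h \<le> r" "0 \<le> k" "k \<le> r" for h k
        using near[of k h] that d(2)[of "x + k *\<^sub>R w + h *\<^sub>R v"] by (simp add: add.assoc add.commute[of "h *\<^sub>R v"])
    qed
    have "r * r * a (x + h *\<^sub>R w + k *\<^sub>R v) = r * r * b (x + k' *\<^sub>R w + h' *\<^sub>R v)"
      using 1(5) 2(5) by (simp add: algebra_simps)
    then have "a (x + h *\<^sub>R w + k *\<^sub>R v) = b (x + k' *\<^sub>R w + h' *\<^sub>R v)" using r by simp
    moreover have "dist (a (x + h *\<^sub>R w + k *\<^sub>R v)) (a x) < e/2" using d(2) near 1 by blast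
    moreover have "dist (b (x + k' *\<^sub>R w + h' *\<^sub>R v)) (b x) < e/2" using d(2) near 2 by blast
    ultimately show ?thesis unfolding dist_real_def by linarith
  qed
  then have "\<bar>a x - b x\<bar> \<le> 0" by (rule field_le_epsilon)
  then show ?thesis by (simp add: a_def b_def)
qed

lemma frechet_inner:
  assumes "f differentiable (at x)"
  shows "frechet_derivative (\<lambda>y. f y \<bullet> b) (at x) v = frechet_derivative f (at x) v \<bullet> b"
  using frechet_derivative_at[OF has_derivative_inner_left[OF assms[unfolded frechet_derivative_works]], of b] by metis

lemma frechet_commute:
  fixes f :: "'a::real_normed_vector \<Rightarrow> 'b::euclidean_space"
  assumes S: "open S" and f: "smooth_on S f" and x: "x \<in> S"
  shows "frechet_derivative (\<lambda>y. frechet_derivative f (at y) v) (at x) w = frechet_derivative (\<lambda>y. frechet_derivative f (at y) w) (at x) v"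
proof (rule euclidean_eqI)
  fix b :: 'b
  have fb: "smooth_on S (\<lambda>y. f y \<bullet> b)" by (intro smooth_intros S f)
  have *: "frechet_derivative (\<lambda>y. frechet_derivative f (at y) v) (at x) w \<bullet> b =
      frechet_derivative (\<lambda>y. frechet_derivative (\<lambda>y. f y \<bullet> b) (at y) v) (at x) w" for v w
  proof -
    have d: "(\<lambda>y. frechet_derivative f (at y) v) differentiable (at x)"
      by (rule smooth_on_differentiable[OF smooth_on_frechet[OF f] x])
    have "frechet_derivative (\<lambda>y. frechet_derivative f (at y) v \<bullet> b) (at x) =
      frechet_derivative (\<lambda>y. frechet_derivative (\<lambda>y. f y \<bullet> b) (at y) v) (at x)"
      by (rule frechet_derivative_transform_within_open[OF _ S x])
        (use d smooth_on_differentiable[OF f] frechet_inner[of f] in auto)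
    then show ?thesis by (simp add: frechet_inner[OF d, symmetric])
  qed
  show "frechet_derivative (\<lambda>y. frechet_derivative f (at y) v) (at x) w \<bullet> b = frechet_derivative (\<lambda>y. frechet_derivative f (at y) w) (at x) v \<bullet> b"
    unfolding * by (rule frechet_commute_real[OF S fb x])
qed

lemma pd_commute: "open S \<Longrightarrow> smooth_on S f \<Longrightarrow> u \<in> S \<Longrightarrow> pd (pd f i) j u = pd (pd f j) i u"
  unfolding pd_def[abs_def] by (rule frechet_commute)

section \<open>Gluing\<close>

context smooth_manifold
begin

definition chart_at :: "'m \<Rightarrow> (real^'n) set \<times> (real^'n \<Rightarrow> 'm)" where
  "chart_at q = (SOME c. c \<in> \<A> \<and> q \<in> snd c ` fst c)"

text \<open>Turns a chart expression into a function on \<open>M\<close> by evaluating it in a chart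
  selected for each point. For chart independent expressions the selection does not matter.\<close>

definition glue :: "((real^'n \<Rightarrow> 'm) \<Rightarrow> real^'n \<Rightarrow> 'c) \<Rightarrow> 'm \<Rightarrow> 'c" where
  "glue f q = f (snd (chart_at q)) (inv_into (fst (chart_at q)) (snd (chart_at q)) q)"

definition chart_indep :: "((real^'n \<Rightarrow> 'm) \<Rightarrow> real^'n \<Rightarrow> 'c) \<Rightarrow> bool" where
  "chart_indep f \<longleftrightarrow> (\<forall>(W1,\<psi>1)\<in>\<A>. \<forall>(W2,\<psi>2)\<in>\<A>. \<forall>u1\<in>W1. \<forall>u2\<in>W2. \<psi>1 u1 = \<psi>2 u2 \<longrightarrow> f \<psi>1 u1 = f \<psi>2 u2)"

lemma glue_eq:
  assumes f: "chart_indep f" and c: "(W, \<psi>) \<in> \<A>" "u \<in> W"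
  shows "glue f (\<psi> u) = f \<psi> u"
proof -
  define q where "q = \<psi> u"
  have "(W, \<psi>) \<in> \<A> \<and> q \<in> snd (W, \<psi>) ` fst (W, \<psi>)" using c by (auto simp: q_def)
  then have *: "chart_at q \<in> \<A> \<and> q \<in> snd (chart_at q) ` fst (chart_at q)"
    unfolding chart_at_def by (rule someI)
  obtain W' \<psi>' where c': "chart_at q = (W', \<psi>')" by force
  have "inv_into W' \<psi>' q \<in> W'" "\<psi>' (inv_into W' \<psi>' q) = q" using * c' by (auto simp: inv_into_into f_inv_into_f)
  moreover have "(W', \<psi>') \<in> \<A>" using * c' by simp
  ultimately have "f \<psi>' (inv_into W' \<psi>' q) = f \<psi> u"
    using f c unfolding chart_indep_def q_def by fast
  then show ?thesis unfolding glue_def q_def[symmetric] c' by simp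
qed

text \<open>Continuity is local and chart ranges are open in \<open>M\<close>, so it can be tested
  in charts. The parameter is carried along because bounds uniform in the variation parameter need
  joint continuity.\<close>

lemma continuous_on_glue_param:
  fixes G :: "'t::t2_space \<Rightarrow> 'm \<Rightarrow> 'c::topological_space"
  assumes G: "\<And>W \<psi>. (W, \<psi>) \<in> \<A> \<Longrightarrow> continuous_on (S \<times> W) (\<lambda>(s, u). G s (\<psi> u))"
  shows "continuous_on (S \<times> M) (\<lambda>(s, q). G s q)"
  unfolding continuous_on_eq_continuous_within
proof (intro ballI)
  fix x assume x: "x \<in> S \<times> M"
  then obtain s q where sq: "x = (s, q)" "s \<in> S" "q \<in> M" by auto
  then obtain W \<psi> u where c: "(W, \<psi>) \<in> \<A>" "u \<in> W" "\<psi> u = q" using chart_cover by metis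
  obtain U where U: "open U" "\<psi> ` W = M \<inter> U" using chart_openin[OF c(1)] by (auto simp: openin_open)
  have "continuous_on (S \<times> \<psi> ` W) ((\<lambda>(s, u). G s (\<psi> u)) \<circ> (\<lambda>(s, q). (s, inv_into W \<psi> q)))"
  proof (rule continuous_on_compose)
    have 1: "continuous_on (S \<times> \<psi> ` W) (\<lambda>y. inv_into W \<psi> (snd y))"
      by (rule continuous_on_compose2[OF chart_inv_continuous[OF c(1)] continuous_on_snd[OF continuous_on_id]]) auto
    show "continuous_on (S \<times> \<psi> ` W) (\<lambda>(s, q). (s, inv_into W \<psi> q))"
      unfolding split_def by (intro continuous_on_Pair continuous_on_fst continuous_on_id 1)
    show "continuous_on ((\<lambda>(s, q). (s, inv_into W \<psi> q)) ` (S \<times> \<psi> ` W)) (\<lambda>(s, u). G s (\<psi> u))"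
      by (rule continuous_on_subset[OF G[OF c(1)]]) (auto simp: inv_into_into inv_into_f_f[OF chart_inj[OF c(1)]])
  qed
  then have "continuous_on (S \<times> \<psi> ` W) (\<lambda>(s, q). G s q)"
    by (rule continuous_on_eq) (auto simp: inv_into_f_f[OF chart_inj[OF c(1)]])
  then have "continuous (at x within S \<times> \<psi> ` W) (\<lambda>(s, q). G s q)"
    using sq c by (auto simp: continuous_on_eq_continuous_within)
  moreover have "at x within S \<times> \<psi> ` W = at x within S \<times> M"
    by (rule at_within_nhd[of _ "UNIV \<times> U"]) (use sq c U in \<open>auto intro: open_Times\<close>)
  ultimately show "continuous (at x within S \<times> M) (\<lambda>(s, q). G s q)" by simp
qed

lemma continuous_on_glue:
  fixes G :: "'m \<Rightarrow> 'c::topological_space"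
  assumes G: "\<And>W \<psi>. (W, \<psi>) \<in> \<A> \<Longrightarrow> continuous_on W (\<lambda>u. G (\<psi> u))"
  shows "continuous_on M G"
proof -
  \<comment> \<open>The case of a one-point parameter set.\<close>
  have "continuous_on ({0::real} \<times> M) (\<lambda>(s, q). G q)"
  proof (rule continuous_on_glue_param)
    fix W \<psi> assume c: "(W, \<psi>) \<in> \<A>"
    show "continuous_on ({0::real} \<times> W) (\<lambda>(s, u). G (\<psi> u))"
      unfolding split_def by (rule continuous_on_compose2[OF G[OF c] continuous_on_snd[OF continuous_on_id]]) auto
  qed
  moreover have "continuous_on M (\<lambda>q. (0::real, q))" by (intro continuous_intros)
  ultimately show ?thesis using continuous_on_compose2[of "{0::real} \<times> M" "\<lambda>(s, q). G q" M "\<lambda>q. (0, q)"] by auto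
qed

end

section \<open>Differentiation under the integral\<close>

text \<open>The mean value theorem bounds all difference quotients on \<open>K\<close> by
  \<open>C\<close>, which is integrable over \<open>K\<close> because \<open>K\<close> has finite
  measure; dominated convergence gives the limit.\<close>

lemma has_real_derivative_integral:
  fixes g g' :: "real \<Rightarrow> 'q \<Rightarrow> real"
  assumes K: "K \<in> sets \<mu>" "emeasure \<mu> K < \<infinity>" and s: "s \<in> S" "open S"
    and der: "\<And>s q. s \<in> S \<Longrightarrow> q \<in> K \<Longrightarrow> ((\<lambda>s. g s q) has_real_derivative g' s q) (at s)"
    and bd: "\<And>s q. s \<in> S \<Longrightarrow> q \<in> K \<Longrightarrow> \<bar>g' s q\<bar> \<le> C"
    and int: "\<And>s. s \<in> S \<Longrightarrow> integrable \<mu> (\<lambda>q. indicator K q * g s q)"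
  shows "((\<lambda>s. \<integral>q. indicator K q * g s q \<partial>\<mu>) has_real_derivative (\<integral>q. indicator K q * g' s q \<partial>\<mu>)) (at s)"
proof -
  obtain d where d: "d > 0" "ball s d \<subseteq> S" using s openE by blast
  have inS: "s + h \<in> S" if "\<bar>h\<bar> < d" for h using that d by (auto simp: dist_norm intro!: subsetD[OF d(2)])
  have lim: "(\<lambda>n. ((\<integral>q. indicator K q * g (s + h n) q \<partial>\<mu>) - (\<integral>q. indicator K q * g s q \<partial>\<mu>)) / h n)
     \<longlonglongrightarrow> (\<integral>q. indicator K q * g' s q \<partial>\<mu>)" if h: "\<And>n. h n \<noteq> 0" "\<And>n. \<bar>h n\<bar> < d" "h \<longlonglongrightarrow> 0" for h
  proof -
    let ?Q = "\<lambda>n q. indicator K q * ((g (s + h n) q - g s q) / h n)"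
    have Qint: "integrable \<mu> (?Q n)" for n
    proof -
      have "integrable \<mu> (\<lambda>q. (indicator K q * g (s + h n) q - indicator K q * g s q) / h n)"
        using int[OF inS[OF h(2)]] int[OF s(1)] by auto
      then show ?thesis by (simp add: algebra_simps diff_divide_distrib)
    qed
    have Qlim: "(\<lambda>n. ?Q n q) \<longlonglongrightarrow> indicator K q * g' s q" for q
    proof (cases "q \<in> K")
      case True
      have "(\<lambda>k. (g (s + k) q - g s q) / k) \<midarrow>0\<rightarrow> g' s q" using der[OF s(1) True] by (simp add: DERIV_def)
      then have "(\<lambda>n. (g (s + h n) q - g s q) / h n) \<longlonglongrightarrow> g' s q"
        using h(1,3) LIMSEQ_SEQ_conv[of 0 "\<lambda>k. (g (s + k) q - g s q) / k" "g' s q"] by blast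
      then show ?thesis using True by simp
    qed simp
    have Qbd: "norm (?Q n q) \<le> indicator K q * C" for n q
    proof (cases "q \<in> K")
      case True
      have "\<bar>g (s + h n) q - g s q\<bar> \<le> C * \<bar>s + h n - s\<bar>"
      proof -
        have "norm (g (s + h n) q - g s q) \<le> C * norm (s + h n - s)"
        proof (rule field_differentiable_bound[of "ball s d" "\<lambda>s. g s q" "\<lambda>s. g' s q"])
          show "((\<lambda>s. g s q) has_field_derivative g' t q) (at t within ball s d)" if "t \<in> ball s d" for t
            by (rule has_field_derivative_at_within[OF der[OF subsetD[OF d(2) that] True]])
          show "norm (g' t q) \<le> C" if "t \<in> ball s d" for t using bd[of t q] that d(2) True by auto
          show "s + h n \<in> ball s d" using h(2)[of n] by (simp add: dist_norm)
        qed (use d in auto)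
        then show ?thesis by simp
      qed
      then show ?thesis using True h(1)[of n] by (simp add: abs_divide pos_divide_le_eq)
    qed simp
    have "(\<lambda>n. \<integral>q. ?Q n q \<partial>\<mu>) \<longlonglongrightarrow> (\<integral>q. indicator K q * g' s q \<partial>\<mu>)"
    proof (rule integral_dominated_convergence[where w = "\<lambda>q. indicator K q * C"])
      show "?Q n \<in> borel_measurable \<mu>" for n using Qint by auto
      \<comment> \<open>The derivative inherits measurability from the difference quotients, as
        their pointwise limit.\<close>
      show "(\<lambda>q. indicator K q * g' s q) \<in> borel_measurable \<mu>"
        by (rule borel_measurable_LIMSEQ_metric[of ?Q]) (use Qint Qlim in auto)
      show "integrable \<mu> (\<lambda>q. indicator K q * C)" using K by (intro integrable_mult_left) (auto simp: integrable_indicator_iff)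
    qed (use Qlim Qbd in auto)
    moreover have "(\<integral>q. ?Q n q \<partial>\<mu>) = ((\<integral>q. indicator K q * g (s + h n) q \<partial>\<mu>) - (\<integral>q. indicator K q * g s q \<partial>\<mu>)) / h n" for n
    proof -
      have "(\<integral>q. ?Q n q \<partial>\<mu>) = (\<integral>q. (indicator K q * g (s + h n) q - indicator K q * g s q) / h n \<partial>\<mu>)"
        by (intro Bochner_Integration.integral_cong) (auto simp: algebra_simps diff_divide_distrib)
      also have "\<dots> = ((\<integral>q. indicator K q * g (s + h n) q \<partial>\<mu>) - (\<integral>q. indicator K q * g s q \<partial>\<mu>)) / h n"
        using Bochner_Integration.integral_diff[OF int[OF inS[OF h(2)]] int[OF s(1)]] by simp
      finally show ?thesis .
    qed
    ultimately show ?thesis by (simp only:)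
  qed
  show ?thesis
    unfolding DERIV_def LIMSEQ_SEQ_conv[symmetric]
  proof (intro allI impI)
    fix h :: "nat \<Rightarrow> real" assume h: "(\<forall>n. h n \<noteq> 0) \<and> h \<longlonglongrightarrow> 0"
    \<comment> \<open>Only a tail of \<open>h\<close> is known to stay within distance d of 0, so
      the sequence is shifted by \<open>N\<close>.\<close>
    then obtain N where N: "\<And>n. n \<ge> N \<Longrightarrow> \<bar>h n\<bar> < d" using d(1) LIMSEQ_D[of h 0 d] by auto
    have "(\<lambda>n. h (n + N)) \<longlonglongrightarrow> 0" using h LIMSEQ_ignore_initial_segment by blast
    from lim[OF _ _ this] h N have "(\<lambda>n. ((\<integral>q. indicator K q * g (s + h (n + N)) q \<partial>\<mu>) - (\<integral>q. indicator K q * g s q \<partial>\<mu>)) / h (n + N))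
     \<longlonglongrightarrow> (\<integral>q. indicator K q * g' s q \<partial>\<mu>)" by simp
    then show "(\<lambda>n. ((\<integral>q. indicator K q * g (s + h n) q \<partial>\<mu>) - (\<integral>q. indicator K q * g s q \<partial>\<mu>)) / h n)
     \<longlonglongrightarrow> (\<integral>q. indicator K q * g' s q \<partial>\<mu>)"
      by (rule LIMSEQ_offset)
  qed
qed

section \<open>The second variation of the density\<close>

lemma pd_add: "f differentiable (at u) \<Longrightarrow> g differentiable (at u) \<Longrightarrow> pd (\<lambda>v. f v + g v) i u = pd f i u + pd g i u"
  unfolding pd_def frechet_derivative_works
  using frechet_derivative_at[OF has_derivative_add, symmetric] by fastforce

lemma pd_bilinear:
  assumes h: "bounded_bilinear h" and f: "f differentiable (at u)" and g: "g differentiable (at u)"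
  shows "pd (\<lambda>v. h (f v) (g v)) i u = h (pd f i u) (g u) + h (f u) (pd g i u)"
proof -
  have "((\<lambda>v. h (f v) (g v)) has_derivative (\<lambda>a. h (f u) (frechet_derivative g (at u) a) + h (frechet_derivative f (at u) a) (g u))) (at u)"
    by (rule bounded_bilinear.FDERIV[OF h f[unfolded frechet_derivative_works] g[unfolded frechet_derivative_works]])
  from frechet_derivative_at[OF this, symmetric] show ?thesis by (simp add: pd_def)
qed

lemmas pd_scaleR = pd_bilinear[OF bounded_bilinear_scaleR]
  and pd_inner = pd_bilinear[OF bounded_bilinear_inner]

lemma div_drift_add:
  "f differentiable (at u) \<Longrightarrow> g differentiable (at u) \<Longrightarrow>
    div_drift T \<phi> (\<lambda>v. f v + g v) u = div_drift T \<phi> f u + div_drift T \<phi> g u"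
  by (simp add: div_drift_def pd_add inner_add_left inner_add_right distrib_left sum.distrib)

lemma div_drift_cong:
  assumes "open S" "u \<in> S" "\<And>v. v \<in> S \<Longrightarrow> f v = g v" "f differentiable (at u)"
  shows "div_drift T \<phi> f u = div_drift T \<phi> g u"
  using assms(2,3) frechet_derivative_transform_within_open[OF assms(4,1,2,3)] by (simp add: div_drift_def pd_def)

context local_immersion
begin

definition grad_half_sq :: "(real^'n \<Rightarrow> 'a) \<Rightarrow> real^'n \<Rightarrow> 'a" where
  "grad_half_sq V v = (\<Sum>i\<in>UNIV. \<Sum>j\<in>UNIV. (ginv (\<lambda>i. pd \<phi> i v) i j * (V v \<bullet> pd V j v)) *\<^sub>R pd \<phi> i v)"

text \<open>What the derivative of \<open>div_drift\<close> along a variation with velocity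
  \<open>V\<close> contains besides \<open>div_drift\<close> of the acceleration: the first term
  comes from the moving coordinate fields, the second from the inverse metric.\<close>

definition quad :: "(real^'n \<Rightarrow> 'a) \<Rightarrow> real^'n \<Rightarrow> real" where
  "quad V u = (\<Sum>i\<in>UNIV. \<Sum>j\<in>UNIV. ginv (\<lambda>i. pd \<phi> i u) i j * (pd V i u \<bullet> pd V j u) -
     (\<Sum>k\<in>UNIV. \<Sum>l\<in>UNIV. ginv (\<lambda>i. pd \<phi> i u) i k * ginv (\<lambda>i. pd \<phi> i u) j l *
        (pd V k u \<bullet> pd \<phi> l u + pd \<phi> k u \<bullet> pd V l u)) * (pd V i u \<bullet> pd \<phi> j u))"

lemma smooth_grad_half_sq: "smooth_on W V \<Longrightarrow> smooth_on W (grad_half_sq V)"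
  unfolding grad_half_sq_def[abs_def]
  by (intro smooth_intros smooth_on_ginv open_W smooth_\<phi> frame_\<phi>)

lemma smooth_div_drift: "smooth_on W Z \<Longrightarrow> smooth_on W (div_drift T \<phi> Z)"
  unfolding div_drift_def[abs_def]
  by (intro smooth_intros smooth_on_ginv open_W smooth_\<phi> frame_\<phi>)

context
  fixes V :: "real^'n \<Rightarrow> 'a"
  assumes smooth_V: "smooth_on W V" and normal_V: "\<And>u i. u \<in> W \<Longrightarrow> V u \<bullet> pd \<phi> i u = 0"
begin

lemma diff_V: "u \<in> W \<Longrightarrow> V differentiable (at u)"
  using smooth_on_differentiable[OF smooth_V] .

text \<open>The term in which \<open>a\<close> is differentiated is a multiple of \<open>V\<close>,
  which is orthogonal to the coordinate fields.\<close>

lemma div_drift_scaled_normal: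
  assumes u: "u \<in> W" and a: "smooth_on W a"
  shows "div_drift T \<phi> (\<lambda>v. a v *\<^sub>R V v) u = a u * div_drift T \<phi> V u"
proof -
  have "pd (\<lambda>v. a v *\<^sub>R V v) i u \<bullet> pd \<phi> j u = a u * (pd V i u \<bullet> pd \<phi> j u)" for i j
    by (simp add: pd_scaleR[OF smooth_on_differentiable[OF a u] diff_V[OF u]] inner_add_left normal_V[OF u])
  then show ?thesis by (simp add: div_drift_def sum_distrib_left algebra_simps)
qed

text \<open>Differentiate <V, d_j phi> = 0. The result is minus a component of <A, V>, and so is
  symmetric in i and j.\<close>

lemma normal_pd_inner:
  assumes u: "u \<in> W" shows "pd V i u \<bullet> pd \<phi> j u = - (V u \<bullet> pd (pd \<phi> j) i u)"
proof -
  have "pd (\<lambda>v. V v \<bullet> pd \<phi> j v) i u = pd (\<lambda>v. 0::real) i u"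
    by (rule pd_cong[OF _ u smooth_on_differentiable[OF smooth_on_inner[OF open_W smooth_V smooth_on_pd[OF smooth_\<phi>]] u]])
      (simp add: normal_V)
  then have "pd V i u \<bullet> pd \<phi> j u + V u \<bullet> pd (pd \<phi> j) i u = 0"
    by (simp add: pd_inner[OF diff_V[OF u] smooth_on_differentiable[OF smooth_on_pd[OF smooth_\<phi>] u]]) (simp add: pd_def)
  then show ?thesis by simp
qed

lemma normal_pd_inner_sym:
  "u \<in> W \<Longrightarrow> pd V i u \<bullet> pd \<phi> j u = pd V j u \<bullet> pd \<phi> i u"
  by (simp add: normal_pd_inner pd_commute[OF open_W smooth_\<phi>, of u i j])

lemma grad_half_sq_inner: "u \<in> W \<Longrightarrow> grad_half_sq V u \<bullet> pd \<phi> k u = V u \<bullet> pd V k u"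
  unfolding grad_half_sq_def by (rule ginv_sum_inner[OF frame_\<phi>])

lemma normal_inner_nor_proj: "u \<in> W \<Longrightarrow> V u \<bullet> nor_proj \<phi> u v = V u \<bullet> v"
  by (rule nor_proj_inner_normal) (auto simp: normal_V)

text \<open>Both sides see only the tangential part of \<open>y\<close>, and projecting the
  derivatives of \<open>V\<close> to the normal space changes nothing after pairing with
  \<open>V\<close>.\<close>

lemma grad_half_sq_inner_any:
  assumes u: "u \<in> W" shows "grad_half_sq V u \<bullet> y = V u \<bullet> nor_deriv \<phi> V u y"
  unfolding grad_half_sq_def nor_deriv_def inner_sum_left inner_sum_right inner_scaleR_left inner_scaleR_right normal_inner_nor_proj[OF u]
  by (subst sum.swap) (simp add: ginv_sym[OF frame_\<phi>[OF u]] inner_commute mult.commute mult.left_commute)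

text \<open>The covariant components of \<open>grad_half_sq V\<close> are <V, nabla_k V> with the
  normal connection. Their derivatives split into <nabla_i V, nabla_k V> and a term with the second
  covariant derivative, and the trace is taken.\<close>

lemma div_drift_grad_half_sq:
  assumes u: "u \<in> W"
  shows "div_drift T \<phi> (grad_half_sq V) u = V u \<bullet> nor_deriv \<phi> V u T +
    (\<Sum>i\<in>UNIV. \<Sum>j\<in>UNIV. ginv (\<lambda>i. pd \<phi> i u) i j * (nor_proj \<phi> u (pd V i u) \<bullet> nor_proj \<phi> u (pd V j u)))
    + V u \<bullet> (\<Sum>i\<in>UNIV. \<Sum>j\<in>UNIV. ginv (\<lambda>i. pd \<phi> i u) i j *\<^sub>R second_nor V i j u)"
proof -
  have key: "pd (grad_half_sq V) i u \<bullet> pd \<phi> k u = nor_proj \<phi> u (pd V i u) \<bullet> nor_proj \<phi> u (pd V k u) + V u \<bullet> second_nor V i k u" for i k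
  proof -
    let ?w = "\<lambda>v. nor_proj \<phi> v (pd V k v)"
    have sw: "smooth_on W ?w" by (rule smooth_nor_proj[OF smooth_on_pd[OF smooth_V]])
    have sG: "smooth_on W (\<lambda>v. grad_half_sq V v \<bullet> pd \<phi> k v)"
      by (intro smooth_intros open_W smooth_grad_half_sq smooth_V smooth_\<phi>)
    \<comment> \<open>When the derivative on the left falls on \<open>pd \<phi> k\<close>,
      \<open>grad_half_sq_inner_any\<close> turns it into the correction term of
      \<open>second_nor\<close>.\<close>
    have "pd (\<lambda>v. grad_half_sq V v \<bullet> pd \<phi> k v) i u = pd (\<lambda>v. V v \<bullet> ?w v) i u"
      by (rule pd_cong[OF _ u smooth_on_differentiable[OF sG u]]) (simp add: grad_half_sq_inner normal_inner_nor_proj)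
    then have "pd (grad_half_sq V) i u \<bullet> pd \<phi> k u + grad_half_sq V u \<bullet> pd (pd \<phi> k) i u = pd V i u \<bullet> ?w u + V u \<bullet> pd ?w i u"
      by (simp add: pd_inner[OF smooth_on_differentiable[OF smooth_grad_half_sq[OF smooth_V] u] smooth_on_differentiable[OF smooth_on_pd[OF smooth_\<phi>] u]]
         pd_inner[OF diff_V[OF u] smooth_on_differentiable[OF sw u]])
    moreover have "pd V i u \<bullet> ?w u = nor_proj \<phi> u (pd V i u) \<bullet> ?w u"
      using nor_proj_inner_normal[OF u, of "?w u" "pd V i u", OF nor_proj_inner[OF u]] by (simp add: inner_commute)
    moreover have "V u \<bullet> pd ?w i u = V u \<bullet> nor_proj \<phi> u (pd ?w i u)" by (simp add: normal_inner_nor_proj[OF u])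
    ultimately show ?thesis by (simp add: grad_half_sq_inner_any[OF u] second_nor_def inner_diff_right)
  qed
  show ?thesis
    by (simp add: div_drift_def key inner_commute[of T] grad_half_sq_inner_any[OF u] inner_sum_right distrib_left sum.distrib)
qed

text \<open>The derivatives of \<open>V\<close> split orthogonally into their normal parts and
  tangential parts described by <A, V>. With S = |<A, V>|^2 the latter contribute S through the
  first term of \<open>quad\<close> and -2 S through the derivative of the inverse metric.\<close>

lemma quad_eq:
  assumes u: "u \<in> W"
  shows "quad V u = (\<Sum>i\<in>UNIV. \<Sum>j\<in>UNIV. ginv (\<lambda>i. pd \<phi> i u) i j * (nor_proj \<phi> u (pd V i u) \<bullet> nor_proj \<phi> u (pd V j u)))
     - V u \<bullet> AVA \<phi> V u"
proof -
  let ?e = "\<lambda>i. pd \<phi> i u"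
  let ?g = "ginv ?e" and ?B = "\<lambda>i j. pd V i u \<bullet> pd \<phi> j u" and ?w = "\<lambda>i. nor_proj \<phi> u (pd V i u)"
  define S where "S = (\<Sum>i\<in>UNIV. \<Sum>j\<in>UNIV. \<Sum>k\<in>UNIV. \<Sum>l\<in>UNIV. ?g i k * ?g j l * ?B i j * ?B k l)"
  have VAVA: "V u \<bullet> AVA \<phi> V u = S"
  proof -
    have "V u \<bullet> nor_proj \<phi> u (pd (pd \<phi> j) i u) = - ?B i j" for i j
      by (simp add: normal_inner_nor_proj[OF u] normal_pd_inner[OF u])
    then show ?thesis
      unfolding AVA_def S_def inner_sum_right by (simp add: sff_pd[OF u] inv_metric_ginv inner_commute[of _ "V u"])
  qed
  have split: "pd V i u \<bullet> pd V j u = ?w i \<bullet> ?w j + (\<Sum>k\<in>UNIV. \<Sum>l\<in>UNIV. ?g k l * ?B i k * ?B j l)" for i j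
  proof -
    have d: "pd V i u = ?w i + tproj ?e (pd V i u)" for i by (simp add: nor_proj_eq[OF u])
    have t: "tproj ?e x \<bullet> y = (\<Sum>k\<in>UNIV. \<Sum>l\<in>UNIV. ?g k l * (x \<bullet> ?e l) * (?e k \<bullet> y))" for x y
      by (simp add: tproj_def inner_sum_left)
    have "?w i \<bullet> tproj ?e (pd V j u) = 0"
      by (simp add: inner_commute[of "?w i"] t nor_proj_inner[OF u] inner_commute[of "?e _" "?w i"])
    moreover have "tproj ?e (pd V i u) \<bullet> ?w j = 0"
      by (simp add: t nor_proj_inner[OF u] inner_commute[of "?e _" "?w j"])
    moreover have "tproj ?e (pd V i u) \<bullet> tproj ?e (pd V j u) = (\<Sum>k\<in>UNIV. \<Sum>l\<in>UNIV. ?g k l * ?B i k * ?B j l)"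
    proof -
      have "?e k \<bullet> tproj ?e (pd V j u) = ?B j k" for k
        using tproj_inner[OF frame_\<phi>[OF u]] by (simp add: inner_commute[of "?e k"])
      then have "tproj ?e (pd V i u) \<bullet> tproj ?e (pd V j u) = (\<Sum>k\<in>UNIV. \<Sum>l\<in>UNIV. ?g k l * ?B i l * ?B j k)"
        by (simp add: t)
      then show ?thesis by (subst (asm) sum.swap) (simp add: ginv_sym[OF frame_\<phi>[OF u]])
    qed
    ultimately show ?thesis by (subst d, subst (2) d) (simp add: inner_add_left inner_add_right)
  qed
  have 1: "(\<Sum>i\<in>UNIV. \<Sum>j\<in>UNIV. ?g i j * (pd V i u \<bullet> pd V j u)) = (\<Sum>i\<in>UNIV. \<Sum>j\<in>UNIV. ?g i j * (?w i \<bullet> ?w j)) + S"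
  proof -
    have "(\<Sum>i\<in>UNIV. \<Sum>j\<in>UNIV. ?g i j * (\<Sum>k\<in>UNIV. \<Sum>l\<in>UNIV. ?g k l * ?B i k * ?B j l)) =
      (\<Sum>i\<in>UNIV. \<Sum>j\<in>UNIV. \<Sum>k\<in>UNIV. \<Sum>l\<in>UNIV. ?g i j * ?g k l * ?B i k * ?B j l)"
      by (simp add: sum_distrib_left mult.assoc)
    also have "\<dots> = S" unfolding S_def by (rule sum.cong[OF refl], rule sum.swap)
    finally show ?thesis unfolding split by (simp add: distrib_left sum.distrib)
  qed
  \<comment> \<open>The two summands agree because <A, V> is symmetric; this is the origin of the
    factor 2.\<close>
  have 2: "(\<Sum>i\<in>UNIV. \<Sum>j\<in>UNIV. (\<Sum>k\<in>UNIV. \<Sum>l\<in>UNIV. ?g i k * ?g j l * (pd V k u \<bullet> pd \<phi> l u + pd \<phi> k u \<bullet> pd V l u)) * ?B i j) = 2 * S"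
  proof -
    have "pd V k u \<bullet> pd \<phi> l u + pd \<phi> k u \<bullet> pd V l u = 2 * ?B k l" for k l
      using normal_pd_inner_sym[OF u, of l k] by (simp add: inner_commute[of "pd \<phi> k u"])
    then show ?thesis unfolding S_def by (simp add: sum_distrib_left sum_distrib_right mult.commute mult.left_commute)
  qed
  show ?thesis unfolding quad_def VAVA by (simp add: sum_subtractf 1 2)
qed

text \<open>Linearity of \<open>div_drift\<close> distributes the acceleration over its two
  projections. The square is absorbed by \<open>div_drift_scaled_normal\<close>, and the normal
  gradient terms of \<open>quad_eq\<close> and \<open>div_drift_grad_half_sq\<close> cancel.\<close>

lemma density_second_variation:
  assumes u: "u \<in> W" and Z: "smooth_on W Z"
  shows "(div_drift T \<phi> V u)\<^sup>2 + div_drift T \<phi> Z u + quad V u =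
    div_drift T \<phi> (\<lambda>v. nor_proj \<phi> v (Z v) + div_drift T \<phi> V v *\<^sub>R V v) u
    + div_drift T \<phi> (\<lambda>v. tan_proj \<phi> v (Z v) + grad_half_sq V v) u - V u \<bullet> L_local T \<phi> V u"
proof -
  have sn: "smooth_on W (\<lambda>v. nor_proj \<phi> v (Z v))" by (rule smooth_nor_proj[OF Z])
  have st: "smooth_on W (\<lambda>v. tan_proj \<phi> v (Z v))"
    by (rule smooth_on_cong[OF open_W _ smooth_tproj[OF Z]]) (simp add: tan_proj_eq)
  have sf: "smooth_on W (\<lambda>v. div_drift T \<phi> V v *\<^sub>R V v)"
    by (intro smooth_on_scaleR open_W smooth_div_drift smooth_V)
  note D = smooth_on_differentiable[OF _ u]
  have 1: "div_drift T \<phi> (\<lambda>v. nor_proj \<phi> v (Z v) + div_drift T \<phi> V v *\<^sub>R V v) u =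
     div_drift T \<phi> (\<lambda>v. nor_proj \<phi> v (Z v)) u + (div_drift T \<phi> V u)\<^sup>2"
    by (simp add: div_drift_add[OF D[OF sn] D[OF sf]] div_drift_scaled_normal[OF u smooth_div_drift[OF smooth_V]] power2_eq_square)
  have 2: "div_drift T \<phi> (\<lambda>v. tan_proj \<phi> v (Z v) + grad_half_sq V v) u =
     div_drift T \<phi> (\<lambda>v. tan_proj \<phi> v (Z v)) u + div_drift T \<phi> (grad_half_sq V) u"
    by (rule div_drift_add[OF D[OF st] D[OF smooth_grad_half_sq[OF smooth_V]]])
  have 3: "div_drift T \<phi> Z u = div_drift T \<phi> (\<lambda>v. nor_proj \<phi> v (Z v)) u + div_drift T \<phi> (\<lambda>v. tan_proj \<phi> v (Z v)) u"
    using div_drift_add[OF D[OF sn] D[OF st], of T \<phi>] by (simp add: nor_proj_def)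
  show ?thesis
    unfolding 1 2 3 quad_eq[OF u] div_drift_grad_half_sq[OF u] L_local_eq[OF u smooth_V]
    by (simp add: inner_add_right)
qed

end

end

section \<open>Variations\<close>

text \<open>All derivatives of slices are values of one joint derivative in the directions (1, 0)
  and (0, axis i 1), so their smoothness and commutation can be taken from the joint map.\<close>

lemma slice_derivatives:
  fixes F :: "real \<Rightarrow> real^'n::finite \<Rightarrow> 'a::euclidean_space"
  assumes F: "(\<lambda>(s, u). F s u) differentiable (at (s, u))"
  shows "((\<lambda>t. F t u) has_vector_derivative frechet_derivative (\<lambda>(s, u). F s u) (at (s, u)) (1, 0)) (at s)"
    and "F s differentiable (at u)" and "pd (F s) i u = frechet_derivative (\<lambda>(s, u). F s u) (at (s, u)) (0, axis i 1)"
proof -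
  let ?F = "\<lambda>(s, u). F s u"
  have D: "(?F has_derivative frechet_derivative ?F (at (s, u))) (at (s, u))"
    using F by (simp add: frechet_derivative_works)
  have "((\<lambda>t. (t, u)) has_derivative (\<lambda>h. (h, 0))) (at s)" by (auto intro!: derivative_eq_intros)
  from has_derivative_compose[OF this D] have E1: "((\<lambda>t. F t u) has_derivative (\<lambda>h. frechet_derivative ?F (at (s, u)) (h, 0))) (at s)"
    by simp
  have "h *\<^sub>R frechet_derivative ?F (at (s, u)) (1, 0) = frechet_derivative ?F (at (s, u)) (h, 0)" for h
    using linear_cmul[OF has_derivative_linear[OF D], of h "(1, 0)"] by simp
  then have eq: "(\<lambda>h. h *\<^sub>R frechet_derivative ?F (at (s, u)) (1, 0)) = (\<lambda>h. frechet_derivative ?F (at (s, u)) (h, 0))"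
    by (rule ext)
  show "((\<lambda>t. F t u) has_vector_derivative frechet_derivative ?F (at (s, u)) (1, 0)) (at s)"
    unfolding has_vector_derivative_def eq by (rule E1)
  have "((\<lambda>v. (s, v)) has_derivative (\<lambda>h. (0, h))) (at u)" by (auto intro!: derivative_eq_intros)
  from has_derivative_compose[OF this D] have E: "(F s has_derivative (\<lambda>h. frechet_derivative ?F (at (s, u)) (0, h))) (at u)"
    by simp
  then show "F s differentiable (at u)" by (auto simp: differentiable_def)
  show "pd (F s) i u = frechet_derivative ?F (at (s, u)) (0, axis i 1)"
    unfolding pd_def using frechet_derivative_at[OF E] by metis
qed

text \<open>The derivative in the variation parameter with the point held fixed. The result is again
  a family indexed by the parameter, so the operation can be iterated: \<open>sd (sd Y) 0\<close> is
  the acceleration.\<close>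

definition sd :: "(real \<Rightarrow> 'b \<Rightarrow> 'a::real_normed_vector) \<Rightarrow> real \<Rightarrow> 'b \<Rightarrow> 'a" where
  "sd F s u = vector_derivative (\<lambda>t. F t u) (at s)"

context
  fixes F :: "real \<Rightarrow> real^'n::finite \<Rightarrow> 'a::euclidean_space" and S :: "real set" and W :: "(real^'n) set"
  assumes S: "open S" and W: "open W" and F: "smooth_on (S \<times> W) (\<lambda>(s, u). F s u)"
begin

lemma open_SW: "open (S \<times> W)" using S W by (rule open_Times)

lemma diff_F: "s \<in> S \<Longrightarrow> u \<in> W \<Longrightarrow> (\<lambda>(s, u). F s u) differentiable (at (s, u))"
  using smooth_on_differentiable[OF F] by auto

lemma sd_eq: "s \<in> S \<Longrightarrow> u \<in> W \<Longrightarrow> sd F s u = frechet_derivative (\<lambda>(s, u). F s u) (at (s, u)) (1, 0)"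
  unfolding sd_def by (rule vector_derivative_at) (rule slice_derivatives[OF diff_F])

lemma has_sd: "s \<in> S \<Longrightarrow> u \<in> W \<Longrightarrow> ((\<lambda>t. F t u) has_vector_derivative sd F s u) (at s)"
  unfolding sd_eq by (rule slice_derivatives[OF diff_F])

lemma smooth_sd: "smooth_on (S \<times> W) (\<lambda>(s, u). sd F s u)"
  by (rule smooth_on_cong[OF open_SW _ smooth_on_frechet[OF F, of "(1, 0)"]]) (auto simp: sd_eq)

lemma smooth_pd_slice: "smooth_on (S \<times> W) (\<lambda>(s, u). pd (F s) i u)"
  by (rule smooth_on_cong[OF open_SW _ smooth_on_frechet[OF F, of "(0, axis i 1)"]]) (auto simp: slice_derivatives[OF diff_F])

lemma smooth_slice: "s \<in> S \<Longrightarrow> smooth_on W (F s)"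
  using smooth_on_compose[OF W open_SW _ smooth_on_Pair[OF W smooth_on_const smooth_on_ident[OF W]] F, of s] by auto

text \<open>Symmetry of the second derivative of the joint map, taken in the directions (1, 0) and
  (0, axis i 1).\<close>

lemma pd_sd:
  assumes s: "s \<in> S" and u: "u \<in> W"
  shows "((\<lambda>t. pd (F t) i u) has_vector_derivative pd (sd F s) i u) (at s)"
proof -
  let ?F = "\<lambda>(s, u). F s u"
  let ?P = "\<lambda>(s, u). pd (F s) i u" and ?D = "\<lambda>(s, u). sd F s u"
  have su: "(s, u) \<in> S \<times> W" using s u by simp
  have 1: "((\<lambda>t. pd (F t) i u) has_vector_derivative frechet_derivative ?P (at (s, u)) (1, 0)) (at s)"
    by (rule slice_derivatives(1)[OF smooth_on_differentiable[OF smooth_pd_slice su]])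
  have 2: "pd (sd F s) i u = frechet_derivative ?D (at (s, u)) (0, axis i 1)"
    by (rule slice_derivatives(3)[OF smooth_on_differentiable[OF smooth_sd su]])
  have 3: "frechet_derivative (\<lambda>y. frechet_derivative ?F (at y) (0, axis i 1)) (at (s, u)) = frechet_derivative ?P (at (s, u))"
    by (rule frechet_derivative_transform_within_open[OF smooth_on_differentiable[OF smooth_on_frechet[OF F] su] open_SW su])
      (auto simp: slice_derivatives[OF diff_F])
  have 4: "frechet_derivative (\<lambda>y. frechet_derivative ?F (at y) (1, 0)) (at (s, u)) = frechet_derivative ?D (at (s, u))"
    by (rule frechet_derivative_transform_within_open[OF smooth_on_differentiable[OF smooth_on_frechet[OF F] su] open_SW su])
      (auto simp: sd_eq)
  show ?thesis using 1 unfolding 2 3[symmetric] 4[symmetric] frechet_commute[OF open_SW F su, of "(0, axis i 1)"] .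
qed

end

context
  fixes F :: "real \<Rightarrow> real^'n::finite \<Rightarrow> 'a::euclidean_space" and S :: "real set" and W :: "(real^'n) set"
  assumes S: "open S" and W: "open W" and F: "smooth_on (S \<times> W) (\<lambda>(s, u). F s u)"
    and frame_F: "\<And>s u. s \<in> S \<Longrightarrow> u \<in> W \<Longrightarrow> frame (\<lambda>i. pd (F s) i u)"
begin

lemma density_derivative:
  assumes s: "s \<in> S" and u: "u \<in> W"
  shows "((\<lambda>t. exp (T \<bullet> F t u) * sqrt (det (gram (\<lambda>i. pd (F t) i u)))) has_real_derivative
     exp (T \<bullet> F s u) * sqrt (det (gram (\<lambda>i. pd (F s) i u))) * div_drift T (F s) (sd F s) u) (at s)"
proof -
  have "((\<lambda>t. T \<bullet> F t u) has_real_derivative T \<bullet> sd F s u) (at s)"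
    using bounded_linear.has_vector_derivative[OF bounded_linear_inner_right has_sd[OF S W F s u]]
    by (simp add: has_real_derivative_iff_has_vector_derivative)
  then have "((\<lambda>t. exp (T \<bullet> F t u)) has_real_derivative exp (T \<bullet> F s u) * (T \<bullet> sd F s u)) (at s)"
    by (auto intro!: derivative_eq_intros)
  from DERIV_mult[OF this has_real_derivative_sqrt_det_gram[of "\<lambda>t i. pd (F t) i u", OF pd_sd[OF S W F s u] frame_F[OF s u]]]
  show ?thesis by (simp add: div_drift_def algebra_simps)
qed

lemma div_drift_derivative:
  assumes s: "s \<in> S" and u: "u \<in> W"
  shows "((\<lambda>t. div_drift T (F t) (sd F t) u) has_real_derivative
     div_drift T (F s) (sd (sd F) s) u + local_immersion.quad (F s) (sd F s) u) (at s)"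
proof -
  interpret L: local_immersion W "F s"
    by unfold_locales (use W smooth_slice[OF S W F s] frame_F[OF s] in auto)
  note sF = smooth_sd[OF S W F]
  let ?e = "\<lambda>t i. pd (F t) i u" and ?z = "\<lambda>t i. pd (sd F t) i u"
  have 1: "((\<lambda>t. T \<bullet> sd F t u) has_real_derivative T \<bullet> sd (sd F) s u) (at s)"
    using bounded_linear.has_vector_derivative[OF bounded_linear_inner_right has_sd[OF S W sF s u]]
    by (simp add: has_real_derivative_iff_has_vector_derivative)
  have 2: "((\<lambda>t. ?z t i \<bullet> ?e t j) has_real_derivative ?z s i \<bullet> ?z s j + pd (sd (sd F) s) i u \<bullet> ?e s j) (at s)" for i j
    unfolding has_real_derivative_iff_has_vector_derivative
    using bounded_bilinear.has_vector_derivative[OF bounded_bilinear_inner pd_sd[OF S W sF s u] pd_sd[OF S W F s u]] by simp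
  have 3: "((\<lambda>t. ginv (?e t) i j) has_real_derivative
     - (\<Sum>k\<in>UNIV. \<Sum>l\<in>UNIV. ginv (?e s) i k * ginv (?e s) j l * (?z s k \<bullet> ?e s l + ?e s k \<bullet> ?z s l))) (at s)" for i j
    by (rule has_real_derivative_ginv[OF pd_sd[OF S W F s u] S s frame_F[OF _ u]])
  have "((\<lambda>t. div_drift T (F t) (sd F t) u) has_real_derivative T \<bullet> sd (sd F) s u +
     (\<Sum>i\<in>UNIV. \<Sum>j\<in>UNIV. - (\<Sum>k\<in>UNIV. \<Sum>l\<in>UNIV. ginv (?e s) i k * ginv (?e s) j l * (?z s k \<bullet> ?e s l + ?e s k \<bullet> ?z s l)) * (?z s i \<bullet> ?e s j)
       + (?z s i \<bullet> ?z s j + pd (sd (sd F) s) i u \<bullet> ?e s j) * ginv (?e s) i j)) (at s)"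
    unfolding div_drift_def by (intro DERIV_add 1 DERIV_sum DERIV_mult 2 3)
  then show ?thesis
    by (rule DERIV_cong) (simp add: div_drift_def L.quad_def sum_subtractf sum.distrib sum_negf algebra_simps)
qed

lemma smooth_slice_ginv: "smooth_on (S \<times> W) (\<lambda>x. ginv (\<lambda>i. pd (F (fst x)) i (snd x)) i j)"
  by (rule smooth_on_ginv[OF open_Times[OF S W]])
    (use smooth_pd_slice[OF S W F] frame_F in \<open>auto simp: split_def\<close>)

lemma smooth_slice_div_drift:
  assumes Z: "smooth_on (S \<times> W) (\<lambda>(s, u). Z s u)"
  shows "smooth_on (S \<times> W) (\<lambda>(s, u). div_drift T (F s) (Z s) u)"
  unfolding div_drift_def split_def
  by (intro smooth_intros smooth_slice_ginv open_Times S W)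
    (use Z smooth_pd_slice[OF S W F] smooth_pd_slice[OF S W Z] in \<open>auto simp: split_def\<close>)

lemma smooth_slice_quad:
  assumes Z: "smooth_on (S \<times> W) (\<lambda>(s, u). Z s u)"
  shows "smooth_on (S \<times> W) (\<lambda>(s, u). local_immersion.quad (F s) (Z s) u)"
proof -
  let ?q = "\<lambda>x. \<Sum>i\<in>UNIV. \<Sum>j\<in>UNIV. ginv (\<lambda>i. pd (F (fst x)) i (snd x)) i j * (pd (Z (fst x)) i (snd x) \<bullet> pd (Z (fst x)) j (snd x)) -
     (\<Sum>k\<in>UNIV. \<Sum>l\<in>UNIV. ginv (\<lambda>i. pd (F (fst x)) i (snd x)) i k * ginv (\<lambda>i. pd (F (fst x)) i (snd x)) j l *
        (pd (Z (fst x)) k (snd x) \<bullet> pd (F (fst x)) l (snd x) + pd (F (fst x)) k (snd x) \<bullet> pd (Z (fst x)) l (snd x))) * (pd (Z (fst x)) i (snd x) \<bullet> pd (F (fst x)) j (snd x))"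
  have "smooth_on (S \<times> W) ?q"
    by (intro smooth_intros smooth_slice_ginv open_Times S W)
      (use smooth_pd_slice[OF S W F] smooth_pd_slice[OF S W Z] in \<open>auto simp: split_def\<close>)
  \<comment> \<open>\<open>quad\<close> belongs to a locale and unfolds only where
    \<open>F s\<close> is known to be an immersion, so the comparison is made pointwise over
    \<open>S \<times> W\<close>.\<close>
  moreover have "?q x = (case x of (s, u) \<Rightarrow> local_immersion.quad (F s) (Z s) u)" if "x \<in> S \<times> W" for x
  proof -
    obtain s u where x: "x = (s, u)" "s \<in> S" "u \<in> W" using \<open>x \<in> S \<times> W\<close> by auto
    interpret L: local_immersion W "F s"
      by unfold_locales (use W smooth_slice[OF S W F x(2)] frame_F[OF x(2)] in auto)
    show ?thesis by (simp add: x L.quad_def)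
  qed
  ultimately show ?thesis using smooth_on_cong[OF open_Times[OF S W], of ?q] by blast
qed

lemma continuous_slice_det: "continuous_on (S \<times> W) (\<lambda>(s, u). det (gram (\<lambda>i. pd (F s) i u)))"
  unfolding split_def
  by (intro smooth_on_continuous smooth_on_det_gram open_Times S W)
    (use smooth_pd_slice[OF S W F] in \<open>auto simp: split_def\<close>)

end

section \<open>Fields on the manifold and comparison of volume densities\<close>

context smooth_manifold
begin

definition smooth_field :: "('m \<Rightarrow> 'b::real_normed_vector) \<Rightarrow> bool" where
  "smooth_field f \<longleftrightarrow> (\<forall>(W,\<psi>)\<in>\<A>. smooth_on W (f \<circ> \<psi>))"

text \<open>The cut-off functions of the divergence theorem are only C^1, and \<open>Div\<close> has
  to make sense for fields multiplied by them.\<close>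

definition C1_field :: "('m \<Rightarrow> 'b::real_normed_vector) \<Rightarrow> bool" where
  "C1_field f \<longleftrightarrow> (\<forall>(W,\<psi>)\<in>\<A>. diff_times_on 1 W (f \<circ> \<psi>))"

lemma smooth_fieldD: "smooth_field f \<Longrightarrow> (W, \<psi>) \<in> \<A> \<Longrightarrow> smooth_on W (f \<circ> \<psi>)"
  unfolding smooth_field_def by blast

lemma C1_fieldD: "C1_field f \<Longrightarrow> (W, \<psi>) \<in> \<A> \<Longrightarrow> diff_times_on 1 W (f \<circ> \<psi>)"
  unfolding C1_field_def by blast

lemma C1_field_differentiable: "C1_field f \<Longrightarrow> (W, \<psi>) \<in> \<A> \<Longrightarrow> u \<in> W \<Longrightarrow> (f \<circ> \<psi>) differentiable (at u)"
  using C1_fieldD[of f W \<psi>] by simp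

lemma smooth_field_C1: "smooth_field f \<Longrightarrow> C1_field f"
  unfolding smooth_field_def C1_field_def smooth_on_def by blast

end

context submanifold
begin

lemma local_immersion_chart: "(W, \<psi>) \<in> \<A> \<Longrightarrow> local_immersion W (X \<circ> \<psi>)"
  by unfold_locales (auto simp: chart_open imm_smooth imm_frame)

lemma chart_change_charts:
  assumes c1: "(W1, \<psi>1) \<in> \<A>" and c2: "(W2, \<psi>2) \<in> \<A>"
  shows "chart_change (overlap W1 \<psi>1 W2 \<psi>2) (X \<circ> \<psi>1) W2 (X \<circ> \<psi>2) (trans_map \<psi>1 W2 \<psi>2)"
proof -
  have O: "overlap W1 \<psi>1 W2 \<psi>2 \<subseteq> W1" by (auto simp: overlap_def)
  interpret A: local_immersion W1 "X \<circ> \<psi>1" by (rule local_immersion_chart[OF c1])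
  interpret B: local_immersion W2 "X \<circ> \<psi>2" by (rule local_immersion_chart[OF c2])
  show ?thesis
  proof unfold_locales
    show "open (overlap W1 \<psi>1 W2 \<psi>2)" by (rule overlap_open[OF c1 c2])
    show "smooth_on (overlap W1 \<psi>1 W2 \<psi>2) (X \<circ> \<psi>1)" by (rule smooth_on_subset[OF imm_smooth[OF c1] O])
    show "frame (\<lambda>i. pd (X \<circ> \<psi>1) i u)" if "u \<in> overlap W1 \<psi>1 W2 \<psi>2" for u
      using A.frame_\<phi> that O by blast
    show "smooth_on (overlap W1 \<psi>1 W2 \<psi>2) (trans_map \<psi>1 W2 \<psi>2)" by (rule trans_map_smooth[OF c1 c2])
  qed (use trans_map_in[OF c1 c2] trans_map_eq[OF c1 c2] in auto)
qed

lemma chart_indepI: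
  assumes "\<And>W1 \<psi>1 W2 \<psi>2 u. \<lbrakk>(W1, \<psi>1) \<in> \<A>; (W2, \<psi>2) \<in> \<A>; u \<in> overlap W1 \<psi>1 W2 \<psi>2\<rbrakk> \<Longrightarrow> f \<psi>1 u = f \<psi>2 (trans_map \<psi>1 W2 \<psi>2 u)"
  shows "chart_indep f"
  unfolding chart_indep_def
proof (clarify)
  fix W1 \<psi>1 W2 \<psi>2 u1 u2 assume *: "(W1, \<psi>1) \<in> \<A>" "(W2, \<psi>2) \<in> \<A>" "u1 \<in> W1" "u2 \<in> W2" "\<psi>1 u1 = \<psi>2 u2"
  have "trans_map \<psi>1 W2 \<psi>2 u1 = u2" by (rule trans_map_unique) (use * in auto)
  moreover have "u1 \<in> overlap W1 \<psi>1 W2 \<psi>2" using * by (auto simp: overlap_def)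
  ultimately show "f \<psi>1 u1 = f \<psi>2 u2" using assms[OF *(1,2)] by metis
qed

lemma chart_indepD:
  assumes "chart_indep f" "(W1, \<psi>1) \<in> \<A>" "(W2, \<psi>2) \<in> \<A>" "u1 \<in> W1" "u2 \<in> W2" "\<psi>1 u1 = \<psi>2 u2"
  shows "f \<psi>1 u1 = f \<psi>2 u2"
proof -
  have "\<forall>(W2,\<psi>2)\<in>\<A>. \<forall>u1\<in>W1. \<forall>u2\<in>W2. \<psi>1 u1 = \<psi>2 u2 \<longrightarrow> f \<psi>1 u1 = f \<psi>2 u2"
    using assms(1,2) unfolding chart_indep_def by blast
  then have "\<forall>u1\<in>W1. \<forall>u2\<in>W2. \<psi>1 u1 = \<psi>2 u2 \<longrightarrow> f \<psi>1 u1 = f \<psi>2 u2" using assms(3) by blast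
  then show ?thesis using assms(4-6) by blast
qed

lemma chart_indep_div_drift:
  assumes Z: "C1_field Z"
  shows "chart_indep (\<lambda>\<psi>. div_drift T (X \<circ> \<psi>) (Z \<circ> \<psi>))"
proof (rule chart_indepI)
  fix W1 \<psi>1 W2 \<psi>2 u assume c: "(W1, \<psi>1) \<in> \<A>" "(W2, \<psi>2) \<in> \<A>" and u: "u \<in> overlap W1 \<psi>1 W2 \<psi>2"
  interpret C: chart_change "overlap W1 \<psi>1 W2 \<psi>2" "X \<circ> \<psi>1" W2 "X \<circ> \<psi>2" "trans_map \<psi>1 W2 \<psi>2"
    by (rule chart_change_charts[OF c])
  show "div_drift T (X \<circ> \<psi>1) (Z \<circ> \<psi>1) u = div_drift T (X \<circ> \<psi>2) (Z \<circ> \<psi>2) (trans_map \<psi>1 W2 \<psi>2 u)"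
    by (rule C.div_drift_change[OF u C1_field_differentiable[OF Z c(2) trans_map_in[OF c u]]]) (use trans_map_eq[OF c] in auto)
qed

text \<open>The description under \<open>THE\<close> is solvable because \<open>L_local\<close> is
  chart independent, and the solution is unique because the point lies in some chart.\<close>

lemma L_op_eq:
  assumes V: "smooth_field V" and c: "(W, \<psi>) \<in> \<A>" and u: "u \<in> W"
  shows "L_op T \<A> X V (\<psi> u) = L_local T (X \<circ> \<psi>) (V \<circ> \<psi>) u"
proof -
  have "chart_indep (\<lambda>\<psi>. L_local T (X \<circ> \<psi>) (V \<circ> \<psi>))"
  proof (rule chart_indepI)
    fix W1 \<psi>1 W2 \<psi>2 u assume c: "(W1, \<psi>1) \<in> \<A>" "(W2, \<psi>2) \<in> \<A>" and u: "u \<in> overlap W1 \<psi>1 W2 \<psi>2"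
    interpret C: chart_change "overlap W1 \<psi>1 W2 \<psi>2" "X \<circ> \<psi>1" W2 "X \<circ> \<psi>2" "trans_map \<psi>1 W2 \<psi>2"
      by (rule chart_change_charts[OF c])
    show "L_local T (X \<circ> \<psi>1) (V \<circ> \<psi>1) u = L_local T (X \<circ> \<psi>2) (V \<circ> \<psi>2) (trans_map \<psi>1 W2 \<psi>2 u)"
      by (rule C.L_local_change[OF smooth_fieldD[OF V c(2)] _ u]) (use trans_map_eq[OF c] in auto)
  qed
  then have *: "L_local T (X \<circ> \<psi>) (V \<circ> \<psi>) u = L_local T (X \<circ> \<psi>') (V \<circ> \<psi>') u'" if "(W', \<psi>') \<in> \<A>" "u' \<in> W'" "\<psi>' u' = \<psi> u" for W' \<psi>' u'
    by (rule chart_indepD[OF _ c that(1) u that(2) that(3)[symmetric]])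
  show ?thesis
    unfolding L_op_def
  proof (rule the_equality)
    show "\<forall>(W', \<psi>')\<in>\<A>. \<forall>u'\<in>W'. \<psi>' u' = \<psi> u \<longrightarrow> L_local T (X \<circ> \<psi>) (V \<circ> \<psi>) u = L_local T (X \<circ> \<psi>') (V \<circ> \<psi>') u'"
      using * by blast
  qed (use c u in blast)
qed

text \<open>The square of the relative volume density of \<open>f\<close> over \<open>X\<close>. For
  every smooth \<open>f\<close> it is chart independent, and it is nonzero exactly where
  \<open>f\<close> is an immersion; both readings are used.\<close>

definition ratio :: "('m \<Rightarrow> 'a) \<Rightarrow> 'm \<Rightarrow> real" where
  "ratio f = glue (\<lambda>\<psi> u. det (metric (f \<circ> \<psi>) u) / det (metric (X \<circ> \<psi>) u))"

lemma ratio_eq: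
  assumes f: "smooth_field f" and c: "(W, \<psi>) \<in> \<A>" "u \<in> W"
  shows "ratio f (\<psi> u) = det (metric (f \<circ> \<psi>) u) / det (metric (X \<circ> \<psi>) u)"
  unfolding ratio_def
proof (rule glue_eq[OF chart_indepI c])
  fix W1 \<psi>1 W2 \<psi>2 u assume c: "(W1, \<psi>1) \<in> \<A>" "(W2, \<psi>2) \<in> \<A>" and u: "u \<in> overlap W1 \<psi>1 W2 \<psi>2"
  let ?t = "trans_map \<psi>1 W2 \<psi>2 u" and ?d = "det (matrix (frechet_derivative (trans_map \<psi>1 W2 \<psi>2) (at u)))"
  note tu = trans_map_in[OF c u]
  have 1: "det (metric (f \<circ> \<psi>1) u) = ?d\<^sup>2 * det (metric (f \<circ> \<psi>2) ?t)"
    by (rule dens_transform[OF c u smooth_on_differentiable[OF smooth_fieldD[OF f c(2)] tu]])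
  have 2: "det (metric (X \<circ> \<psi>1) u) = ?d\<^sup>2 * det (metric (X \<circ> \<psi>2) ?t)"
    by (rule dens_transform[OF c u smooth_on_differentiable[OF imm_smooth[OF c(2)] tu]])
  have "det (metric (X \<circ> \<psi>1) u) > 0"
    unfolding metric_gram using det_gram_pos[OF imm_frame[OF c(1)]] u by (auto simp: overlap_def)
  then have "?d\<^sup>2 \<noteq> 0" using 2 by auto
  then show "det (metric (f \<circ> \<psi>1) u) / det (metric (X \<circ> \<psi>1) u) = det (metric (f \<circ> \<psi>2) ?t) / det (metric (X \<circ> \<psi>2) ?t)"
    unfolding 1 2 by simp
qed

lemma vol_measurable:
  fixes h :: "'m \<Rightarrow> 'c::topological_space"
  shows "continuous_on M h \<Longrightarrow> h \<in> borel_measurable vol"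
  using borel_measurable_continuous_on_restrict[of M h] by (simp add: sets_vol cong: measurable_cong_sets)

lemma integrable_vol_compact:
  fixes h :: "'m \<Rightarrow> real"
  assumes h: "continuous_on M h" and K: "compact K" "K \<subseteq> M"
  shows "integrable vol (\<lambda>q. indicator K q * h q)"
proof -
  have "compact (h ` K)" by (rule compact_continuous_image[OF continuous_on_subset[OF h K(2)] K(1)])
  from compact_imp_bounded[OF this] obtain B where "\<forall>x\<in>h ` K. norm x \<le> B" unfolding bounded_iff by blast
  then have B: "norm (h q) \<le> B" if "q \<in> K" for q using that by blast
  have "integrable vol (\<lambda>q. indicator K q *\<^sub>R h q)"
    by (rule integrableI_bounded_set_indicator[where B = B])
      (use sets_compact[OF K] sets_vol vol_measurable[OF h] emeasure_vol_compact[OF K] B in auto)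
  then show ?thesis by simp
qed

end

section \<open>The functional along a variation and its two derivatives\<close>

locale variation = submanifold M \<A> X
  for M :: "'m::{t2_space,second_countable_topology} set" and \<A> :: "('n::finite, 'm) atlas"
    and X :: "'m \<Rightarrow> 'a::euclidean_space" +
  fixes K :: "'m set" and \<epsilon> :: real and Y :: "real \<Rightarrow> 'm \<Rightarrow> 'a" and T :: 'a
  assumes variation: "compact_variation M \<A> X K \<epsilon> Y"
begin

abbreviation S :: "real set" where "S \<equiv> {-\<epsilon><..<\<epsilon>}"

lemma eps_pos: "0 < \<epsilon>" and compact_K: "compact K" and K_sub: "K \<subseteq> M"
  and Y_0: "q \<in> M \<Longrightarrow> Y 0 q = X q" and Y_outside: "s \<in> S \<Longrightarrow> q \<in> M - K \<Longrightarrow> Y s q = X q"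
  and Y_smooth: "(W, \<psi>) \<in> \<A> \<Longrightarrow> smooth_on (S \<times> W) (\<lambda>(s,u). Y s (\<psi> u))"
  using variation unfolding compact_variation_def by auto

lemma Y_submanifold: "s \<in> S \<Longrightarrow> submanifold M \<A> (Y s)"
  using variation unfolding compact_variation_def immersed_submanifold_def
  by unfold_locales auto

lemma zero_in_S: "0 \<in> S" using eps_pos by simp

lemma Y_frame: "(W, \<psi>) \<in> \<A> \<Longrightarrow> s \<in> S \<Longrightarrow> u \<in> W \<Longrightarrow> frame (\<lambda>i. pd (\<lambda>u. Y s (\<psi> u)) i u)"
  using submanifold.imm_frame[OF Y_submanifold, of s W \<psi> u] by (simp add: o_def)

lemma Y_field: "s \<in> S \<Longrightarrow> smooth_field (Y s)"
  unfolding smooth_field_def using submanifold.imm_smooth[OF Y_submanifold] by blast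

lemma Y_sd_field: "s \<in> S \<Longrightarrow> smooth_field (sd Y s)"
  unfolding smooth_field_def
proof clarify
  fix W \<psi> assume s: "s \<in> S" and c: "(W, \<psi>) \<in> \<A>"
  have "smooth_on W (sd (\<lambda>s u. Y s (\<psi> u)) s)"
    by (rule smooth_slice[OF _ chart_open[OF c] smooth_sd[OF _ chart_open[OF c] Y_smooth[OF c]] s]) auto
  moreover have "sd (\<lambda>s u. Y s (\<psi> u)) s = sd Y s \<circ> \<psi>" by (simp add: sd_def fun_eq_iff)
  ultimately show "smooth_on W (sd Y s \<circ> \<psi>)" by simp
qed

lemma Y_sd_sd_field: "s \<in> S \<Longrightarrow> smooth_field (sd (sd Y) s)"
  unfolding smooth_field_def
proof clarify
  fix W \<psi> assume s: "s \<in> S" and c: "(W, \<psi>) \<in> \<A>"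
  have "smooth_on W (sd (sd (\<lambda>s u. Y s (\<psi> u))) s)"
    by (rule smooth_slice[OF _ chart_open[OF c] smooth_sd[OF _ chart_open[OF c] smooth_sd[OF _ chart_open[OF c] Y_smooth[OF c]]] s]) auto
  moreover have "sd (sd (\<lambda>s u. Y s (\<psi> u))) s = sd (sd Y) s \<circ> \<psi>" by (simp add: sd_def fun_eq_iff)
  ultimately show "smooth_on W (sd (sd Y) s \<circ> \<psi>)" by simp
qed

text \<open>The density of the weighted volume of \<open>Y s\<close> with respect to the fixed
  measure \<open>vol\<close>.\<close>

definition wt :: "real \<Rightarrow> 'm \<Rightarrow> real" where
  "wt s q = exp (T \<bullet> Y s q) * sqrt (ratio (Y s) q)"

text \<open>The logarithmic derivative of \<open>wt\<close> in s: the weighted divergence of the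
  velocity, taken in the geometry of \<open>Y s\<close>.\<close>

definition rate :: "real \<Rightarrow> 'm \<Rightarrow> real" where
  "rate s = glue (\<lambda>\<psi>. div_drift T (Y s \<circ> \<psi>) (sd Y s \<circ> \<psi>))"

lemma wt_chart:
  assumes c: "(W, \<psi>) \<in> \<A>" "u \<in> W" and s: "s \<in> S"
  shows "wt s (\<psi> u) = exp (T \<bullet> Y s (\<psi> u)) * sqrt (det (gram (\<lambda>i. pd (\<lambda>u. Y s (\<psi> u)) i u))) / dens \<psi> u"
  unfolding wt_def ratio_eq[OF Y_field[OF s] c] dens_def metric_gram by (simp add: real_sqrt_divide o_def)

lemma rate_chart:
  assumes c: "(W, \<psi>) \<in> \<A>" "u \<in> W" and s: "s \<in> S"
  shows "rate s (\<psi> u) = div_drift T (\<lambda>u. Y s (\<psi> u)) (sd (\<lambda>s u. Y s (\<psi> u)) s) u"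
proof -
  interpret Ys: submanifold M \<A> "Y s" by (rule Y_submanifold[OF s])
  have "rate s (\<psi> u) = div_drift T (Y s \<circ> \<psi>) (sd Y s \<circ> \<psi>) u"
    unfolding rate_def
    by (rule glue_eq[OF Ys.chart_indep_div_drift[OF smooth_field_C1[OF Y_sd_field[OF s]]] c])
  moreover have "sd (\<lambda>s u. Y s (\<psi> u)) s = sd Y s \<circ> \<psi>" by (simp add: sd_def fun_eq_iff)
  ultimately show ?thesis by (simp add: o_def)
qed

lemma has_wt_derivative:
  assumes q: "q \<in> M" and s: "s \<in> S"
  shows "((\<lambda>t. wt t q) has_real_derivative wt s q * rate s q) (at s)"
proof -
  obtain W \<psi> u where c: "(W, \<psi>) \<in> \<A>" "u \<in> W" "\<psi> u = q" using chart_cover[OF q] by blast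
  let ?F = "\<lambda>s u. Y s (\<psi> u)"
  have "((\<lambda>t. exp (T \<bullet> ?F t u) * sqrt (det (gram (\<lambda>i. pd (?F t) i u))) / dens \<psi> u) has_real_derivative
     exp (T \<bullet> ?F s u) * sqrt (det (gram (\<lambda>i. pd (?F s) i u))) * div_drift T (?F s) (sd ?F s) u / dens \<psi> u) (at s)"
    by (intro DERIV_cdivide density_derivative[OF _ chart_open[OF c(1)] Y_smooth[OF c(1)] Y_frame[OF c(1)] s c(2)]) auto
  then have "((\<lambda>t. wt t q) has_real_derivative
     exp (T \<bullet> ?F s u) * sqrt (det (gram (\<lambda>i. pd (?F s) i u))) * div_drift T (?F s) (sd ?F s) u / dens \<psi> u) (at s)"
    by (rule has_field_derivative_transform_within_open[OF _ _ s]) (auto simp: wt_chart[OF c(1,2)] c(3)[symmetric])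
  then show ?thesis
    by (simp add: wt_chart[OF c(1,2) s] rate_chart[OF c(1,2) s] c(3)[symmetric])
qed

text \<open>Defined by differentiation on \<open>M\<close> instead of gluing, hence chart
  independent from the start.\<close>

definition rate' :: "real \<Rightarrow> 'm \<Rightarrow> real" where
  "rate' s q = deriv (\<lambda>t. rate t q) s"

lemma rate_derivative_chart:
  assumes c: "(W, \<psi>) \<in> \<A>" "u \<in> W" and s: "s \<in> S"
  shows "((\<lambda>t. rate t (\<psi> u)) has_real_derivative
    div_drift T (\<lambda>u. Y s (\<psi> u)) (sd (sd (\<lambda>s u. Y s (\<psi> u))) s) u + local_immersion.quad (\<lambda>u. Y s (\<psi> u)) (sd (\<lambda>s u. Y s (\<psi> u)) s) u) (at s)"
  by (rule has_field_derivative_transform_within_open[OF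
        div_drift_derivative[OF _ chart_open[OF c(1)] Y_smooth[OF c(1)] Y_frame[OF c(1)] s c(2)] _ s])
    (auto simp: rate_chart[OF c])

lemma rate'_chart:
  assumes c: "(W, \<psi>) \<in> \<A>" "u \<in> W" and s: "s \<in> S"
  shows "rate' s (\<psi> u) = div_drift T (\<lambda>u. Y s (\<psi> u)) (sd (sd (\<lambda>s u. Y s (\<psi> u))) s) u
     + local_immersion.quad (\<lambda>u. Y s (\<psi> u)) (sd (\<lambda>s u. Y s (\<psi> u)) s) u"
  unfolding rate'_def by (rule DERIV_imp_deriv[OF rate_derivative_chart[OF assms]])

lemma has_rate_derivative:
  assumes q: "q \<in> M" and s: "s \<in> S"
  shows "((\<lambda>t. rate t q) has_real_derivative rate' s q) (at s)"
proof -
  obtain W \<psi> u where c: "(W, \<psi>) \<in> \<A>" "u \<in> W" "\<psi> u = q" using chart_cover[OF q] by blast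
  show ?thesis using rate_derivative_chart[OF c(1,2) s] rate'_chart[OF c(1,2) s] c(3) by simp
qed

lemma wt_continuous: "continuous_on (S \<times> M) (\<lambda>(s, q). wt s q)"
proof (rule continuous_on_glue_param)
  fix W \<psi> assume c: "(W, \<psi>) \<in> \<A>"
  have "continuous_on (S \<times> W) (\<lambda>x. exp (T \<bullet> Y (fst x) (\<psi> (snd x))) * sqrt (det (gram (\<lambda>i. pd (\<lambda>u. Y (fst x) (\<psi> u)) i (snd x)))) / dens \<psi> (snd x))"
  proof (intro continuous_intros)
    show "continuous_on (S \<times> W) (\<lambda>x. Y (fst x) (\<psi> (snd x)))"
      using smooth_on_continuous[OF Y_smooth[OF c]] by (simp add: split_def)
    show "continuous_on (S \<times> W) (\<lambda>x. det (gram (\<lambda>i. pd (\<lambda>u. Y (fst x) (\<psi> u)) i (snd x))))"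
      using continuous_slice_det[OF _ chart_open[OF c] Y_smooth[OF c] Y_frame[OF c]] by (simp add: split_def)
    show "continuous_on (S \<times> W) (\<lambda>x. dens \<psi> (snd x))"
      by (rule continuous_on_compose2[OF dens_continuous[OF c] continuous_on_snd[OF continuous_on_id]]) auto
  qed (use dens_pos[OF c] in fastforce)
  then show "continuous_on (S \<times> W) (\<lambda>(s, u). wt s (\<psi> u))"
    by (rule continuous_on_eq) (auto simp: wt_chart[OF c])
qed

lemma rate_continuous: "continuous_on (S \<times> M) (\<lambda>(s, q). rate s q)"
proof (rule continuous_on_glue_param)
  fix W \<psi> assume c: "(W, \<psi>) \<in> \<A>"
  have "continuous_on (S \<times> W) (\<lambda>(s, u). div_drift T (\<lambda>u. Y s (\<psi> u)) (sd (\<lambda>s u. Y s (\<psi> u)) s) u)"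
    by (rule smooth_on_continuous, rule smooth_slice_div_drift[OF _ chart_open[OF c] Y_smooth[OF c] Y_frame[OF c]
          smooth_sd[OF _ chart_open[OF c] Y_smooth[OF c]]]) auto
  then show "continuous_on (S \<times> W) (\<lambda>(s, u). rate s (\<psi> u))"
    by (rule continuous_on_eq) (auto simp: rate_chart[OF c])
qed

lemma rate'_continuous: "continuous_on (S \<times> M) (\<lambda>(s, q). rate' s q)"
proof (rule continuous_on_glue_param)
  fix W \<psi> assume c: "(W, \<psi>) \<in> \<A>"
  note F = _ chart_open[OF c] Y_smooth[OF c]
  have 1: "continuous_on (S \<times> W) (\<lambda>(s, u). div_drift T (\<lambda>u. Y s (\<psi> u)) (sd (sd (\<lambda>s u. Y s (\<psi> u))) s) u)"
    by (rule smooth_on_continuous, rule smooth_slice_div_drift[OF _ chart_open[OF c] Y_smooth[OF c] Y_frame[OF c]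
          smooth_sd[OF _ chart_open[OF c] smooth_sd[OF _ chart_open[OF c] Y_smooth[OF c]]]]) auto
  have 2: "continuous_on (S \<times> W) (\<lambda>(s, u). local_immersion.quad (\<lambda>u. Y s (\<psi> u)) (sd (\<lambda>s u. Y s (\<psi> u)) s) u)"
    by (rule smooth_on_continuous, rule smooth_slice_quad[OF _ chart_open[OF c] Y_smooth[OF c] Y_frame[OF c]
          smooth_sd[OF _ chart_open[OF c] Y_smooth[OF c]]]) auto
  have "continuous_on (S \<times> W) (\<lambda>x. (case x of (s, u) \<Rightarrow> div_drift T (\<lambda>u. Y s (\<psi> u)) (sd (sd (\<lambda>s u. Y s (\<psi> u))) s) u)
     + (case x of (s, u) \<Rightarrow> local_immersion.quad (\<lambda>u. Y s (\<psi> u)) (sd (\<lambda>s u. Y s (\<psi> u)) s) u))"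
    by (rule continuous_on_add[OF 1 2])
  then show "continuous_on (S \<times> W) (\<lambda>(s, u). rate' s (\<psi> u))"
    by (rule continuous_on_eq) (auto simp: rate'_chart[OF c])
qed

lemma continuous_at_time:
  assumes "continuous_on (S \<times> M) (\<lambda>(s, q). h s q)" "s \<in> S" shows "continuous_on M (h s)"
proof -
  have "continuous_on M (\<lambda>q. (s, q))" by (intro continuous_intros)
  moreover have "(\<lambda>q. (s, q)) ` M \<subseteq> S \<times> M" using assms(2) by blast
  ultimately show ?thesis using continuous_on_compose2[OF assms(1)] by fastforce
qed

text \<open>Halving the interval leaves a closed interval inside \<open>S\<close>, whose product
  with \<open>K\<close> is compact.\<close>

lemma bounded_near_0:
  fixes h :: "real \<Rightarrow> 'm \<Rightarrow> real"
  assumes "continuous_on (S \<times> M) (\<lambda>(s, q). h s q)"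
  obtains C where "\<And>s q. s \<in> {-\<epsilon>/2<..<\<epsilon>/2} \<Longrightarrow> q \<in> K \<Longrightarrow> \<bar>h s q\<bar> \<le> C"
proof -
  have sub: "{-\<epsilon>/2..\<epsilon>/2} \<times> K \<subseteq> S \<times> M" using K_sub eps_pos by auto
  have "compact ((\<lambda>(s, q). h s q) ` ({-\<epsilon>/2..\<epsilon>/2} \<times> K))"
    by (intro compact_continuous_image continuous_on_subset[OF assms sub] compact_Times compact_K) auto
  from compact_imp_bounded[OF this] obtain C where C: "\<forall>x\<in>(\<lambda>(s, q). h s q) ` ({-\<epsilon>/2..\<epsilon>/2} \<times> K). norm x \<le> C"
    unfolding bounded_iff by blast
  have "\<bar>h s q\<bar> \<le> C" if "s \<in> {-\<epsilon>/2<..<\<epsilon>/2}" "q \<in> K" for s q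
  proof -
    have "h s q \<in> (\<lambda>(s, q). h s q) ` ({-\<epsilon>/2..\<epsilon>/2} \<times> K)" using that by (auto intro!: image_eqI[of _ _ "(s, q)"])
    then show ?thesis using C by force
  qed
  then show ?thesis by (rule that)
qed

text \<open>The complement of \<open>K\<close> is open in \<open>M\<close>, so the agreement with
  \<open>X\<close> extends to the derivatives.\<close>

lemma wt_outside:
  assumes s: "s \<in> S" and q: "q \<in> M - K"
  shows "wt s q = exp (T \<bullet> X q)"
proof -
  obtain W \<psi> u where c: "(W, \<psi>) \<in> \<A>" "u \<in> W" "\<psi> u = q" using chart_cover[of q] q by blast
  let ?O = "{v\<in>W. \<psi> v \<in> M - K}"
  have O: "open ?O" by (rule chart_vimage_open[OF c(1) openin_diff_compact[OF compact_K]])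
  have uO: "u \<in> ?O" using c q by auto
  have eq: "(X \<circ> \<psi>) v = (Y s \<circ> \<psi>) v" if "v \<in> ?O" for v using that Y_outside[OF s] by auto
  have "frechet_derivative (X \<circ> \<psi>) (at u) = frechet_derivative (Y s \<circ> \<psi>) (at u)"
    by (rule frechet_derivative_transform_within_open[OF smooth_on_differentiable[OF imm_smooth[OF c(1)] c(2)] O uO eq])
  then have "metric (Y s \<circ> \<psi>) u = metric (X \<circ> \<psi>) u" by (simp add: metric_def pd_def)
  moreover have "det (metric (X \<circ> \<psi>) u) > 0" unfolding metric_gram using det_gram_pos[OF imm_frame[OF c(1,2)]] .
  ultimately have "ratio (Y s) q = 1" using ratio_eq[OF Y_field[OF s] c(1,2)] c(3) by simp
  then show ?thesis using Y_outside[OF s q] by (simp add: wt_def)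
qed

lemma wt_0: "q \<in> M \<Longrightarrow> wt 0 q = exp (T \<bullet> X q)"
proof -
  assume q: "q \<in> M"
  obtain W \<psi> u where c: "(W, \<psi>) \<in> \<A>" "u \<in> W" "\<psi> u = q" using chart_cover[OF q] by blast
  have "frechet_derivative (X \<circ> \<psi>) (at u) = frechet_derivative (Y 0 \<circ> \<psi>) (at u)"
    by (rule frechet_derivative_transform_within_open[OF smooth_on_differentiable[OF imm_smooth[OF c(1)] c(2)] chart_open[OF c(1)] c(2)])
      (use Y_0 chart_subset[OF c(1)] in auto)
  then have "metric (Y 0 \<circ> \<psi>) u = metric (X \<circ> \<psi>) u" by (simp add: metric_def pd_def)
  moreover have "det (metric (X \<circ> \<psi>) u) > 0" unfolding metric_gram using det_gram_pos[OF imm_frame[OF c(1,2)]] .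
  ultimately have "ratio (Y 0) q = 1" using ratio_eq[OF Y_field[OF zero_in_S] c(1,2)] c(3) by simp
  then show ?thesis using Y_0[OF q] by (simp add: wt_def)
qed

lemma F_part_wt:
  assumes s: "s \<in> S" and B: "B \<in> sets vol"
  shows "F_part T M \<A> (Y s) B = (\<integral>\<^sup>+q\<in>B. ennreal (wt s q) \<partial>vol)"
proof -
  have cY: "continuous_on M (Y s)"
    by (rule continuous_on_glue) (use smooth_on_continuous[OF smooth_fieldD[OF Y_field[OF s]]] in \<open>simp add: o_def\<close>)
  have cw: "continuous_on M (wt s)" by (rule continuous_at_time[OF wt_continuous s])
  have r: "sqrt (ratio (Y s) q) = wt s q / exp (T \<bullet> Y s q)" for q by (simp add: wt_def)
  have "continuous_on M (\<lambda>q. sqrt (ratio (Y s) q))"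
    unfolding r by (intro continuous_intros cw cY) auto
  from measurable_compose[OF vol_measurable[OF this] measurable_ennreal]
  have rm: "(\<lambda>q. ennreal (sqrt (ratio (Y s) q))) \<in> borel_measurable vol" .
  have em: "(\<lambda>q. ennreal (exp (T \<bullet> Y s q)) * indicator B q) \<in> borel_measurable vol"
    by (intro borel_measurable_times_ennreal borel_measurable_indicator B
        measurable_compose[OF vol_measurable measurable_ennreal] continuous_intros cY)
  have "volume_measure M \<A> (Y s) = density vol (\<lambda>q. ennreal (sqrt (ratio (Y s) q)))"
  proof (rule volume_measure_density[OF submanifold_axioms Y_submanifold[OF s] rm])
    fix W \<psi> u assume c: "(W, \<psi>) \<in> \<A>" "u \<in> W"
    have p: "det (metric (X \<circ> \<psi>) u) > 0" unfolding metric_gram using det_gram_pos[OF imm_frame[OF c]] .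
    show "ennreal (sqrt (det (metric (X \<circ> \<psi>) u))) * ennreal (sqrt (ratio (Y s) (\<psi> u))) = ennreal (sqrt (det (metric (Y s \<circ> \<psi>) u)))"
      using p by (simp add: ratio_eq[OF Y_field[OF s] c] ennreal_mult'[symmetric] real_sqrt_mult[symmetric])
  qed
  then have "F_part T M \<A> (Y s) B = (\<integral>\<^sup>+q. ennreal (sqrt (ratio (Y s) q)) * (ennreal (exp (T \<bullet> Y s q)) * indicator B q) \<partial>vol)"
    unfolding F_part_def using nn_integral_density[OF rm em] by simp
  also have "\<dots> = (\<integral>\<^sup>+q\<in>B. ennreal (wt s q) \<partial>vol)"
    by (intro nn_integral_cong) (auto simp: wt_def ennreal_mult'[symmetric] mult.commute split: split_indicator)
  finally show ?thesis .
qed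

lemma wt_nonneg:
  assumes "q \<in> M" "s \<in> S" shows "wt s q \<ge> 0"
proof -
  obtain W \<psi> u where c: "(W, \<psi>) \<in> \<A>" "u \<in> W" "\<psi> u = q" using chart_cover[OF assms(1)] by blast
  have "0 \<le> det (gram (\<lambda>i. pd (\<lambda>u. Y s (\<psi> u)) i u))"
    using det_gram_pos[OF Y_frame[OF c(1) assms(2) c(2)]] by simp
  then show ?thesis using wt_chart[OF c(1,2) assms(2)] dens_pos[OF c(1,2)] c(3) by simp
qed

lemma K_sets: "K \<in> sets vol" using sets_compact[OF compact_K K_sub] sets_vol by simp

lemma integrable_wt: "s \<in> S \<Longrightarrow> integrable vol (\<lambda>q. indicator K q * wt s q)"
  by (rule integrable_vol_compact[OF continuous_at_time[OF wt_continuous] compact_K K_sub])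

lemma nn_integral_wt:
  assumes s: "s \<in> S"
  shows "(\<integral>\<^sup>+q\<in>K. ennreal (wt s q) \<partial>vol) = ennreal (\<integral>q. indicator K q * wt s q \<partial>vol)"
proof -
  have "(\<integral>\<^sup>+q. ennreal (indicator K q * wt s q) \<partial>vol) = ennreal (\<integral>q. indicator K q * wt s q \<partial>vol)"
    by (rule nn_integral_eq_integral[OF integrable_wt[OF s]]) (use wt_nonneg s in \<open>auto intro!: AE_I2 split: split_indicator\<close>)
  then show ?thesis by (simp add: ennreal_indicator ennreal_mult' mult.commute)
qed

lemma integral_wt_nonneg: "s \<in> S \<Longrightarrow> 0 \<le> (\<integral>q. indicator K q * wt s q \<partial>vol)"
  by (rule Bochner_Integration.integral_nonneg_AE) (use wt_nonneg in \<open>auto intro!: AE_I2 split: split_indicator\<close>)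

text \<open>In either case of \<open>F_along\<close> the part outside \<open>K\<close> contributes a
  constant: the finite integral over M - K, or nothing at all. Both derivatives can thus be computed
  from the integral over \<open>K\<close>.\<close>

lemma F_along_eq:
  obtains c where "\<And>s. s \<in> S \<Longrightarrow> F_along T M \<A> X K Y s = c + (\<integral>q. indicator K q * wt s q \<partial>vol)"
proof (cases "F_part T M \<A> X M < \<infinity>")
  case False
  then have "F_along T M \<A> X K Y s = 0 + (\<integral>q. indicator K q * wt s q \<partial>vol)" if "s \<in> S" for s
    using that by (simp add: F_along_def F_part_wt[OF _ K_sets] nn_integral_wt integral_wt_nonneg)
  then show ?thesis by (rule that)
next
  case True
  have M: "M \<in> sets vol" using sets.top[of vol] by simp
  let ?c = "\<integral>\<^sup>+q\<in>M - K. ennreal (exp (T \<bullet> X q)) \<partial>vol"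
  have "?c \<le> F_part T M \<A> X M"
    unfolding F_part_def by (intro nn_integral_mono) (auto split: split_indicator)
  then have cfin: "?c < \<infinity>" using True by auto
  have "F_along T M \<A> X K Y s = enn2real ?c + (\<integral>q. indicator K q * wt s q \<partial>vol)" if s: "s \<in> S" for s
  proof -
    have wm: "(\<lambda>q. ennreal (wt s q)) \<in> borel_measurable vol"
      by (rule measurable_compose[OF vol_measurable[OF continuous_at_time[OF wt_continuous s]] measurable_ennreal])
    have "F_part T M \<A> (Y s) M = (\<integral>\<^sup>+q. ennreal (wt s q) * indicator (M - K) q + ennreal (wt s q) * indicator K q \<partial>vol)"
      unfolding F_part_wt[OF s M] by (intro nn_integral_cong) (use K_sub in \<open>auto split: split_indicator\<close>)
    also have "\<dots> = (\<integral>\<^sup>+q\<in>M - K. ennreal (wt s q) \<partial>vol) + (\<integral>\<^sup>+q\<in>K. ennreal (wt s q) \<partial>vol)"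
      by (rule nn_integral_add) (use wm K_sets M in auto)
    also have "(\<integral>\<^sup>+q\<in>M - K. ennreal (wt s q) \<partial>vol) = ?c"
      by (intro nn_integral_cong) (use wt_outside[OF s] in \<open>auto split: split_indicator\<close>)
    finally have "F_part T M \<A> (Y s) M = ?c + ennreal (\<integral>q. indicator K q * wt s q \<partial>vol)"
      unfolding nn_integral_wt[OF s] .
    then show ?thesis
      using True cfin integral_wt_nonneg[OF s] by (simp add: F_along_def enn2real_plus)
  qed
  then show ?thesis by (rule that)
qed

lemma F_along_derivative:
  assumes s: "s \<in> {-\<epsilon>/2<..<\<epsilon>/2}"
  shows "(F_along T M \<A> X K Y has_real_derivative (\<integral>q. indicator K q * (wt s q * rate s q) \<partial>vol)) (at s)"
proof -
  obtain c where c: "\<And>s. s \<in> S \<Longrightarrow> F_along T M \<A> X K Y s = c + (\<integral>q. indicator K q * wt s q \<partial>vol)"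
    by (rule F_along_eq) blast
  have sub: "{-\<epsilon>/2<..<\<epsilon>/2} \<subseteq> S" using eps_pos by auto
  have "continuous_on (S \<times> M) (\<lambda>x. (case x of (s, q) \<Rightarrow> wt s q) * (case x of (s, q) \<Rightarrow> rate s q))"
    by (rule continuous_on_mult[OF wt_continuous rate_continuous])
  then have "continuous_on (S \<times> M) (\<lambda>(s, q). wt s q * rate s q)" by (simp add: split_def)
  then obtain C where C: "\<And>s q. s \<in> {-\<epsilon>/2<..<\<epsilon>/2} \<Longrightarrow> q \<in> K \<Longrightarrow> \<bar>wt s q * rate s q\<bar> \<le> C"
    by (rule bounded_near_0) blast
  have "((\<lambda>s. \<integral>q. indicator K q * wt s q \<partial>vol) has_real_derivative (\<integral>q. indicator K q * (wt s q * rate s q) \<partial>vol)) (at s)"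
    by (rule has_real_derivative_integral[OF K_sets emeasure_vol_compact[OF compact_K K_sub] s _ _ C])
      (use sub K_sub has_wt_derivative integrable_wt in auto)
  then have "((\<lambda>s. c + (\<integral>q. indicator K q * wt s q \<partial>vol)) has_real_derivative (\<integral>q. indicator K q * (wt s q * rate s q) \<partial>vol)) (at s)"
    by (auto intro!: derivative_eq_intros)
  then show ?thesis
    by (rule has_field_derivative_transform_within_open[OF _ _ s]) (use c sub in auto)
qed

lemma F_along_second_derivative:
  "((\<lambda>s. \<integral>q. indicator K q * (wt s q * rate s q) \<partial>vol) has_real_derivative
    (\<integral>q. indicator K q * (wt 0 q * ((rate 0 q)\<^sup>2 + rate' 0 q)) \<partial>vol)) (at 0)"
proof -
  have sub: "{-\<epsilon>/2<..<\<epsilon>/2} \<subseteq> S" using eps_pos by auto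
  have 1: "continuous_on (S \<times> M) (\<lambda>(s, q). wt s q * rate s q)"
    using continuous_on_mult[OF wt_continuous rate_continuous] by (simp add: split_def)
  have "continuous_on (S \<times> M) (\<lambda>x. (case x of (s, q) \<Rightarrow> wt s q) * ((case x of (s, q) \<Rightarrow> rate s q)\<^sup>2 + (case x of (s, q) \<Rightarrow> rate' s q)))"
    by (intro continuous_on_mult continuous_on_add continuous_on_power wt_continuous rate_continuous rate'_continuous)
  then have "continuous_on (S \<times> M) (\<lambda>(s, q). wt s q * ((rate s q)\<^sup>2 + rate' s q))" by (simp add: split_def)
  then obtain C where C: "\<And>s q. s \<in> {-\<epsilon>/2<..<\<epsilon>/2} \<Longrightarrow> q \<in> K \<Longrightarrow> \<bar>wt s q * ((rate s q)\<^sup>2 + rate' s q)\<bar> \<le> C"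
    by (rule bounded_near_0) blast
  show ?thesis
  proof (rule has_real_derivative_integral[OF K_sets emeasure_vol_compact[OF compact_K K_sub] _ _ _ C])
    show "((\<lambda>s. wt s q * rate s q) has_real_derivative wt s q * ((rate s q)\<^sup>2 + rate' s q)) (at s)"
      if "s \<in> {-\<epsilon>/2<..<\<epsilon>/2}" "q \<in> K" for s q
    proof -
      have sq: "q \<in> M" "s \<in> S" using that sub K_sub by auto
      show ?thesis
        by (rule DERIV_cong[OF DERIV_mult[OF has_wt_derivative[OF sq] has_rate_derivative[OF sq]]])
          (simp add: power2_eq_square algebra_simps)
    qed
    show "integrable vol (\<lambda>q. indicator K q * (wt s q * rate s q))" if "s \<in> {-\<epsilon>/2<..<\<epsilon>/2}" for s
      by (rule integrable_vol_compact[OF continuous_at_time[OF 1] compact_K K_sub]) (use that sub in auto)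
  qed (use eps_pos in auto)
qed

end

section \<open>The divergence theorem\<close>

lemma diff_times_on_Un:
  assumes "open S1" "open S2" "diff_times_on k S1 f" "diff_times_on k S2 f"
  shows "diff_times_on k (S1 \<union> S2) f"
  using assms(3,4) by (induction k arbitrary: f) (use assms(1,2) in \<open>auto intro: continuous_on_open_Un\<close>)

text \<open>The open sets \<open>W\<close> and the complement of \<open>C\<close> cover the space,
  and the extension is of class C^k on each of them.\<close>

lemma diff_times_on_extend_zero:
  fixes f :: "'a::real_normed_vector \<Rightarrow> 'b::real_normed_vector"
  assumes W: "open W" and C: "closed C" "C \<subseteq> W" and f: "diff_times_on k W f" and z: "\<And>u. u \<in> W - C \<Longrightarrow> f u = 0"
  shows "diff_times_on k UNIV (\<lambda>u. if u \<in> W then f u else 0)"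
proof -
  have "diff_times_on k W (\<lambda>u. if u \<in> W then f u else 0)"
    by (rule diff_times_on_cong[OF W _ f]) simp
  moreover have "diff_times_on k (- C) (\<lambda>u. if u \<in> W then f u else 0)"
    by (rule diff_times_on_cong[OF _ _ diff_times_on_const[of _ _ 0]]) (use C z in auto)
  ultimately have "diff_times_on k (W \<union> - C) (\<lambda>u. if u \<in> W then f u else 0)"
    using W C by (intro diff_times_on_Un) auto
  moreover have "W \<union> - C = UNIV" using C by auto
  ultimately show ?thesis by simp
qed

lemma frechet_derivative_eq_0:
  assumes "open S" "x \<in> S" "\<And>y. y \<in> S \<Longrightarrow> f y = 0"
  shows "frechet_derivative f (at x) v = 0"
proof -
  have "frechet_derivative (\<lambda>_. 0) (at x) = frechet_derivative f (at x)"
    by (rule frechet_derivative_transform_within_open[OF _ assms(1,2)]) (use assms(3) in auto)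
  from fun_cong[OF this, of v] show ?thesis by simp
qed

text \<open>By translation invariance the integral of f(x + s b) does not depend on s;
  differentiation under the integral at s = 0 then gives the vanishing integral.\<close>

lemma
  fixes f :: "'a::euclidean_space \<Rightarrow> real"
  assumes f: "diff_times_on 1 UNIV f" and C: "compact C" and z: "\<And>x. x \<notin> C \<Longrightarrow> f x = 0"
  shows integrable_directional_derivative: "integrable lborel (\<lambda>x. frechet_derivative f (at x) b)"
    and integral_directional_derivative: "(\<integral>x. frechet_derivative f (at x) b \<partial>lborel) = 0"
proof -
  let ?g = "\<lambda>x. frechet_derivative f (at x) b"
  have cf: "continuous_on UNIV f" and cg: "continuous_on UNIV ?g" and df: "\<And>x. f differentiable (at x)" using f by auto
  have gz: "?g x = 0" if "x \<notin> C" for x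
    by (rule frechet_derivative_eq_0[of "- C"]) (use C z that compact_imp_closed in auto)
  have "integrable lborel (\<lambda>x. indicator C x *\<^sub>R ?g x)"
    by (rule borel_integrable_compact[OF C]) (rule continuous_on_subset[OF cg], simp)
  moreover have "(\<lambda>x. indicator C x *\<^sub>R ?g x) = ?g" using gz by (auto simp: indicator_def fun_eq_iff)
  ultimately show "integrable lborel ?g" by simp
  \<comment> \<open>The points that a translation by s b with |s| \<le> 1 can move into
    \<open>C\<close>. This one compact set carries all the translated functions, as differentiation
    under the integral demands.\<close>
  define K where "K = (\<lambda>(x, t). x - t *\<^sub>R b) ` (C \<times> {-1..1::real})"
  have K: "compact K" unfolding K_def split_def
    by (intro compact_continuous_image continuous_intros compact_Times C compact_Icc)
  have inK: "x \<in> K" if "x + s *\<^sub>R b \<in> C" "-1 \<le> s" "s \<le> 1" for x s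
    unfolding K_def using that by (intro image_eqI[of _ _ "(x + s *\<^sub>R b, s)"]) auto
  have "compact (?g ` C)" by (rule compact_continuous_image[OF continuous_on_subset[OF cg] C]) simp
  from compact_imp_bounded[OF this] obtain B where B: "\<forall>y\<in>?g ` C. norm y \<le> B" unfolding bounded_iff by blast
  \<comment> \<open>Outside \<open>C\<close> the derivative is zero, and \<open>B\<close> could be
    negative if \<open>C\<close> is empty; hence the maximum with 0.\<close>
  have B': "\<bar>?g x\<bar> \<le> max B 0" for x using B gz[of x] by (cases "x \<in> C") auto
  have D: "((\<lambda>s. \<integral>x. indicator K x * f (x + s *\<^sub>R b) \<partial>lborel) has_real_derivative
     (\<integral>x. indicator K x * ?g (x + 0 *\<^sub>R b) \<partial>lborel)) (at 0)"
  proof (rule has_real_derivative_integral[where S = "{-1<..<1}" and C = "max B 0" and g' = "\<lambda>s x. ?g (x + s *\<^sub>R b)"])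
    show "K \<in> sets lborel" using K by (simp add: borel_compact)
    show "emeasure lborel K < \<infinity>" using emeasure_bounded_finite[OF compact_imp_bounded[OF K]] .
    show "((\<lambda>s. f (x + s *\<^sub>R b)) has_real_derivative ?g (x + s *\<^sub>R b)) (at s)" for s x
    proof -
      have D: "(f has_derivative frechet_derivative f (at (x + s *\<^sub>R b))) (at (x + s *\<^sub>R b))"
        using df by (simp add: frechet_derivative_works)
      have "((\<lambda>t. x + t *\<^sub>R b) has_derivative (\<lambda>h. h *\<^sub>R b)) (at s)" by (auto intro!: derivative_eq_intros)
      from has_derivative_compose[OF this D] show ?thesis
        unfolding has_field_derivative_def
        by (rule has_derivative_eq_rhs) (simp add: fun_eq_iff linear_cmul[OF has_derivative_linear[OF D]])
    qed
    have "continuous_on K (\<lambda>x. f (x + s *\<^sub>R b))" for s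
      by (rule continuous_on_compose2[OF cf]) (auto intro!: continuous_intros)
    from borel_integrable_compact[OF K this]
    show "integrable lborel (\<lambda>x. indicator K x * f (x + s *\<^sub>R b))" for s by simp
  qed (use B' in auto)
  have const: "(\<integral>x. indicator K x * f (x + s *\<^sub>R b) \<partial>lborel) = (\<integral>x. f x \<partial>lborel)" if s: "s \<in> {-1<..<1}" for s
  proof -
    have "indicator K x * f (x + s *\<^sub>R b) = f (s *\<^sub>R b + x)" for x
      using inK[of x s] z[of "x + s *\<^sub>R b"] s by (auto simp: indicator_def add.commute)
    then have "(\<integral>x. indicator K x * f (x + s *\<^sub>R b) \<partial>lborel) = (\<integral>x. f (s *\<^sub>R b + x) \<partial>lborel)" by simp
    also have "\<dots> = (\<integral>x. f x \<partial>distr lborel borel ((+) (s *\<^sub>R b)))"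
      by (rule integral_distr[symmetric]) (use borel_measurable_continuous_onI[OF cf] in auto)
    finally show ?thesis by (simp add: lborel_distr_plus)
  qed
  have "((\<lambda>s::real. \<integral>x. f x \<partial>lborel) has_real_derivative 0) (at 0)" by simp
  then have "((\<lambda>s. \<integral>x. indicator K x * f (x + s *\<^sub>R b) \<partial>lborel) has_real_derivative 0) (at 0)"
    by (rule has_field_derivative_transform_within_open[of _ _ _ "{-1<..<1}"]) (use const in auto)
  with D have "(\<integral>x. indicator K x * ?g (x + 0 *\<^sub>R b) \<partial>lborel) = 0" by (rule DERIV_unique)
  moreover have "(\<integral>x. indicator K x * ?g (x + 0 *\<^sub>R b) \<partial>lborel) = (\<integral>x. ?g x \<partial>lborel)"
    by (rule Bochner_Integration.integral_cong[OF refl]) (use inK[of _ 0] gz in \<open>auto simp: indicator_def\<close>)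
  ultimately show "(\<integral>x. ?g x \<partial>lborel) = 0" by simp
qed

lemma smooth_on_exp:
  assumes "open S" "smooth_on S f" shows "smooth_on S (\<lambda>x. exp (f x :: real))"
proof -
  have "diff_times_on k UNIV (exp :: real \<Rightarrow> real)" for k
  proof (induction k)
    case 0 then show ?case by (auto intro!: continuous_intros)
  next
    case (Suc k)
    show ?case
      by (rule diff_times_on_SucI[OF _ has_derivative_exp[OF has_derivative_ident]])
        (auto intro!: diff_times_on_bilinear[OF _ bounded_bilinear_mult] Suc.IH)
  qed
  then have "smooth_on UNIV (exp :: real \<Rightarrow> real)" by (simp add: smooth_on_def)
  from smooth_on_compose[OF assms(1) _ _ assms(2) this] show ?thesis by simp
qed

lemma smooth_on_sqrt:
  assumes "open S" "smooth_on S f" "\<And>x. x \<in> S \<Longrightarrow> f x > 0" shows "smooth_on S (\<lambda>x. sqrt (f x))"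
proof -
  have "diff_times_on k {0<..} sqrt" for k
  proof (induction k)
    case 0 then show ?case by (auto intro!: continuous_intros)
  next
    case (Suc k)
    show ?case
    proof (rule diff_times_on_SucI)
      show "(sqrt has_derivative (\<lambda>v. inverse (sqrt x) / 2 * v)) (at x)" if "x \<in> {0<..}" for x
        by (rule DERIV_real_sqrt[unfolded has_field_derivative_def]) (use that in simp)
      have "diff_times_on k {0<..} (\<lambda>x. inverse (sqrt x))" by (rule diff_times_on_inverse[OF _ Suc.IH]) auto
      then show "diff_times_on k {0<..} (\<lambda>x. inverse (sqrt x) / 2 * v)" for v
        unfolding divide_inverse by (intro diff_times_on_bilinear[OF _ bounded_bilinear_mult]) auto
    qed simp
  qed
  then have "smooth_on {0<..} sqrt" by (simp add: smooth_on_def)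
  from smooth_on_compose[OF assms(1) _ _ assms(2) this] show ?thesis using assms(3) by auto
qed

section \<open>The weighted divergence in coordinates\<close>

context local_immersion
begin

definition weight :: "'a \<Rightarrow> real^'n \<Rightarrow> real" where
  "weight T v = exp (T \<bullet> \<phi> v) * sqrt (det (gram (\<lambda>i. pd \<phi> i v)))"

lemma smooth_weight: "smooth_on W (weight T)"
  unfolding weight_def[abs_def]
  by (intro smooth_on_mult smooth_on_exp smooth_on_sqrt smooth_on_inner smooth_on_const smooth_on_det_gram
      smooth_on_pd smooth_\<phi> open_W det_gram_pos frame_\<phi>)

text \<open>Presents a coordinate derivative as a derivative in one real variable, so that the
  determinant formulas for curves of frames apply.\<close>

lemma pd_along_line:
  fixes f :: "real^'n \<Rightarrow> 'b::euclidean_space"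
  assumes "f differentiable (at u)"
  shows "((\<lambda>t. f (u + t *\<^sub>R axis k 1)) has_vector_derivative pd f k u) (at 0)"
proof -
  have D: "(f has_derivative frechet_derivative f (at u)) (at (u + 0 *\<^sub>R axis k 1))"
    using assms by (simp add: frechet_derivative_works)
  have "((\<lambda>t::real. u + t *\<^sub>R axis k 1) has_derivative (\<lambda>h. h *\<^sub>R axis k 1)) (at 0)" by (auto intro!: derivative_eq_intros)
  from has_derivative_compose[OF this D] show ?thesis
    unfolding has_vector_derivative_def pd_def
    by (rule has_derivative_eq_rhs) (simp add: fun_eq_iff linear_cmul[OF has_derivative_linear[OF D]])
qed

lemma pd_weight:
  assumes u: "u \<in> W"
  shows "pd (weight T) k u = weight T u * (T \<bullet> pd \<phi> k u + (\<Sum>i\<in>UNIV. \<Sum>j\<in>UNIV. ginv (\<lambda>i. pd \<phi> i u) i j * (pd (pd \<phi> i) k u \<bullet> pd \<phi> j u)))"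
proof -
  let ?u = "\<lambda>t::real. u + t *\<^sub>R axis k 1"
  have "((\<lambda>t. T \<bullet> \<phi> (?u t)) has_real_derivative T \<bullet> pd \<phi> k u) (at 0)"
    using bounded_linear.has_vector_derivative[OF bounded_linear_inner_right pd_along_line[OF diff_\<phi>[OF u]]]
    by (simp add: has_real_derivative_iff_has_vector_derivative)
  then have 1: "((\<lambda>t. exp (T \<bullet> \<phi> (?u t))) has_real_derivative exp (T \<bullet> \<phi> u) * (T \<bullet> pd \<phi> k u)) (at 0)"
    by (auto intro!: derivative_eq_intros)
  have 2: "((\<lambda>t. sqrt (det (gram (\<lambda>i. pd \<phi> i (?u t))))) has_real_derivative
      sqrt (det (gram (\<lambda>i. pd \<phi> i (?u 0)))) * (\<Sum>i\<in>UNIV. \<Sum>j\<in>UNIV. ginv (\<lambda>i. pd \<phi> i (?u 0)) i j * (pd (pd \<phi> i) k u \<bullet> pd \<phi> j (?u 0)))) (at 0)"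
    by (rule has_real_derivative_sqrt_det_gram)
      (use pd_along_line[OF smooth_on_differentiable[OF smooth_on_pd[OF smooth_\<phi>] u]] frame_\<phi>[OF u] in auto)
  have "((\<lambda>t. weight T (?u t)) has_real_derivative weight T u * (T \<bullet> pd \<phi> k u + (\<Sum>i\<in>UNIV. \<Sum>j\<in>UNIV. ginv (\<lambda>i. pd \<phi> i u) i j * (pd (pd \<phi> i) k u \<bullet> pd \<phi> j u)))) (at 0)"
    using DERIV_mult[OF 1 2] by (simp add: weight_def algebra_simps)
  moreover have "((\<lambda>t. weight T (?u t)) has_real_derivative pd (weight T) k u) (at 0)"
    using pd_along_line[OF smooth_on_differentiable[OF smooth_weight u]] by (simp add: has_real_derivative_iff_has_vector_derivative)
  ultimately show ?thesis by (rule DERIV_unique[rotated])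
qed

text \<open>The Voss-Weyl formula with weight. By symmetry of the second derivatives of
  \<open>\<phi>\<close>, the terms in which coordinate fields are differentiated match the
  derivative of the volume density.\<close>

lemma weight_div_drift:
  assumes u: "u \<in> W" and a: "\<And>k. a k differentiable (at u)"
  shows "(\<Sum>k\<in>UNIV. pd (\<lambda>v. weight T v * a k v) k u) = weight T u * div_drift T \<phi> (\<lambda>v. \<Sum>k\<in>UNIV. a k v *\<^sub>R pd \<phi> k v) u"
proof -
  let ?g = "ginv (\<lambda>i. pd \<phi> i u)"
  have d\<phi>: "pd \<phi> k differentiable (at u)" for k by (rule smooth_on_differentiable[OF smooth_on_pd[OF smooth_\<phi>] u])
  have U: "pd (\<lambda>v. \<Sum>k\<in>UNIV. a k v *\<^sub>R pd \<phi> k v) i u = (\<Sum>k\<in>UNIV. pd (a k) i u *\<^sub>R pd \<phi> k u + a k u *\<^sub>R pd (pd \<phi> k) i u)" for i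
    by (rule pd_sum_scaleR) (use a d\<phi> in auto)
  have "(\<Sum>i\<in>UNIV. \<Sum>j\<in>UNIV. ?g i j * (pd (\<lambda>v. \<Sum>k\<in>UNIV. a k v *\<^sub>R pd \<phi> k v) i u \<bullet> pd \<phi> j u)) =
     (\<Sum>k\<in>UNIV. pd (a k) k u + a k u * (\<Sum>i\<in>UNIV. \<Sum>j\<in>UNIV. ?g i j * (pd (pd \<phi> i) k u \<bullet> pd \<phi> j u)))"
  proof -
    have "(\<Sum>j\<in>UNIV. ?g i j * (pd (\<lambda>v. \<Sum>k\<in>UNIV. a k v *\<^sub>R pd \<phi> k v) i u \<bullet> pd \<phi> j u)) =
      (\<Sum>k\<in>UNIV. pd (a k) i u * (if i = k then 1 else 0) + a k u * (\<Sum>j\<in>UNIV. ?g i j * (pd (pd \<phi> i) k u \<bullet> pd \<phi> j u)))" for i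
    proof -
      have "(\<Sum>j\<in>UNIV. ?g i j * (pd (\<lambda>v. \<Sum>k\<in>UNIV. a k v *\<^sub>R pd \<phi> k v) i u \<bullet> pd \<phi> j u)) =
        (\<Sum>k\<in>UNIV. \<Sum>j\<in>UNIV. ?g i j * ((pd (a k) i u *\<^sub>R pd \<phi> k u + a k u *\<^sub>R pd (pd \<phi> k) i u) \<bullet> pd \<phi> j u))"
        unfolding U inner_sum_left sum_distrib_left by (rule sum.swap)
      also have "\<dots> = (\<Sum>k\<in>UNIV. pd (a k) i u * (\<Sum>j\<in>UNIV. ?g i j * (pd \<phi> j u \<bullet> pd \<phi> k u)) + a k u * (\<Sum>j\<in>UNIV. ?g i j * (pd (pd \<phi> i) k u \<bullet> pd \<phi> j u)))"
        by (intro sum.cong refl)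
          (simp add: inner_add_left sum_distrib_left sum.distrib[symmetric] pd_commute[OF open_W smooth_\<phi> u, of _ i] inner_commute algebra_simps)
      finally show ?thesis by (simp only: ginv_left[OF frame_\<phi>[OF u]])
    qed
    then have "(\<Sum>i\<in>UNIV. \<Sum>j\<in>UNIV. ?g i j * (pd (\<lambda>v. \<Sum>k\<in>UNIV. a k v *\<^sub>R pd \<phi> k v) i u \<bullet> pd \<phi> j u)) =
      (\<Sum>k\<in>UNIV. \<Sum>i\<in>UNIV. pd (a k) i u * (if i = k then 1 else 0) + a k u * (\<Sum>j\<in>UNIV. ?g i j * (pd (pd \<phi> i) k u \<bullet> pd \<phi> j u)))"
      by (simp only:) (rule sum.swap)
    moreover have "(\<Sum>i\<in>UNIV. pd (a k) i u * (if i = k then 1 else 0)) = pd (a k) k u" for k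
      by (simp add: if_distrib[of "\<lambda>x. _ * x"] cong: if_cong)
    ultimately show ?thesis by (simp only: sum.distrib sum_distrib_left)
  qed
  then have "weight T u * div_drift T \<phi> (\<lambda>v. \<Sum>k\<in>UNIV. a k v *\<^sub>R pd \<phi> k v) u =
      (\<Sum>k\<in>UNIV. pd (weight T) k u * a k u + weight T u * pd (a k) k u)"
    by (simp add: div_drift_def pd_weight[OF u] inner_sum_right sum.distrib sum_distrib_left algebra_simps)
  also have "\<dots> = (\<Sum>k\<in>UNIV. pd (\<lambda>v. weight T v * a k v) k u)"
    by (intro sum.cong refl)
      (simp add: pd_bilinear[OF bounded_bilinear_mult smooth_on_differentiable[OF smooth_weight u] a])
  finally show ?thesis by simp
qed

end

section \<open>Divergence on the manifold and its integral over one chart\<close>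

context submanifold
begin

definition Div :: "'a \<Rightarrow> ('m \<Rightarrow> 'a) \<Rightarrow> 'm \<Rightarrow> real" where
  "Div T U = glue (\<lambda>\<psi>. div_drift T (X \<circ> \<psi>) (U \<circ> \<psi>))"

lemma Div_chart: "C1_field U \<Longrightarrow> (W, \<psi>) \<in> \<A> \<Longrightarrow> u \<in> W \<Longrightarrow> Div T U (\<psi> u) = div_drift T (X \<circ> \<psi>) (U \<circ> \<psi>) u"
  unfolding Div_def by (rule glue_eq[OF chart_indep_div_drift])

lemma Div_continuous:
  assumes U: "C1_field U" shows "continuous_on M (Div T U)"
proof (rule continuous_on_glue)
  fix W \<psi> assume c: "(W, \<psi>) \<in> \<A>"
  interpret L: local_immersion W "X \<circ> \<psi>" by (rule local_immersion_chart[OF c])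
  define f where "f = U \<circ> \<psi>"
  have "continuous_on W f" "\<And>i. continuous_on W (pd f i)"
    using C1_fieldD[OF U c] by (auto simp: pd_def[abs_def] f_def)
  moreover have "continuous_on W (\<lambda>u. ginv (\<lambda>i. pd (X \<circ> \<psi>) i u) i j)" for i j
    by (intro smooth_on_continuous smooth_on_ginv L.open_W smooth_on_pd L.smooth_\<phi> L.frame_\<phi>)
  moreover have "continuous_on W (pd (X \<circ> \<psi>) i)" for i
    by (intro smooth_on_continuous smooth_on_pd L.smooth_\<phi>)
  ultimately have "continuous_on W (div_drift T (X \<circ> \<psi>) (U \<circ> \<psi>))"
    unfolding div_drift_def[abs_def] f_def[symmetric] by (intro continuous_intros)
  then show "continuous_on W (\<lambda>u. Div T U (\<psi> u))"
    by (rule continuous_on_eq) (simp add: Div_chart[OF U c])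
qed

lemma Div_outside:
  assumes U: "C1_field U" and K: "compact K" and z: "\<And>q. q \<in> M - K \<Longrightarrow> U q = 0" and q: "q \<in> M - K"
  shows "Div T U q = 0"
proof -
  obtain W \<psi> u where c: "(W, \<psi>) \<in> \<A>" "u \<in> W" "\<psi> u = q" using chart_cover[of q] q by blast
  let ?O = "{v\<in>W. \<psi> v \<in> M - K}"
  have O: "open ?O" by (rule chart_vimage_open[OF c(1) openin_diff_compact[OF K]])
  have uO: "u \<in> ?O" using c q by auto
  have "pd (U \<circ> \<psi>) i u = 0" for i
    unfolding pd_def by (rule frechet_derivative_eq_0[OF O uO]) (use z in auto)
  then show ?thesis using Div_chart[OF U c(1,2)] c(3) z[OF q] by (simp add: div_drift_def)
qed

lemma C1_field_scaleR:
  fixes f :: "'m \<Rightarrow> real"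
  assumes "C1_field f" "C1_field U" shows "C1_field (\<lambda>q. f q *\<^sub>R U q)"
  unfolding C1_field_def
proof clarify
  fix W \<psi> assume c: "(W, \<psi>) \<in> \<A>"
  show "diff_times_on 1 W ((\<lambda>q. f q *\<^sub>R U q) \<circ> \<psi>)"
    using diff_times_on_bilinear[OF chart_open[OF c] bounded_bilinear_scaleR C1_fieldD[OF assms(1) c] C1_fieldD[OF assms(2) c]]
    by (simp only: o_def)
qed

lemma Div_add:
  assumes f: "C1_field f" and g: "C1_field g" and q: "q \<in> M"
  shows "Div T (\<lambda>q. f q + g q) q = Div T f q + Div T g q"
proof -
  obtain W \<psi> u where c: "(W, \<psi>) \<in> \<A>" "u \<in> W" "\<psi> u = q" using chart_cover[OF q] by blast
  have "C1_field (\<lambda>q. f q + g q)"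
    unfolding C1_field_def
  proof clarify
    fix W \<psi> assume c: "(W, \<psi>) \<in> \<A>"
    show "diff_times_on 1 W ((\<lambda>q. f q + g q) \<circ> \<psi>)"
      using diff_times_on_add[OF chart_open[OF c] C1_fieldD[OF f c] C1_fieldD[OF g c]] by (simp only: o_def)
  qed
  from Div_chart[OF this c(1,2), of T] Div_chart[OF f c(1,2), of T] Div_chart[OF g c(1,2), of T]
  show ?thesis
    using div_drift_add[OF C1_field_differentiable[OF f c(1,2)] C1_field_differentiable[OF g c(1,2)], of T "X \<circ> \<psi>"] c(3)
    by (simp add: o_def)
qed

definition tangent_field :: "('m \<Rightarrow> 'a) \<Rightarrow> bool" where
  "tangent_field U \<longleftrightarrow> (\<forall>(W,\<psi>)\<in>\<A>. \<forall>u\<in>W. tan_proj (X \<circ> \<psi>) u (U (\<psi> u)) = U (\<psi> u))"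

lemma tangent_fieldD: "tangent_field U \<Longrightarrow> (W, \<psi>) \<in> \<A> \<Longrightarrow> u \<in> W \<Longrightarrow> tan_proj (X \<circ> \<psi>) u (U (\<psi> u)) = U (\<psi> u)"
  unfolding tangent_field_def by blast

lemma tangent_field_scaleR:
  assumes "tangent_field U" shows "tangent_field (\<lambda>q. f q *\<^sub>R U q)"
  unfolding tangent_field_def
proof clarify
  fix W \<psi> u assume c: "(W, \<psi>) \<in> \<A>" and u: "u \<in> W"
  interpret L: local_immersion W "X \<circ> \<psi>" by (rule local_immersion_chart[OF c])
  show "tan_proj (X \<circ> \<psi>) u (f (\<psi> u) *\<^sub>R U (\<psi> u)) = f (\<psi> u) *\<^sub>R U (\<psi> u)"
    using tangent_fieldD[OF assms c u] by (simp add: L.tan_proj_eq[OF u] linear_cmul[OF linear_tproj])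
qed

lemma continuous_immersion: "continuous_on M X"
  by (rule continuous_on_glue) (use smooth_on_continuous[OF imm_smooth] in \<open>simp add: o_def\<close>)

lemma integrable_Div:
  assumes U: "C1_field U" and K: "compact K" "K \<subseteq> M" and z: "\<And>q. q \<in> M - K \<Longrightarrow> U q = 0"
  shows "integrable vol (\<lambda>q. exp (T \<bullet> X q) * Div T U q)"
proof -
  have "integrable vol (\<lambda>q. indicator K q * (exp (T \<bullet> X q) * Div T U q))"
    by (intro integrable_vol_compact K continuous_intros continuous_immersion Div_continuous U)
  then show ?thesis
    by (rule Bochner_Integration.integrable_cong[THEN iffD1, rotated 2])
      (use Div_outside[OF U K(1) z] in \<open>auto simp: indicator_def\<close>)
qed

text \<open>In the chart, density times divergence is a sum of coordinate derivatives of compactly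
  supported functions, extended by zero to the whole parameter space; each of them has integral
  zero.\<close>

lemma divergence_chart:
  assumes c: "(W, \<psi>) \<in> \<A>" and C: "compact C" "C \<subseteq> W" and U: "C1_field U" "tangent_field U"
    and z: "\<And>q. q \<in> M - \<psi> ` C \<Longrightarrow> U q = 0"
  shows "(\<integral>q. exp (T \<bullet> X q) * Div T U q \<partial>vol) = 0"
proof -
  interpret L: local_immersion W "X \<circ> \<psi>" by (rule local_immersion_chart[OF c])
  let ?\<phi> = "X \<circ> \<psi>"
  define a where "a k u = (\<Sum>j\<in>UNIV. ginv (\<lambda>i. pd ?\<phi> i u) k j * ((U \<circ> \<psi>) u \<bullet> pd ?\<phi> j u))" for k u
  have sm: "smooth_on W f \<Longrightarrow> diff_times_on 1 W f" for f :: "real^'n \<Rightarrow> 'x::real_normed_vector" by (simp only: smooth_on_def)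
  have a1: "diff_times_on 1 W (a k)" for k
    unfolding a_def[abs_def]
    by (intro diff_times_on_sum L.open_W diff_times_on_bilinear[OF L.open_W bounded_bilinear_mult]
        diff_times_on_bilinear[OF L.open_W bounded_bilinear_inner] sm smooth_on_ginv smooth_on_pd L.smooth_\<phi> L.frame_\<phi> C1_fieldD[OF U(1) c])
  have Ua: "(U \<circ> \<psi>) u = (\<Sum>k\<in>UNIV. a k u *\<^sub>R pd ?\<phi> k u)" if "u \<in> W" for u
    using tangent_fieldD[OF U(2) c that] by (simp add: L.tan_proj_eq[OF that] tproj_def a_def scaleR_sum_left)
  have az: "a k u = 0" if "u \<in> W - C" for k u
  proof -
    have "\<psi> u \<in> M - \<psi> ` C"
      using that C(2) chart_subset[OF c] inj_on_image_mem_iff[OF chart_inj[OF c], of u C] by auto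
    then show ?thesis using z by (simp add: a_def)
  qed
  define f where "f k u = (if u \<in> W then L.weight T u * a k u else 0)" for k u
  have f1: "diff_times_on 1 UNIV (f k)" for k
    unfolding f_def[abs_def]
    by (rule diff_times_on_extend_zero[OF L.open_W compact_imp_closed[OF C(1)] C(2)
          diff_times_on_bilinear[OF L.open_W bounded_bilinear_mult sm[OF L.smooth_weight] a1]]) (simp add: az)
  have fz: "f k u = 0" if "u \<notin> C" for k u using that az by (auto simp: f_def)
  have eq: "indicator W u * (dens \<psi> u * (exp (T \<bullet> X (\<psi> u)) * Div T U (\<psi> u))) = (\<Sum>k\<in>UNIV. frechet_derivative (f k) (at u) (axis k 1))" for u
  proof (cases "u \<in> W")
    case True
    have da: "a k differentiable (at u)" for k using a1[of k] True by simp
    have "frechet_derivative (f k) (at u) (axis k 1) = pd (\<lambda>v. L.weight T v * a k v) k u" for k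
      unfolding pd_def
      by (rule fun_cong[OF frechet_derivative_transform_within_open[OF _ L.open_W True]]) (use f1[of k] in \<open>auto simp: f_def\<close>)
    then have "(\<Sum>k\<in>UNIV. frechet_derivative (f k) (at u) (axis k 1)) = L.weight T u * div_drift T ?\<phi> (\<lambda>v. \<Sum>k\<in>UNIV. a k v *\<^sub>R pd ?\<phi> k v) u"
      using L.weight_div_drift[OF True, of a T] da by simp
    also have "div_drift T ?\<phi> (\<lambda>v. \<Sum>k\<in>UNIV. a k v *\<^sub>R pd ?\<phi> k v) u = div_drift T ?\<phi> (U \<circ> \<psi>) u"
      by (rule sym, rule div_drift_cong[OF L.open_W True _ C1_field_differentiable[OF U(1) c True]]) (rule Ua)
    also have "L.weight T u = dens \<psi> u * exp (T \<bullet> X (\<psi> u))" by (simp add: L.weight_def dens_def metric_gram)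
    finally show ?thesis using True unfolding Div_chart[OF U(1) c True] by (simp only: indicator_simps mult_1 mult.assoc)
  next
    case False
    then have "frechet_derivative (f k) (at u) (axis k 1) = 0" for k
      by (intro frechet_derivative_eq_0[of "- C"]) (use C compact_imp_closed fz in auto)
    then show ?thesis using False by simp
  qed
  have cC: "compact (\<psi> ` C)" by (rule compact_continuous_image[OF continuous_on_subset[OF chart_continuous[OF c] C(2)] C(1)])
  have "(\<integral>q. exp (T \<bullet> X q) * Div T U q \<partial>vol) = (\<integral>u. indicator W u * (dens \<psi> u * (exp (T \<bullet> X (\<psi> u)) * Div T U (\<psi> u))) \<partial>lborel)"
  proof (rule integral_chart[OF c])
    have "\<psi> ` C \<subseteq> M" using C(2) chart_subset[OF c] by blast
    from integrable_Div[OF U(1) cC this z] show "(\<lambda>q. exp (T \<bullet> X q) * Div T U q) \<in> borel_measurable vol" by auto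
    show "exp (T \<bullet> X q) * Div T U q = 0" if "q \<in> M - \<psi> ` W" for q
      using Div_outside[OF U(1) cC z, of q T] that C(2) by auto
  qed
  also have "\<dots> = (\<Sum>k\<in>UNIV. \<integral>u. frechet_derivative (f k) (at u) (axis k 1) \<partial>lborel)"
    unfolding eq by (rule Bochner_Integration.integral_sum) (rule integrable_directional_derivative[OF f1 C(1) fz])
  also have "\<dots> = 0" by (simp add: integral_directional_derivative[OF f1 C(1) fz])
  finally show ?thesis .
qed

end

text \<open>A plateau function which is only $C^1$ suffices to localise the divergence theorem.\<close>

definition plateau :: "real \<Rightarrow> real" where
  "plateau t = 1 - (max 0 (1 - (max 0 (2 - t))\<^sup>2))\<^sup>2"

lemma plateau_1: "t \<le> 1 \<Longrightarrow> plateau t = 1"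
proof -
  assume "t \<le> 1"
  then have "1 \<le> (2 - t)\<^sup>2" by (simp add: one_le_power)
  then have 1: "max 0 (1 - (2 - t)\<^sup>2) = 0" by (intro max_absorb1) linarith
  have 2: "max 0 (2 - t) = 2 - t" using \<open>t \<le> 1\<close> by simp
  show ?thesis unfolding plateau_def 2 1 by simp
qed

lemma plateau_0: "2 \<le> t \<Longrightarrow> plateau t = 0"
  by (simp add: plateau_def max_def)

text \<open>Squaring removes the corner at 0: the derivative 2 max(0, t) is continuous.\<close>

lemma diff_times_on_max_0_power2: "diff_times_on 1 UNIV (\<lambda>t::real. (max 0 t)\<^sup>2)"
proof -
  have D: "((\<lambda>t::real. (max 0 t)\<^sup>2) has_derivative (\<lambda>v. 2 * max 0 t * v)) (at t)" for t
  proof -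
    consider "t > 0" | "t < 0" | "t = 0" by linarith
    then show ?thesis
    proof cases
      case 1
      have "((\<lambda>t::real. t\<^sup>2) has_derivative (\<lambda>v. 2 * max 0 t * v)) (at t)"
        using 1 by (auto intro!: derivative_eq_intros)
      then show ?thesis
        by (rule has_derivative_transform_within_open[OF _ open_greaterThan[of 0]]) (use 1 in auto)
    next
      case 2
      have "((\<lambda>t::real. 0::real) has_derivative (\<lambda>v. 2 * max 0 t * v)) (at t)"
        using 2 by (auto intro!: derivative_eq_intros)
      then show ?thesis
        by (rule has_derivative_transform_within_open[OF _ open_lessThan[of 0]]) (use 2 in auto)
    next
      case 3
      have "((\<lambda>t::real. (max 0 t)\<^sup>2) has_real_derivative 0) (at 0)"
        unfolding DERIV_def
      proof (simp, rule Lim_null_comparison[of _ "\<lambda>h. \<bar>h\<bar>"])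
        show "\<forall>\<^sub>F h::real in at 0. norm ((max 0 h)\<^sup>2 / h) \<le> \<bar>h\<bar>"
          by (rule always_eventually) (auto simp: max_def power2_eq_square)
        show "((\<lambda>h::real. \<bar>h\<bar>) \<longlongrightarrow> 0) (at 0)" by (rule tendsto_eq_intros tendsto_ident_at)+ simp
      qed
      then show ?thesis
        unfolding 3 has_field_derivative_def by (rule has_derivative_eq_rhs) (simp add: fun_eq_iff)
    qed
  qed
  show ?thesis
    unfolding One_nat_def
    by (rule diff_times_on_SucI[OF _ D]) (auto intro!: continuous_intros)
qed

lemma diff_times_on_plateau: "diff_times_on 1 UNIV plateau"
proof -
  have 1: "diff_times_on 1 UNIV (\<lambda>t::real. c - t)" for c
    using smooth_on_diff[OF open_UNIV smooth_on_const[of _ c] smooth_on_ident[OF open_UNIV]] unfolding smooth_on_def by blast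
  have 2: "diff_times_on 1 UNIV (\<lambda>t::real. (max 0 (2 - t))\<^sup>2)"
    by (rule diff_times_on_compose[OF open_UNIV open_UNIV _ 1 diff_times_on_max_0_power2]) simp
  have 3: "diff_times_on 1 UNIV (\<lambda>t::real. 1 - (max 0 (2 - t))\<^sup>2)"
    by (rule diff_times_on_compose[OF open_UNIV open_UNIV _ 2 1]) simp
  have 4: "diff_times_on 1 UNIV (\<lambda>t::real. (max 0 (1 - (max 0 (2 - t))\<^sup>2))\<^sup>2)"
    by (rule diff_times_on_compose[OF open_UNIV open_UNIV _ 3 diff_times_on_max_0_power2]) simp
  show ?thesis unfolding plateau_def[abs_def]
    by (rule diff_times_on_compose[OF open_UNIV open_UNIV _ 4 1]) simp
qed

context submanifold
begin

text \<open>A set on which a field can be kept unchanged while it is cut off to a compact part of a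
  single chart.\<close>

definition cutoff_set :: "'m set \<Rightarrow> bool" where
  "cutoff_set G \<longleftrightarrow> (\<exists>W \<psi> C p. (W, \<psi>) \<in> \<A> \<and> compact C \<and> C \<subseteq> W \<and> C1_field p \<and> (\<forall>q\<in>G. p q = (1::real)) \<and> (\<forall>q\<in>M - \<psi> ` C. p q = 0))"

lemma cutoff_exists:
  assumes q: "q \<in> M"
  shows "\<exists>G. openin (top_of_set M) G \<and> q \<in> G \<and> cutoff_set G"
proof -
  obtain W \<psi> u where c: "(W, \<psi>) \<in> \<A>" "u \<in> W" "\<psi> u = q" using chart_cover[OF q] by blast
  obtain R where R: "R > 0" "cball u R \<subseteq> W" using chart_open[OF c(1)] c(2) open_contains_cball by blast
  \<comment> \<open>\<open>plateau\<close> is 1 up to the argument 1 and 0 from 2 on. With |v - u|^2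
    / r^2 as argument, which is smooth also at the centre, this gives 1 on the ball of radius r and
    0 outside the ball of radius 2 r, which has to fit into the chart.\<close>
  define r where "r = R / 2"
  have r: "r > 0" "cball u (2 * r) \<subseteq> W" using R by (auto simp: r_def)
  define h where "h v = plateau ((v - u) \<bullet> (v - u) / r\<^sup>2)" for v
  have h1: "diff_times_on 1 UNIV h"
  proof -
    have "smooth_on UNIV (\<lambda>v. (v - u) \<bullet> (v - u) / r\<^sup>2)"
      by (intro smooth_intros open_UNIV) (use r in auto)
    then have "diff_times_on 1 UNIV (\<lambda>v. (v - u) \<bullet> (v - u) / r\<^sup>2)" by (simp only: smooth_on_def)
    from diff_times_on_compose[OF open_UNIV open_UNIV _ this diff_times_on_plateau] show ?thesis unfolding h_def[abs_def] by simp
  qed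
  have h_1: "h v = 1" if "v \<in> ball u r" for v
  proof -
    have "norm (v - u) \<le> r" using that by (simp add: dist_norm norm_minus_commute)
    then have "(v - u) \<bullet> (v - u) \<le> r\<^sup>2" by (simp add: dot_square_norm power_mono)
    then show ?thesis unfolding h_def using r(1) by (intro plateau_1) simp
  qed
  have h_0: "h v = 0" if "v \<notin> cball u (2 * r)" for v
  proof -
    have "2 * r \<le> norm (v - u)" using that by (simp add: dist_norm norm_minus_commute)
    then have "(2 * r)\<^sup>2 \<le> (norm (v - u))\<^sup>2" using r(1) by (intro power_mono) auto
    then have "4 * r\<^sup>2 \<le> (v - u) \<bullet> (v - u)" by (simp add: dot_square_norm power_mult_distrib)
    moreover have "0 < r\<^sup>2" using r(1) by simp
    ultimately have "2 * r\<^sup>2 \<le> (v - u) \<bullet> (v - u)" by linarith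
    then show ?thesis unfolding h_def using r(1) by (intro plateau_0) (simp add: le_divide_eq)
  qed
  let ?C = "cball u (2 * r)"
  define p where "p q = (if q \<in> \<psi> ` W then h (inv_into W \<psi> q) else 0)" for q
  have p_out: "p q = 0" if "q \<notin> \<psi> ` ?C" for q
  proof (cases "q \<in> \<psi> ` W")
    case True
    then have "inv_into W \<psi> q \<notin> ?C" using that by (metis f_inv_into_f image_eqI)
    then show ?thesis using h_0 by (simp add: p_def)
  qed (simp add: p_def)
  have cC: "compact (\<psi> ` ?C)" by (rule compact_continuous_image[OF continuous_on_subset[OF chart_continuous[OF c(1)] r(2)]]) simp
  have "C1_field p"
    unfolding C1_field_def
  proof clarify
    fix W' \<psi>' assume c': "(W', \<psi>') \<in> \<A>"
    \<comment> \<open>\<open>p\<close> is given by the chart on the first open set and vanishes on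
      the second, which is open because the support is compact.\<close>
    let ?O = "overlap W' \<psi>' W \<psi>" and ?Q = "{v\<in>W'. \<psi>' v \<in> M - \<psi> ` ?C}"
    have Q: "open ?Q" by (rule chart_vimage_open[OF c' openin_diff_compact[OF cC]])
    have "diff_times_on 1 ?O (\<lambda>v. h (trans_map \<psi>' W \<psi> v))"
      using trans_map_smooth[OF c' c(1)] unfolding smooth_on_def
      by (intro diff_times_on_compose[OF overlap_open[OF c' c(1)] open_UNIV _ _ h1]) auto
    then have 1: "diff_times_on 1 ?O (p \<circ> \<psi>')"
      by (rule diff_times_on_cong[OF overlap_open[OF c' c(1)], rotated]) (auto simp: p_def trans_map_def overlap_def)
    have 2: "diff_times_on 1 ?Q (p \<circ> \<psi>')"
      by (rule diff_times_on_cong[OF Q _ diff_times_on_const[of _ _ 0]]) (use p_out in auto)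
    have "W' = ?O \<union> ?Q" using chart_subset[OF c'] r(2) by (auto simp: overlap_def)
    then show "diff_times_on 1 W' (p \<circ> \<psi>')" using diff_times_on_Un[OF overlap_open[OF c' c(1)] Q 1 2] by simp
  qed
  moreover have "p q = 1" if qB: "q \<in> \<psi> ` ball u r" for q
  proof -
    have sub: "ball u r \<subseteq> W" using r by auto
    obtain v where v: "v \<in> ball u r" "q = \<psi> v" using qB by blast
    then have "inv_into W \<psi> q = v" using sub inv_into_f_f[OF chart_inj[OF c(1)]] by blast
    then show ?thesis using v sub h_1 by (auto simp: p_def)
  qed
  ultimately have "cutoff_set (\<psi> ` ball u r)"
    unfolding cutoff_set_def using c(1) r(2) p_out by (intro exI[of _ W] exI[of _ \<psi>] exI[of _ ?C] exI[of _ p]) auto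
  moreover have "openin (top_of_set M) (\<psi> ` ball u r)"
    by (rule chart_image_openin[OF c(1)]) (use r in auto)
  ultimately show ?thesis using c(3) r(1) by (intro exI[of _ "\<psi> ` ball u r"]) auto
qed

text \<open>In place of a partition of unity, cut-off functions are peeled off one at a time: p U
  lives in a single chart, while (1 - p) U vanishes where p = 1 and is supported in a compact set
  covered by one neighbourhood less.\<close>

lemma divergence_theorem:
  assumes K: "compact K" "K \<subseteq> M" and U: "C1_field U" "tangent_field U" and z: "\<And>q. q \<in> M - K \<Longrightarrow> U q = 0"
  shows "(\<integral>q. exp (T \<bullet> X q) * Div T U q \<partial>vol) = 0"
proof -
  obtain F where F: "finite F" "K \<subseteq> \<Union>F" "\<And>G. G \<in> F \<Longrightarrow> openin (top_of_set M) G \<and> cutoff_set G"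
    using compact_openin_cover[OF K, of cutoff_set] cutoff_exists K(2) by blast
  show ?thesis
    using F(1) F(3) K F(2) U z
  proof (induction F arbitrary: K U rule: finite_induct)
    case empty
    then have "K = {}" by simp
    then have "Div T U q = 0" if "q \<in> M" for q
      using Div_outside[OF empty.prems(5) compact_empty, of q T] empty.prems(7) that by simp
    then have "(\<integral>q. exp (T \<bullet> X q) * Div T U q \<partial>vol) = (\<integral>q. 0 \<partial>vol)"
      by (intro Bochner_Integration.integral_cong) auto
    then show ?case by simp
  next
    case (insert G F)
    note K = \<open>compact K\<close> \<open>K \<subseteq> M\<close> and U = \<open>C1_field U\<close> \<open>tangent_field U\<close>
    have z: "U q = 0" if "q \<in> M - K" for q using insert.prems that by blast
    obtain W \<psi> C p where c: "(W, \<psi>) \<in> \<A>" "compact C" "C \<subseteq> W" "C1_field p" "\<And>q. q \<in> G \<Longrightarrow> p q = (1::real)" "\<And>q. q \<in> M - \<psi> ` C \<Longrightarrow> p q = 0"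
      using insert.prems(1)[of G] unfolding cutoff_set_def by auto
    \<comment> \<open>\<open>N\<close> is open in the whole space, so that \<open>K - N\<close>
      stays compact.\<close>
    obtain N where N: "open N" "G = M \<inter> N" using insert.prems(1)[of G] by (auto simp: openin_open)
    let ?U1 = "\<lambda>q. p q *\<^sub>R U q" and ?U2 = "\<lambda>q. (1 - p q) *\<^sub>R U q"
    have p2: "C1_field (\<lambda>q. 1 - p q)"
      unfolding C1_field_def
    proof clarify
      fix W \<psi> assume c': "(W, \<psi>) \<in> \<A>"
      have "diff_times_on 1 W (\<lambda>u. 1 + (- 1) *\<^sub>R (p \<circ> \<psi>) u)"
        by (intro diff_times_on_add chart_open[OF c'] diff_times_on_const diff_times_on_bilinear[OF _ bounded_bilinear_scaleR] C1_fieldD[OF c(4) c'])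
      then show "diff_times_on 1 W ((\<lambda>q. 1 - p q) \<circ> \<psi>)" by (simp add: o_def)
    qed
    have U1: "C1_field ?U1" and U2: "C1_field ?U2" using C1_field_scaleR[OF _ U(1)] c(4) p2 by auto
    have K2: "compact (K - N)" "K - N \<subseteq> M" using K N(1) by (auto intro: compact_diff)
    have z2: "?U2 q = 0" if "q \<in> M - (K - N)" for q using that z c(5) N(2) by (cases "q \<in> K") auto
    have z1: "?U1 q = 0" if "q \<in> M - \<psi> ` C" for q using that c(6) by simp
    have z1': "?U1 q = 0" if "q \<in> M - K" for q using that z by simp
    have I1: "(\<integral>q. exp (T \<bullet> X q) * Div T ?U1 q \<partial>vol) = 0"
      by (rule divergence_chart[OF c(1-3) U1 tangent_field_scaleR[OF U(2)] z1])
    have I2: "(\<integral>q. exp (T \<bullet> X q) * Div T ?U2 q \<partial>vol) = 0"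
      by (rule insert.IH[OF _ K2 _ U2 tangent_field_scaleR[OF U(2)] z2]) (use insert.prems N in auto)
    have "(\<integral>q. exp (T \<bullet> X q) * Div T U q \<partial>vol) = (\<integral>q. exp (T \<bullet> X q) * Div T ?U1 q + exp (T \<bullet> X q) * Div T ?U2 q \<partial>vol)"
    proof (rule Bochner_Integration.integral_cong[OF refl])
      fix q assume "q \<in> space vol"
      then have "Div T (\<lambda>q. ?U1 q + ?U2 q) q = Div T ?U1 q + Div T ?U2 q" by (intro Div_add[OF U1 U2]) simp
      moreover have "(\<lambda>q. ?U1 q + ?U2 q) = U" by (simp add: algebra_simps)
      ultimately show "exp (T \<bullet> X q) * Div T U q = exp (T \<bullet> X q) * Div T ?U1 q + exp (T \<bullet> X q) * Div T ?U2 q"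
        by (simp add: distrib_left)
    qed
    also have "\<dots> = (\<integral>q. exp (T \<bullet> X q) * Div T ?U1 q \<partial>vol) + (\<integral>q. exp (T \<bullet> X q) * Div T ?U2 q \<partial>vol)"
      by (rule Bochner_Integration.integral_add[OF integrable_Div[OF U1 K z1'] integrable_Div[OF U2 K2 z2]])
    finally show ?case unfolding I1 I2 by simp
  qed
qed

end

section \<open>The second variation formula\<close>

text \<open>A converse to \<open>det_gram_pos\<close>, by which immersions are recognised from a
  nonzero determinant.\<close>

lemma frame_if_det_gram:
  assumes "det (gram e) \<noteq> 0" shows "frame e"
  unfolding frame_def
proof (rule injI)
  fix x y assume "lincomb e x = lincomb e y"
  then have 0: "lincomb e (x - y) = 0" by (simp add: linear_diff[OF linear_lincomb])
  have "(gram e *v (x - y)) $ i = e i \<bullet> lincomb e (x - y)" for i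
    by (simp add: gram_def matrix_vector_mult_def lincomb_def inner_sum_right mult.commute)
  then have "gram e *v (x - y) = 0" unfolding 0 by (simp add: vec_eq_iff)
  then have "x - y = 0" by (metis assms matrix_inv_works(2) matrix_vector_mul_assoc matrix_vector_mul_lid matrix_vector_mult_0_right)
  then show "x = y" by simp
qed

lemma (in chart_change) grad_half_sq_change:
  assumes V: "smooth_on W2 V2" "\<And>u. u \<in> O1 \<Longrightarrow> V1 u = V2 (\<tau> u)" and u: "u \<in> O1"
  shows "A.grad_half_sq V1 u = B.grad_half_sq V2 (\<tau> u)"
proof -
  have pdV: "pd V1 j u = (\<Sum>k\<in>UNIV. J k j u *\<^sub>R pd V2 k (\<tau> u))" for j by (rule pd_pullback[OF u V])
  show ?thesis
    unfolding A.grad_half_sq_def B.grad_half_sq_def scaleR_scaleR[symmetric] V(2)[OF u]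
    by (rule trace[OF u]) (simp only: pd_\<phi>1[OF u] pdV inner_sum_right inner_scaleR_right scaleR_sum_scaleR)
qed

context submanifold
begin

text \<open>\<open>X + s N\<close> stays an immersion for small \<open>s\<close> by compactness of the support of \<open>N\<close>.\<close>

lemma linear_variation:
  assumes N: "smooth_field N" and K: "compact K" "K \<subseteq> M" and z: "\<And>q. q \<in> M - K \<Longrightarrow> N q = 0"
  obtains \<delta> where "compact_variation M \<A> X K \<delta> (\<lambda>s q. X q + s *\<^sub>R N q)"
proof -
  let ?Y = "\<lambda>s q. X q + s *\<^sub>R N q"
  have sm: "smooth_on (S \<times> W) (\<lambda>(s, u). ?Y s (\<psi> u))" if c: "(W, \<psi>) \<in> \<A>" and S: "open S" for W \<psi> S
  proof -
    have o: "open (S \<times> W)" using S chart_open[OF c] by (rule open_Times)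
    have 1: "smooth_on (S \<times> W) (\<lambda>x. f (snd x))" if "smooth_on W f" for f :: "real^'n \<Rightarrow> 'a"
      by (rule smooth_on_compose[OF o chart_open[OF c] _ smooth_on_bounded_linear_map[OF o bounded_linear_snd] that]) auto
    have "smooth_on (S \<times> W) (\<lambda>x. (X \<circ> \<psi>) (snd x) + fst x *\<^sub>R (N \<circ> \<psi>) (snd x))"
      by (intro smooth_on_add smooth_on_scaleR o 1 imm_smooth[OF c] smooth_fieldD[OF N c] smooth_on_bounded_linear_map[OF o bounded_linear_fst])
    then show ?thesis by (simp add: split_def)
  qed
  have field: "smooth_field (?Y s)" for s
    unfolding smooth_field_def
  proof clarify
    fix W \<psi> assume c: "(W, \<psi>) \<in> \<A>"
    have "smooth_on W (\<lambda>u. ?Y s (\<psi> u))"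
      using smooth_slice[OF open_UNIV chart_open[OF c] sm[OF c open_UNIV], of s] by simp
    then show "smooth_on W (?Y s \<circ> \<psi>)" by (simp only: o_def)
  qed
  have cont: "continuous_on (UNIV \<times> M) (\<lambda>(s, q). ratio (?Y s) q)"
  proof (rule continuous_on_glue_param)
    fix W \<psi> assume c: "(W, \<psi>) \<in> \<A>"
    have o: "open (UNIV \<times> W)" by (intro open_Times open_UNIV chart_open[OF c])
    have "smooth_on (UNIV \<times> W) (\<lambda>x. det (gram (\<lambda>i. pd (\<lambda>u. ?Y (fst x) (\<psi> u)) i (snd x))))"
      by (rule smooth_on_det_gram[OF o]) (use smooth_pd_slice[OF open_UNIV chart_open[OF c] sm[OF c open_UNIV]] in \<open>auto simp: split_def\<close>)
    moreover have "smooth_on (UNIV \<times> W) (\<lambda>x. det (gram (\<lambda>i. pd (X \<circ> \<psi>) i (snd x))))"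
      by (rule smooth_on_det_gram[OF o], rule smooth_on_compose[OF o chart_open[OF c] _ smooth_on_bounded_linear_map[OF o bounded_linear_snd]
            smooth_on_pd[OF imm_smooth[OF c]]]) auto
    ultimately have "continuous_on (UNIV \<times> W) (\<lambda>x. det (gram (\<lambda>i. pd (\<lambda>u. ?Y (fst x) (\<psi> u)) i (snd x))) / det (gram (\<lambda>i. pd (X \<circ> \<psi>) i (snd x))))"
      using det_gram_pos[OF imm_frame[OF c]] by (intro continuous_on_divide smooth_on_continuous) force+
    then show "continuous_on (UNIV \<times> W) (\<lambda>(s, u). ratio (?Y s) (\<psi> u))"
      by (rule continuous_on_eq) (auto simp: ratio_eq[OF field c] metric_gram o_def)
  qed
  \<comment> \<open>At these pairs the varied map agrees with \<open>X\<close> in a neighbourhood of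
    the point, so only points of \<open>K\<close> can lose the immersion property. This is what
    admits a noncompact \<open>M\<close>.\<close>
  have at_base: "ratio (?Y s) q = 1" if q: "q \<in> M" and s: "s = 0 \<or> q \<notin> K" for s q
  proof -
    obtain W \<psi> u where c: "(W, \<psi>) \<in> \<A>" "u \<in> W" "\<psi> u = q" using chart_cover[OF q] by blast
    let ?O = "if s = 0 then W else {v\<in>W. \<psi> v \<in> M - K}"
    from chart_vimage_open[OF c(1) openin_diff_compact[OF K(1)]] have O: "open ?O" using chart_open[OF c(1)] by (cases "s = 0") simp_all
    have uO: "u \<in> ?O" using c q s by auto
    have eq: "(X \<circ> \<psi>) v = (?Y s \<circ> \<psi>) v" if "v \<in> ?O" for v using that z by (auto split: if_splits)
    have "frechet_derivative (X \<circ> \<psi>) (at u) = frechet_derivative (?Y s \<circ> \<psi>) (at u)"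
      by (rule frechet_derivative_transform_within_open[OF smooth_on_differentiable[OF imm_smooth[OF c(1)] c(2)] O uO eq])
    then have "metric (?Y s \<circ> \<psi>) u = metric (X \<circ> \<psi>) u" by (simp add: metric_def pd_def)
    moreover have "det (metric (X \<circ> \<psi>) u) > 0" unfolding metric_gram using det_gram_pos[OF imm_frame[OF c(1,2)]] .
    ultimately show ?thesis using ratio_eq[OF field c(1,2), of s] c(3) by simp
  qed
  \<comment> \<open>The nondegenerate pairs (s, q) form a relatively open set that contains all (0,
    q) with q in \<open>K\<close>; the tube lemma yields a range of s that works for all of
    \<open>K\<close>.\<close>
  have "openin (top_of_set (UNIV \<times> M)) ((UNIV \<times> M) \<inter> (\<lambda>(s, q). ratio (?Y s) q) -` (- {0}))"
    by (rule continuous_openin_preimage_gen[OF cont]) (rule open_Compl[OF closed_singleton])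
  then obtain G where G: "open G" "(UNIV \<times> M) \<inter> (\<lambda>(s, q). ratio (?Y s) q) -` (- {0}) = (UNIV \<times> M) \<inter> G"
    by (auto simp: openin_open)
  have sub: "{0} \<times> K \<subseteq> G"
  proof clarify
    fix q assume q: "q \<in> K"
    then have "(0, q) \<in> (UNIV \<times> M) \<inter> (\<lambda>(s, q). ratio (?Y s) q) -` (- {0})"
      using at_base[of q 0] K(2) by auto
    then show "(0, q) \<in> G" unfolding G(2) by blast
  qed
  obtain I where I: "open I" "0 \<in> I" "I \<times> K \<subseteq> G"
    using Elementary_Topology.tube_lemma[OF K(1) G(1) sub] by blast
  then obtain \<delta> where \<delta>: "\<delta> > 0" "ball 0 \<delta> \<subseteq> I" using openE by blast
  have nz: "ratio (?Y s) q \<noteq> 0" if s: "s \<in> {-\<delta><..<\<delta>}" and q: "q \<in> M" for s q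
  proof (cases "q \<in> K")
    case True
    have "s \<in> I" using s \<delta>(2) by (auto simp: dist_norm)
    then have "(s, q) \<in> (UNIV \<times> M) \<inter> G" using True I(3) q by auto
    then show ?thesis unfolding G(2)[symmetric] by auto
  qed (use at_base[OF q] in auto)
  have "smooth_immersion \<A> (?Y s)" if s: "s \<in> {-\<delta><..<\<delta>}" for s
    unfolding smooth_immersion_def
  proof clarify
    fix W \<psi> assume c: "(W, \<psi>) \<in> \<A>"
    have f: "smooth_on W (?Y s \<circ> \<psi>)" by (rule smooth_fieldD[OF field c])
    have "inj (frechet_derivative (?Y s \<circ> \<psi>) (at u))" if u: "u \<in> W" for u
    proof -
      have "\<psi> u \<in> M" using chart_subset[OF c] u by blast
      from nz[OF s this] have "det (metric (?Y s \<circ> \<psi>) u) \<noteq> 0" by (auto simp: ratio_eq[OF field c u])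
      then show ?thesis
        using frame_if_det_gram frame_pd_iff[OF smooth_on_differentiable[OF f u]] unfolding metric_gram by blast
    qed
    then show "smooth_on W (?Y s \<circ> \<psi>) \<and> (\<forall>u\<in>W. inj (frechet_derivative (?Y s \<circ> \<psi>) (at u)))" using f by blast
  qed
  then have "compact_variation M \<A> X K \<delta> ?Y"
    unfolding compact_variation_def immersed_submanifold_def
    using \<delta>(1) K z atlas sm[OF _ open_greaterThanLessThan] by auto
  then show ?thesis by (rule that)
qed

text \<open>The linear variation X + s N has velocity \<open>N\<close>, so its \<open>rate\<close>
  at 0 is \<open>Div T N\<close>, and criticality makes the first derivative of
  \<open>F_along\<close> vanish.\<close>

lemma critical_first_variation:
  assumes crit: "F_critical T M \<A> X" and N: "smooth_field N" "normal_field \<A> X N"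
    and K: "compact K" "K \<subseteq> M" and z: "\<And>q. q \<in> M - K \<Longrightarrow> N q = 0"
  shows "(\<integral>q. indicator K q * (exp (T \<bullet> X q) * Div T N q) \<partial>vol) = 0"
proof -
  let ?Y = "\<lambda>s q. X q + s *\<^sub>R N q"
  obtain \<delta> where cv: "compact_variation M \<A> X K \<delta> ?Y" using linear_variation[OF N(1) K z] by blast
  interpret V: variation M \<A> X K \<delta> ?Y T by unfold_locales (rule cv)
  have d: "((\<lambda>s. ?Y s q) has_vector_derivative N q) (at s)" for q s
    by (auto intro!: derivative_eq_intros)
  then have sd: "sd ?Y 0 = N" by (auto simp: sd_def fun_eq_iff vector_derivative_at)
  have "normal_variation M \<A> X K \<delta> ?Y N"
    unfolding normal_variation_def using cv d N(2) by blast
  then have 0: "(F_along T M \<A> X K ?Y has_real_derivative 0) (at 0)"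
    using crit unfolding F_critical_def by blast
  have "(F_along T M \<A> X K ?Y has_real_derivative (\<integral>q. indicator K q * (V.wt 0 q * V.rate 0 q) \<partial>vol)) (at 0)"
    by (rule V.F_along_derivative) (use V.eps_pos in auto)
  from DERIV_unique[OF this 0] have "(\<integral>q. indicator K q * (V.wt 0 q * V.rate 0 q) \<partial>vol) = 0" .
  moreover have "V.rate 0 = Div T N" unfolding V.rate_def Div_def sd by simp
  moreover have "(\<integral>q. indicator K q * (V.wt 0 q * Div T N q) \<partial>vol) = (\<integral>q. indicator K q * (exp (T \<bullet> X q) * Div T N q) \<partial>vol)"
    by (rule Bochner_Integration.integral_cong[OF refl]) (use V.wt_0 in simp)
  ultimately show ?thesis by simp
qed

end

section \<open>Splitting the second variation\<close>

context variation
begin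

lemma sd_outside:
  assumes "q \<in> M - K" "s \<in> S" shows "sd Y s q = 0"
proof -
  have "((\<lambda>t. X q) has_vector_derivative 0) (at s)" by simp
  then have "((\<lambda>t. Y t q) has_vector_derivative 0) (at s)"
    by (rule has_vector_derivative_transform_within_open[OF _ open_greaterThanLessThan assms(2)]) (use Y_outside assms in auto)
  then show ?thesis by (simp add: sd_def vector_derivative_at)
qed

lemma sd_sd_outside:
  assumes "q \<in> M - K" "s \<in> S" shows "sd (sd Y) s q = 0"
proof -
  have "((\<lambda>t. 0) has_vector_derivative 0) (at s)" by simp
  then have "((\<lambda>t. sd Y t q) has_vector_derivative 0) (at s)"
    by (rule has_vector_derivative_transform_within_open[OF _ open_greaterThanLessThan assms(2)]) (use sd_outside assms in auto)
  then show ?thesis by (simp add: sd_def[of "sd Y"] vector_derivative_at)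
qed

context
  fixes V :: "'m \<Rightarrow> 'a"
  assumes V: "\<And>q. q \<in> M \<Longrightarrow> ((\<lambda>s. Y s q) has_vector_derivative V q) (at 0)" and normal: "normal_field \<A> X V"
begin

lemma V_eq: "q \<in> M \<Longrightarrow> V q = sd Y 0 q"
  unfolding sd_def by (rule vector_derivative_at[OF V, symmetric])

lemma V_field: "smooth_field V"
  unfolding smooth_field_def
proof clarify
  fix W \<psi> assume c: "(W, \<psi>) \<in> \<A>"
  show "smooth_on W (V \<circ> \<psi>)"
    by (rule smooth_on_cong[OF chart_open[OF c] _ smooth_fieldD[OF Y_sd_field[OF zero_in_S] c]])
      (use chart_subset[OF c] V_eq in auto)
qed

lemma V_outside: "q \<in> M - K \<Longrightarrow> V q = 0"
  using V_eq sd_outside[OF _ zero_in_S] by simp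

abbreviation "Z \<equiv> sd (sd Y) 0"

lemma Z_field: "smooth_field Z" by (rule Y_sd_sd_field[OF zero_in_S])

lemma normal_V_chart: "(W, \<psi>) \<in> \<A> \<Longrightarrow> u \<in> W \<Longrightarrow> (V \<circ> \<psi>) u \<bullet> pd (X \<circ> \<psi>) i u = 0"
  using normal local_immersion.normal_space_iff[OF local_immersion_chart] unfolding normal_field_def by fastforce

text \<open>This field and \<open>tan_part\<close> join a projection of the acceleration to a term
  built from the velocity alone. Both are glued because projections, divergence and gradient are
  given as chart expressions.\<close>

definition nor_part :: "'m \<Rightarrow> 'a" where
  "nor_part = glue (\<lambda>\<psi> u. nor_proj (X \<circ> \<psi>) u (Z (\<psi> u)) + div_drift T (X \<circ> \<psi>) (V \<circ> \<psi>) u *\<^sub>R V (\<psi> u))"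

definition tan_part :: "'m \<Rightarrow> 'a" where
  "tan_part = glue (\<lambda>\<psi> u. tan_proj (X \<circ> \<psi>) u (Z (\<psi> u)) + local_immersion.grad_half_sq (X \<circ> \<psi>) (V \<circ> \<psi>) u)"

lemma nor_part_chart:
  assumes c: "(W, \<psi>) \<in> \<A>" "u \<in> W"
  shows "nor_part (\<psi> u) = nor_proj (X \<circ> \<psi>) u (Z (\<psi> u)) + div_drift T (X \<circ> \<psi>) (V \<circ> \<psi>) u *\<^sub>R V (\<psi> u)"
  unfolding nor_part_def
proof (rule glue_eq[OF chart_indepI c])
  fix W1 \<psi>1 W2 \<psi>2 u assume c: "(W1, \<psi>1) \<in> \<A>" "(W2, \<psi>2) \<in> \<A>" and u: "u \<in> overlap W1 \<psi>1 W2 \<psi>2"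
  let ?t = "trans_map \<psi>1 W2 \<psi>2"
  interpret C: chart_change "overlap W1 \<psi>1 W2 \<psi>2" "X \<circ> \<psi>1" W2 "X \<circ> \<psi>2" ?t by (rule chart_change_charts[OF c])
  have "div_drift T (X \<circ> \<psi>1) (V \<circ> \<psi>1) u = div_drift T (X \<circ> \<psi>2) (V \<circ> \<psi>2) (?t u)"
    by (rule C.div_drift_change[OF u C1_field_differentiable[OF smooth_field_C1[OF V_field] c(2) trans_map_in[OF c u]]])
      (use trans_map_eq[OF c] in auto)
  then show "nor_proj (X \<circ> \<psi>1) u (Z (\<psi>1 u)) + div_drift T (X \<circ> \<psi>1) (V \<circ> \<psi>1) u *\<^sub>R V (\<psi>1 u) =
    nor_proj (X \<circ> \<psi>2) (?t u) (Z (\<psi>2 (?t u))) + div_drift T (X \<circ> \<psi>2) (V \<circ> \<psi>2) (?t u) *\<^sub>R V (\<psi>2 (?t u))"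
    by (simp add: C.nor_proj_change[OF u] trans_map_eq[OF c u])
qed

lemma tan_part_chart:
  assumes c: "(W, \<psi>) \<in> \<A>" "u \<in> W"
  shows "tan_part (\<psi> u) = tan_proj (X \<circ> \<psi>) u (Z (\<psi> u)) + local_immersion.grad_half_sq (X \<circ> \<psi>) (V \<circ> \<psi>) u"
  unfolding tan_part_def
proof (rule glue_eq[OF chart_indepI c])
  fix W1 \<psi>1 W2 \<psi>2 u assume c: "(W1, \<psi>1) \<in> \<A>" "(W2, \<psi>2) \<in> \<A>" and u: "u \<in> overlap W1 \<psi>1 W2 \<psi>2"
  let ?t = "trans_map \<psi>1 W2 \<psi>2"
  interpret C: chart_change "overlap W1 \<psi>1 W2 \<psi>2" "X \<circ> \<psi>1" W2 "X \<circ> \<psi>2" ?t by (rule chart_change_charts[OF c])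
  have "C.A.grad_half_sq (V \<circ> \<psi>1) u = C.B.grad_half_sq (V \<circ> \<psi>2) (?t u)"
    by (rule C.grad_half_sq_change[OF smooth_fieldD[OF V_field c(2)] _ u]) (use trans_map_eq[OF c] in auto)
  then show "tan_proj (X \<circ> \<psi>1) u (Z (\<psi>1 u)) + local_immersion.grad_half_sq (X \<circ> \<psi>1) (V \<circ> \<psi>1) u =
    tan_proj (X \<circ> \<psi>2) (?t u) (Z (\<psi>2 (?t u))) + local_immersion.grad_half_sq (X \<circ> \<psi>2) (V \<circ> \<psi>2) (?t u)"
    by (simp add: C.A.tan_proj_eq[OF u] C.B.tan_proj_eq[OF trans_map_in[OF c u]] C.tproj_change[OF u] trans_map_eq[OF c u])
qed

lemma nor_part_field: "smooth_field nor_part"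
  unfolding smooth_field_def
proof clarify
  fix W \<psi> assume c: "(W, \<psi>) \<in> \<A>"
  interpret L: local_immersion W "X \<circ> \<psi>" by (rule local_immersion_chart[OF c])
  have "smooth_on W (\<lambda>u. nor_proj (X \<circ> \<psi>) u ((Z \<circ> \<psi>) u) + div_drift T (X \<circ> \<psi>) (V \<circ> \<psi>) u *\<^sub>R (V \<circ> \<psi>) u)"
    by (intro smooth_on_add smooth_on_scaleR L.open_W L.smooth_nor_proj L.smooth_div_drift smooth_fieldD[OF V_field c] smooth_fieldD[OF Z_field c])
  then show "smooth_on W (nor_part \<circ> \<psi>)"
    by (rule smooth_on_cong[OF L.open_W, rotated]) (simp add: nor_part_chart[OF c])
qed

lemma nor_part_normal: "normal_field \<A> X nor_part"
  unfolding normal_field_def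
proof clarify
  fix W \<psi> u assume c: "(W, \<psi>) \<in> \<A>" and u: "u \<in> W"
  interpret L: local_immersion W "X \<circ> \<psi>" by (rule local_immersion_chart[OF c])
  show "nor_part (\<psi> u) \<in> normal_space (X \<circ> \<psi>) u"
    unfolding L.normal_space_iff[OF u] using normal_V_chart[OF c u]
    by (simp add: nor_part_chart[OF c u] inner_add_left L.nor_proj_inner[OF u])
qed

lemma tan_part_field: "smooth_field tan_part"
  unfolding smooth_field_def
proof clarify
  fix W \<psi> assume c: "(W, \<psi>) \<in> \<A>"
  interpret L: local_immersion W "X \<circ> \<psi>" by (rule local_immersion_chart[OF c])
  have "smooth_on W (\<lambda>u. tproj (\<lambda>i. pd (X \<circ> \<psi>) i u) ((Z \<circ> \<psi>) u) + L.grad_half_sq (V \<circ> \<psi>) u)"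
    by (intro smooth_on_add L.open_W L.smooth_tproj L.smooth_grad_half_sq smooth_fieldD[OF V_field c] smooth_fieldD[OF Z_field c])
  then show "smooth_on W (tan_part \<circ> \<psi>)"
    by (rule smooth_on_cong[OF L.open_W, rotated]) (simp add: tan_part_chart[OF c] L.tan_proj_eq)
qed

lemma tan_part_tangent: "tangent_field tan_part"
  unfolding tangent_field_def
proof clarify
  fix W \<psi> u assume c: "(W, \<psi>) \<in> \<A>" and u: "u \<in> W"
  interpret L: local_immersion W "X \<circ> \<psi>" by (rule local_immersion_chart[OF c])
  let ?e = "\<lambda>i. pd (X \<circ> \<psi>) i u"
  have "tproj ?e (\<Sum>i\<in>UNIV. \<Sum>j\<in>UNIV. a i j *\<^sub>R ?e i) = (\<Sum>i\<in>UNIV. \<Sum>j\<in>UNIV. a i j *\<^sub>R ?e i)" for a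
    by (simp add: linear_sum[OF linear_tproj] linear_cmul[OF linear_tproj] tproj_basis[OF L.frame_\<phi>[OF u]])
  then have "tproj ?e (tproj ?e x) = tproj ?e x" "tproj ?e (L.grad_half_sq (V \<circ> \<psi>) u) = L.grad_half_sq (V \<circ> \<psi>) u" for x
    unfolding L.grad_half_sq_def by (simp_all add: tproj_def[of _ x])
  then show "tan_proj (X \<circ> \<psi>) u (tan_part (\<psi> u)) = tan_part (\<psi> u)"
    by (simp add: tan_part_chart[OF c u] L.tan_proj_eq[OF u] linear_add[OF linear_tproj])
qed

lemma
  assumes q: "q \<in> M - K"
  shows nor_part_outside: "nor_part q = 0" and tan_part_outside: "tan_part q = 0"
proof -
  obtain W \<psi> u where c: "(W, \<psi>) \<in> \<A>" "u \<in> W" "\<psi> u = q" using chart_cover[of q] q by blast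
  interpret L: local_immersion W "X \<circ> \<psi>" by (rule local_immersion_chart[OF c(1)])
  have "V (\<psi> u) = 0" "Z (\<psi> u) = 0" using V_outside[OF q] sd_sd_outside[OF q zero_in_S] c(3) by auto
  then show "nor_part q = 0" "tan_part q = 0"
    using nor_part_chart[OF c(1,2)] tan_part_chart[OF c(1,2)] c(3)
    by (simp_all add: L.nor_proj_eq[OF c(2)] L.tan_proj_eq[OF c(2)] L.grad_half_sq_def tproj_def)
qed

lemma second_variation_pointwise:
  assumes q: "q \<in> M"
  shows "(rate 0 q)\<^sup>2 + rate' 0 q = Div T nor_part q + Div T tan_part q - V q \<bullet> L_op T \<A> X V q"
proof -
  obtain W \<psi> u where c: "(W, \<psi>) \<in> \<A>" "u \<in> W" "\<psi> u = q" using chart_cover[OF q] by blast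
  interpret L: local_immersion W "X \<circ> \<psi>" by (rule local_immersion_chart[OF c(1)])
  interpret L0: local_immersion W "\<lambda>u. Y 0 (\<psi> u)"
    using L.open_W smooth_fieldD[OF Y_field[OF zero_in_S] c(1)] Y_frame[OF c(1) zero_in_S] by unfold_locales (auto simp: o_def)
  note sV = smooth_fieldD[OF V_field c(1)] and sZ = smooth_fieldD[OF Z_field c(1)]
  have sub: "\<psi> v \<in> M" if "v \<in> W" for v using chart_subset[OF c(1)] that by blast
  \<comment> \<open>\<open>Y 0\<close> equals \<open>X\<close>, and the velocity equals
    \<open>V\<close>, only on \<open>M\<close>; derivatives are therefore compared on the open set
    \<open>W\<close>.\<close>
  have 1: "pd (\<lambda>u. Y 0 (\<psi> u)) i u = pd (X \<circ> \<psi>) i u" for i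
    by (rule L.pd_cong[OF _ c(2) L0.diff_\<phi>[OF c(2)]]) (simp add: Y_0 sub)
  have 2: "sd (\<lambda>s u. Y s (\<psi> u)) 0 v = (V \<circ> \<psi>) v" if "v \<in> W" for v
    using V_eq[OF sub[OF that]] by (simp add: sd_def)
  have 3: "pd (sd (\<lambda>s u. Y s (\<psi> u)) 0) i u = pd (V \<circ> \<psi>) i u" for i
    by (rule sym, rule L.pd_cong[OF _ c(2) smooth_on_differentiable[OF sV c(2)]]) (simp add: 2)
  have 4: "sd (sd (\<lambda>s u. Y s (\<psi> u))) 0 = Z \<circ> \<psi>" by (simp add: sd_def fun_eq_iff)
  have rate: "rate 0 q = div_drift T (X \<circ> \<psi>) (V \<circ> \<psi>) u"
    using rate_chart[OF c(1,2) zero_in_S] c(3) by (simp add: div_drift_def 1 3 2[OF c(2)])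
  have rate': "rate' 0 q = div_drift T (X \<circ> \<psi>) (Z \<circ> \<psi>) u + L.quad (V \<circ> \<psi>) u"
    using rate'_chart[OF c(1,2) zero_in_S] c(3) by (simp only: div_drift_def 1 3 4 L.quad_def L0.quad_def)
  have n: "Div T nor_part q = div_drift T (X \<circ> \<psi>) (\<lambda>v. nor_proj (X \<circ> \<psi>) v ((Z \<circ> \<psi>) v) + div_drift T (X \<circ> \<psi>) (V \<circ> \<psi>) v *\<^sub>R (V \<circ> \<psi>) v) u"
    unfolding Div_chart[OF smooth_field_C1[OF nor_part_field] c(1,2), unfolded c(3)]
    by (rule div_drift_cong[OF L.open_W c(2) _ smooth_on_differentiable[OF smooth_fieldD[OF nor_part_field c(1)] c(2)]])
      (simp add: nor_part_chart[OF c(1)])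
  have t: "Div T tan_part q = div_drift T (X \<circ> \<psi>) (\<lambda>v. tan_proj (X \<circ> \<psi>) v ((Z \<circ> \<psi>) v) + L.grad_half_sq (V \<circ> \<psi>) v) u"
    unfolding Div_chart[OF smooth_field_C1[OF tan_part_field] c(1,2), unfolded c(3)]
    by (rule div_drift_cong[OF L.open_W c(2) _ smooth_on_differentiable[OF smooth_fieldD[OF tan_part_field c(1)] c(2)]])
      (simp add: tan_part_chart[OF c(1)])
  have "V q \<bullet> L_op T \<A> X V q = (V \<circ> \<psi>) u \<bullet> L_local T (X \<circ> \<psi>) (V \<circ> \<psi>) u"
    using L_op_eq[OF V_field c(1,2), of T] c(3) by simp
  then show ?thesis
    unfolding rate rate' n t
    using L.density_second_variation[OF sV normal_V_chart[OF c(1)] c(2) sZ, of T] by linarith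
qed

lemma second_variation:
  assumes crit: "F_critical T M \<A> X"
  shows "integrable vol (\<lambda>q. - (V q \<bullet> L_op T \<A> X V q) * exp (T \<bullet> X q))"
    and "has_second_derivative (F_along T M \<A> X K Y) (\<integral>q. - (V q \<bullet> L_op T \<A> X V q) * exp (T \<bullet> X q) \<partial>vol) 0"
proof -
  let ?h = "\<lambda>q. - (V q \<bullet> L_op T \<A> X V q) * exp (T \<bullet> X q)"
  let ?n = "\<lambda>q. exp (T \<bullet> X q) * Div T nor_part q" and ?t = "\<lambda>q. exp (T \<bullet> X q) * Div T tan_part q"
  note nC = smooth_field_C1[OF nor_part_field] and tC = smooth_field_C1[OF tan_part_field]
  \<comment> \<open>The pointwise identity is read backwards: continuity of <V, LV> follows from
    that of the other terms, without a direct study of \<open>L_op\<close>.\<close>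
  have "continuous_on M (\<lambda>q. ((rate 0 q)\<^sup>2 + rate' 0 q - Div T nor_part q - Div T tan_part q) * exp (T \<bullet> X q))"
    by (intro continuous_intros continuous_immersion Div_continuous nC tC continuous_at_time[OF rate_continuous zero_in_S] continuous_at_time[OF rate'_continuous zero_in_S])
  then have "continuous_on M ?h"
    by (rule continuous_on_eq) (simp add: second_variation_pointwise)
  from integrable_vol_compact[OF this compact_K K_sub] have ih: "integrable vol (\<lambda>q. indicator K q * ?h q)" .
  have hK: "indicator K q * ?h q = ?h q" if "q \<in> M" for q
    using V_outside[of q] that by (auto simp: indicator_def)
  show "integrable vol ?h"
    by (rule Bochner_Integration.integrable_cong[THEN iffD1, OF refl _ ih]) (use hK in simp)
  have in': "integrable vol (\<lambda>q. indicator K q * ?n q)" and it: "integrable vol (\<lambda>q. indicator K q * ?t q)"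
    by (intro integrable_vol_compact compact_K K_sub continuous_intros continuous_immersion Div_continuous nC tC)+
  have n0: "(\<integral>q. indicator K q * ?n q \<partial>vol) = 0"
    by (rule critical_first_variation[OF crit nor_part_field nor_part_normal compact_K K_sub nor_part_outside])
  have "(\<integral>q. indicator K q * ?t q \<partial>vol) = (\<integral>q. ?t q \<partial>vol)"
    by (rule Bochner_Integration.integral_cong[OF refl])
      (use Div_outside[OF tC compact_K tan_part_outside] in \<open>auto simp: indicator_def\<close>)
  then have t0: "(\<integral>q. indicator K q * ?t q \<partial>vol) = 0"
    using divergence_theorem[OF compact_K K_sub tC tan_part_tangent tan_part_outside] by simp
  have "(\<integral>q. indicator K q * (wt 0 q * ((rate 0 q)\<^sup>2 + rate' 0 q)) \<partial>vol) =
    (\<integral>q. (indicator K q * ?n q + indicator K q * ?t q) + indicator K q * ?h q \<partial>vol)"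
  proof (rule Bochner_Integration.integral_cong[OF refl])
    fix q assume "q \<in> space vol"
    then have q: "q \<in> M" by simp
    show "indicator K q * (wt 0 q * ((rate 0 q)\<^sup>2 + rate' 0 q)) = (indicator K q * ?n q + indicator K q * ?t q) + indicator K q * ?h q"
      unfolding second_variation_pointwise[OF q] wt_0[OF q] by (simp add: algebra_simps)
  qed
  also have "\<dots> = (\<integral>q. indicator K q * ?n q + indicator K q * ?t q \<partial>vol) + (\<integral>q. indicator K q * ?h q \<partial>vol)"
    by (rule Bochner_Integration.integral_add[OF Bochner_Integration.integrable_add[OF in' it] ih])
  also have "(\<integral>q. indicator K q * ?n q + indicator K q * ?t q \<partial>vol) = 0"
    unfolding Bochner_Integration.integral_add[OF in' it] n0 t0 by simp
  also have "(\<integral>q. indicator K q * ?h q \<partial>vol) = (\<integral>q. ?h q \<partial>vol)"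
    by (rule Bochner_Integration.integral_cong[OF refl]) (use hK in simp)
  finally have D: "(\<integral>q. indicator K q * (wt 0 q * ((rate 0 q)\<^sup>2 + rate' 0 q)) \<partial>vol) = (\<integral>q. ?h q \<partial>vol)" by simp
  have "\<forall>\<^sub>F s in nhds 0. s \<in> {-\<epsilon>/2<..<\<epsilon>/2}"
    by (rule eventually_nhds_in_open) (use eps_pos in auto)
  then have "\<forall>\<^sub>F s in nhds 0. (F_along T M \<A> X K Y has_real_derivative (\<integral>q. indicator K q * (wt s q * rate s q) \<partial>vol)) (at s)"
    by (rule eventually_mono) (rule F_along_derivative)
  then show "has_second_derivative (F_along T M \<A> X K Y) (\<integral>q. ?h q \<partial>vol) 0"
    unfolding has_second_derivative_def
    by (intro exI[of _ "\<lambda>s. \<integral>q. indicator K q * (wt s q * rate s q) \<partial>vol"] conjI F_along_second_derivative[unfolded D])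
qed

end

end

theorem theorem2p3:
  fixes T :: "'a::euclidean_space"
    and M :: "'m::{t2_space,second_countable_topology} set"
    and \<A> :: "('n::finite, 'm) atlas"
    and X V :: "'m \<Rightarrow> 'a"
    and Y :: "real \<Rightarrow> 'm \<Rightarrow> 'a"
    and K :: "'m set"
    and \<epsilon> :: real
    and p :: nat
  assumes dim: "DIM('a) = CARD('n) + p"
    and submanifold: "immersed_submanifold M \<A> X"
    and critical: "F_critical T M \<A> X"
    and variation: "normal_variation M \<A> X K \<epsilon> Y V"
  shows "integrable (volume_measure M \<A> X) (\<lambda>q. - (V q \<bullet> L_op T \<A> X V q) * exp (T \<bullet> X q))
    \<and> has_second_derivative (F_along T M \<A> X K Y)
        (LINT q|volume_measure M \<A> X. - (V q \<bullet> L_op T \<A> X V q) * exp (T \<bullet> X q)) 0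
    \<and> (\<forall>(W,\<psi>)\<in>\<A>. \<forall>u\<in>W.
         L_op T \<A> X V (\<psi> u) =
           nor_laplacian (X \<circ> \<psi>) (V \<circ> \<psi>) u
           + nor_conn (X \<circ> \<psi>) (\<lambda>w. tan_proj (X \<circ> \<psi>) w T) (V \<circ> \<psi>) u
           + AVA (X \<circ> \<psi>) (V \<circ> \<psi>) u)
    \<and> (\<forall>(W,\<psi>)\<in>\<A>. \<forall>U e. open U \<and> U \<subseteq> W \<and> orthonormal_normal_frame p (X \<circ> \<psi>) U e \<longrightarrow>
         (\<forall>u\<in>U. L_op T \<A> X V (\<psi> u) = L_components p T (X \<circ> \<psi>) e (V \<circ> \<psi>) u))"
proof -
  interpret submanifold M \<A> X
    using submanifold unfolding immersed_submanifold_def by unfold_locales auto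
  have cv: "compact_variation M \<A> X K \<epsilon> Y" and V: "\<And>q. q \<in> M \<Longrightarrow> ((\<lambda>s. Y s q) has_vector_derivative V q) (at 0)"
    and normal: "normal_field \<A> X V"
    using variation unfolding normal_variation_def by auto
  interpret variation M \<A> X K \<epsilon> Y T by unfold_locales (rule cv)
  note sV = V_field[OF V normal]
  have 3: "L_op T \<A> X V (\<psi> u) = nor_laplacian (X \<circ> \<psi>) (V \<circ> \<psi>) u
           + nor_conn (X \<circ> \<psi>) (\<lambda>w. tan_proj (X \<circ> \<psi>) w T) (V \<circ> \<psi>) u + AVA (X \<circ> \<psi>) (V \<circ> \<psi>) u"
    if "(W, \<psi>) \<in> \<A>" "u \<in> W" for W \<psi> u
    using L_op_eq[OF sV that, of T] by (simp only: L_local_def)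
  have 4: "L_op T \<A> X V (\<psi> u) = L_components p T (X \<circ> \<psi>) e (V \<circ> \<psi>) u"
    if c: "(W, \<psi>) \<in> \<A>" and U: "U \<subseteq> W" "orthonormal_normal_frame p (X \<circ> \<psi>) U e" "u \<in> U" for W \<psi> U e u
  proof -
    interpret L: local_immersion W "X \<circ> \<psi>" by (rule local_immersion_chart[OF c])
    have u: "u \<in> W" using U by blast
    have "L_local T (X \<circ> \<psi>) (V \<circ> \<psi>) u = L_components p T (X \<circ> \<psi>) e (V \<circ> \<psi>) u"
    proof (rule L.L_components_eq[OF u smooth_fieldD[OF sV c] dim])
      show "e \<alpha> u \<bullet> pd (X \<circ> \<psi>) i u = 0" if "\<alpha> < p" for \<alpha> i
        using U that L.normal_space_iff[OF u] unfolding orthonormal_normal_frame_def by blast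
      show "e \<alpha> u \<bullet> e \<beta> u = (if \<alpha> = \<beta> then 1 else 0)" if "\<alpha> < p" "\<beta> < p" for \<alpha> \<beta>
        using U that unfolding orthonormal_normal_frame_def by blast
      show "(V \<circ> \<psi>) u \<bullet> pd (X \<circ> \<psi>) i u = 0" for i
        by (rule normal_V_chart[OF V normal c u])
    qed
    then show ?thesis using L_op_eq[OF sV c u, of T] by simp
  qed
  show ?thesis
    using second_variation[OF V normal critical] 3 4 by blast
qed

end
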